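(* Let $n\ge 1$ be an integer, $1<p<2$, $K>0$ and $0<q<1/p$, and let \[ \Theta=\{(x,t)\in\mathbf{R}^{n}\times\mathbf{R}: |x|<K(-t)^{q} \text{ and } -1<t<0\}. \] Then there is a traditional barrier at $(0,0)$ for $\Theta$ (with respect to the $p$-parabolic equation $\partial_t u-\operatorname{div}(|\nabla u|^{p-2}\nabla u)=0$), despite the fact that $(0,0)$ is irregular with respect to $\Theta$; that is, a traditional barrier at $(0,0)$ exists and $(0,0)$ is irregular.
   Context: The $p$-parabolic equation is $\partial_t u-\Delta_p u:=\partial_t u-\operatorname{div}(|\nabla u|^{p-2}\nabla u)=0$; gradient and divergence are taken with respect to $x\in\mathbf{R}^n$ only. Let $\Theta\subset\mathbf{R}^{n+1}$ be a nonempty bounded open set, $\partial\Theta$ its (topological) boundary in $\mathbf{R}^{n+1}$. For open $U\subset\mathbf{R}^n$ and $t_1<t_2$, put $U_{t_1,t_2}=U\times(t_1,t_2)$, with parabolic boundary $\partial_p U_{t_1,t_2}=(\overline U\times\{t_1\})\cup(\partial U\times(t_1,t_2])$. The space $L^p(t_1,t_2;W^{1,p}(U))$ consists of functions $u(x,t)$ with $u(\cdot,t)\in W^{1,p}(U)$ for a.e. $t\in(t_1,t_2)$ and $\int_{t_1}^{t_2}\int_U(|u|^p+|\nabla u|^p)\,dx\,dt<\infty$. The space $C([t_1,t_2];L^2(U))$ consists of functions $u(x,t)$ such that $t\mapsto\int_U|u(x,t)|^2\,dx$ is continuous on $[t_1,t_2]$. Weak solution: $u:\Theta\to[-\infty,\infty]$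 is a weak solution if for every open cylinder $U_{t_1,t_2}\Subset\Theta$ we have $u\in C([t_1,t_2];L^2(U))\cap L^p(t_1,t_2;W^{1,p}(U))$ and $\int_{t_1}^{t_2}\int_U|\nabla u|^{p-2}\nabla u\cdot\nabla\varphi\,dx\,dt-\int_{t_1}^{t_2}\int_U u\,\partial_t\varphi\,dx\,dt=0$ for all $\varphi\in C_0^\infty(U_{t_1,t_2})$. A $p$-parabolic function is a continuous weak solution. A function $u:\Theta\to(-\infty,\infty]$ is $p$-superparabolic if (i) $u$ is lower semicontinuous; (ii) $u$ is finite in a dense subset of $\Theta$; (iii) for every space-time box $Q_{t_1,t_2}=Q\times(t_1,t_2)\Subset\Theta$, with $Q=(a_1,b_1)\times\cdots\times(a_n,b_n)$, if $h$ is $p$-parabolic in $Q_{t_1,t_2}$, continuous on $\overline{Q}_{t_1,t_2}$ and $h\le u$ on $\partial_pQ_{t_1,t_2}$, then $h\le u$ in $Q_{t_1,t_2}$. Upper Perron solution: for bounded $f:\partial\Theta\to\mathbf{R}$, let $\mathcal{U}_f(\Theta)$ be the set of all $p$-superparabolic functions $u$ on $\Theta$ that are bounded below and satisfy $\liminf_{\Theta\ni\eta\to\xi}u(\eta)\ge f(\xi)$ for all $\xi\in\partial\Theta$; put $\overline{H}f(\xi)=\inf_{u\in\mathcal{U}_f(\Theta)}u(\xi)$ for $\xi\in\Theta$. A boundary point $\xi_0\in\partial\Theta$ is regular with respect to $\Theta$ if $\lim_{\Theta\ni\xi\to\xi_0}\overline{H}f(\xi)=f(\xi_0)$ for every continuous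 $f:\partial\Theta\to\mathbf{R}$; otherwise it is irregular. A traditional barrier at $\xi_0\in\partial\Theta$ for $\Theta$ is a function $u$ such that (a) $u$ is a positive $p$-superparabolic function in $\Theta$; (b) $\lim_{\Theta\ni\zeta\to\xi_0}u(\zeta)=0$; (c) $\liminf_{\Theta\ni\zeta\to\xi}u(\zeta)>0$ for all $\xi\in\partial\Theta\setminus\{\xi_0\}$. *)

theory Defs
  imports "HOL-Analysis.Analysis"
begin

text \<open>
  Points of space-time are pairs \<open>(x, t)\<close> of type \<open>(real^'n) \<times> real\<close>. Functions on a set
  are total functions of which only the values on that set matter.
\<close>

definition compactly_contained :: "'a::topological_space set \<Rightarrow> 'a set \<Rightarrow> bool" where
  "compactly_contained A B \<longleftrightarrow> compact (closure A) \<and> closure A \<subseteq> B"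

primrec C_k :: "nat \<Rightarrow> ('a::real_normed_vector \<Rightarrow> real) \<Rightarrow> bool" where
  "C_k 0 f \<longleftrightarrow> continuous_on UNIV f"
| "C_k (Suc k) f \<longleftrightarrow> (\<forall>x. f differentiable (at x)) \<and>
     (\<forall>v. C_k k (\<lambda>x. frechet_derivative f (at x) v))"

text \<open>The space of smooth functions with compact support in \<open>U\<close>, extended by zero.\<close>

definition test_function :: "'a::real_normed_vector set \<Rightarrow> ('a \<Rightarrow> real) \<Rightarrow> bool" where
  "test_function U \<phi> \<longleftrightarrow> (\<forall>k. C_k k \<phi>) \<and> compactly_contained {x. \<phi> x \<noteq> 0} U"

definition space_gradient :: "((real^'n) \<times> real \<Rightarrow> real) \<Rightarrow> (real^'n) \<times> real \<Rightarrow> real^'n" where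
  "space_gradient \<phi> z = (\<chi> i. frechet_derivative \<phi> (at z) (axis i 1, 0))"

definition time_derivative :: "((real^'n) \<times> real \<Rightarrow> real) \<Rightarrow> (real^'n) \<times> real \<Rightarrow> real" where
  "time_derivative \<phi> z = frechet_derivative \<phi> (at z) (0, 1)"

definition Lp_on ::
  "real \<Rightarrow> 'a::euclidean_space set \<Rightarrow> ('a \<Rightarrow> 'b::euclidean_space) \<Rightarrow> bool" where
  "Lp_on p S f \<longleftrightarrow> f \<in> borel_measurable (lebesgue_on S) \<and>
     integrable (lebesgue_on S) (\<lambda>x. norm (f x) powr p)"

text \<open>
  \<open>real_of_ereal\<close> sends both infinities to 0, so for extended-real-valued functions finiteness
  almost everywhere has to be required separately.
\<close>

definition Lp_ereal_on ::
  "real \<Rightarrow> 'a::euclidean_space set \<Rightarrow> ('a \<Rightarrow> ereal) \<Rightarrow> bool" where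
  "Lp_ereal_on p S u \<longleftrightarrow> (AE x in lebesgue_on S. \<bar>u x\<bar> \<noteq> \<infinity>) \<and>
     Lp_on p S (\<lambda>x. real_of_ereal (u x))"

text \<open>\<open>v\<close> belongs to the Sobolev space \<open>W\<^sup>1\<^sup>,\<^sup>p(U)\<close> and \<open>g\<close> is its weak gradient.\<close>

definition W1p_with_gradient ::
  "real \<Rightarrow> (real^'n) set \<Rightarrow> (real^'n \<Rightarrow> ereal) \<Rightarrow> (real^'n \<Rightarrow> real^'n) \<Rightarrow> bool" where
  "W1p_with_gradient p U v g \<longleftrightarrow> Lp_ereal_on p U v \<and> Lp_on p U g \<and>
     (\<forall>\<phi> i. test_function U \<phi> \<longrightarrow>
        (LINT x|lebesgue_on U. real_of_ereal (v x) * frechet_derivative \<phi> (at x) (axis i 1)) =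
        - (LINT x|lebesgue_on U. g x $ i * \<phi> x))"

text \<open>
  \<open>u\<close> belongs to \<open>L\<^sup>p(t1, t2; W\<^sup>1\<^sup>,\<^sup>p(U))\<close> and \<open>g\<close> is its weak gradient with respect to \<open>x\<close>
  (unique up to null sets).
\<close>

definition LpW1p_with_gradient ::
  "real \<Rightarrow> (real^'n) set \<Rightarrow> real \<Rightarrow> real \<Rightarrow> ((real^'n) \<times> real \<Rightarrow> ereal) \<Rightarrow>
     ((real^'n) \<times> real \<Rightarrow> real^'n) \<Rightarrow> bool" where
  "LpW1p_with_gradient p U t1 t2 u g \<longleftrightarrow>
     (AE t in lebesgue_on {t1<..<t2}. W1p_with_gradient p U (\<lambda>x. u (x, t)) (\<lambda>x. g (x, t))) \<and>
     Lp_ereal_on p (U \<times> {t1<..<t2}) u \<and> Lp_on p (U \<times> {t1<..<t2}) g"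

text \<open>
  Membership in \<open>C([t1, t2]; L\<^sup>2(U))\<close>, understood as continuity of the squared \<open>L\<^sup>2(U)\<close>-norm in time.
\<close>

definition in_CL2 ::
  "(real^'n) set \<Rightarrow> real \<Rightarrow> real \<Rightarrow> ((real^'n) \<times> real \<Rightarrow> ereal) \<Rightarrow> bool" where
  "in_CL2 U t1 t2 u \<longleftrightarrow> (\<forall>t\<in>{t1..t2}. Lp_ereal_on 2 U (\<lambda>x. u (x, t))) \<and>
     continuous_on {t1..t2} (\<lambda>t. LINT x|lebesgue_on U. \<bar>real_of_ereal (u (x, t))\<bar>\<^sup>2)"

text \<open>
  For \<open>g z = 0\<close> the term \<open>norm (g z) powr (p - 2) *\<^sub>R g z\<close> is 0, the usual convention for
  \<open>|\<nabla>u|\<^sup>p\<^sup>-\<^sup>2\<nabla>u\<close> when \<open>1 < p < 2\<close>.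
\<close>

definition weak_solution ::
  "real \<Rightarrow> ((real^'n) \<times> real) set \<Rightarrow> ((real^'n) \<times> real \<Rightarrow> ereal) \<Rightarrow> bool" where
  "weak_solution p \<Theta> u \<longleftrightarrow>
     (\<forall>U t1 t2. open U \<and> t1 < t2 \<and> compactly_contained (U \<times> {t1<..<t2}) \<Theta> \<longrightarrow>
        in_CL2 U t1 t2 u \<and>
        (\<exists>g. LpW1p_with_gradient p U t1 t2 u g \<and>
           (\<forall>\<phi>. test_function (U \<times> {t1<..<t2}) \<phi> \<longrightarrow>
              (LINT z|lebesgue_on (U \<times> {t1<..<t2}).
                 (norm (g z) powr (p - 2) *\<^sub>R g z) \<bullet> space_gradient \<phi> z) -
              (LINT z|lebesgue_on (U \<times> {t1<..<t2}).
                 real_of_ereal (u z) * time_derivative \<phi> z) = 0)))"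

text \<open>Continuous functions are real-valued.\<close>

definition p_parabolic ::
  "real \<Rightarrow> ((real^'n) \<times> real) set \<Rightarrow> ((real^'n) \<times> real \<Rightarrow> real) \<Rightarrow> bool" where
  "p_parabolic p \<Theta> h \<longleftrightarrow> continuous_on \<Theta> h \<and> weak_solution p \<Theta> (\<lambda>z. ereal (h z))"

definition parabolic_boundary ::
  "(real^'n) set \<Rightarrow> real \<Rightarrow> real \<Rightarrow> ((real^'n) \<times> real) set" where
  "parabolic_boundary U t1 t2 = closure U \<times> {t1} \<union> frontier U \<times> {t1<..t2}"

definition p_superparabolic ::
  "real \<Rightarrow> ((real^'n) \<times> real) set \<Rightarrow> ((real^'n) \<times> real \<Rightarrow> ereal) \<Rightarrow> bool" where
  "p_superparabolic p \<Theta> u \<longleftrightarrow>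
     (\<forall>z\<in>\<Theta>. u z \<noteq> -\<infinity>) \<and>
     (\<forall>z\<in>\<Theta>. u z \<le> Liminf (at z within \<Theta>) u) \<and>
     \<Theta> \<subseteq> closure {z\<in>\<Theta>. u z \<noteq> \<infinity>} \<and>
     (\<forall>a b t1 t2 h. t1 < t2 \<and> compactly_contained (box a b \<times> {t1<..<t2}) \<Theta> \<and>
        p_parabolic p (box a b \<times> {t1<..<t2}) h \<and>
        continuous_on (closure (box a b \<times> {t1<..<t2})) h \<and>
        (\<forall>z\<in>parabolic_boundary (box a b) t1 t2. ereal (h z) \<le> u z) \<longrightarrow>
        (\<forall>z\<in>box a b \<times> {t1<..<t2}. ereal (h z) \<le> u z))"

definition upper_class ::
  "real \<Rightarrow> ((real^'n) \<times> real) set \<Rightarrow> ((real^'n) \<times> real \<Rightarrow> real) \<Rightarrow>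
     ((real^'n) \<times> real \<Rightarrow> ereal) set" where
  "upper_class p \<Theta> f =
     {u. p_superparabolic p \<Theta> u \<and> (\<exists>c::real. \<forall>z\<in>\<Theta>. ereal c \<le> u z) \<and>
         (\<forall>\<xi>\<in>frontier \<Theta>. Liminf (at \<xi> within \<Theta>) u \<ge> ereal (f \<xi>))}"

definition upper_Perron ::
  "real \<Rightarrow> ((real^'n) \<times> real) set \<Rightarrow> ((real^'n) \<times> real \<Rightarrow> real) \<Rightarrow>
     (real^'n) \<times> real \<Rightarrow> ereal" where
  "upper_Perron p \<Theta> f \<xi> = (INF u\<in>upper_class p \<Theta> f. u \<xi>)"

text \<open>For bounded \<open>\<Theta>\<close> the boundary is compact, so continuous \<open>f\<close> are bounded on it.\<close>

definition regular_point ::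
  "real \<Rightarrow> ((real^'n) \<times> real) set \<Rightarrow> (real^'n) \<times> real \<Rightarrow> bool" where
  "regular_point p \<Theta> \<xi>0 \<longleftrightarrow> \<xi>0 \<in> frontier \<Theta> \<and>
     (\<forall>f. continuous_on (frontier \<Theta>) f \<longrightarrow>
        (upper_Perron p \<Theta> f \<longlongrightarrow> ereal (f \<xi>0)) (at \<xi>0 within \<Theta>))"

definition irregular_point ::
  "real \<Rightarrow> ((real^'n) \<times> real) set \<Rightarrow> (real^'n) \<times> real \<Rightarrow> bool" where
  "irregular_point p \<Theta> \<xi>0 \<longleftrightarrow> \<xi>0 \<in> frontier \<Theta> \<and> \<not> regular_point p \<Theta> \<xi>0"

definition traditional_barrier ::
  "real \<Rightarrow> ((real^'n) \<times> real) set \<Rightarrow> (real^'n) \<times> real \<Rightarrow>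
     ((real^'n) \<times> real \<Rightarrow> ereal) \<Rightarrow> bool" where
  "traditional_barrier p \<Theta> \<xi>0 u \<longleftrightarrow>
     p_superparabolic p \<Theta> u \<and> (\<forall>z\<in>\<Theta>. 0 < u z) \<and>
     (u \<longlongrightarrow> 0) (at \<xi>0 within \<Theta>) \<and>
     (\<forall>\<xi>\<in>frontier \<Theta> - {\<xi>0}. 0 < Liminf (at \<xi> within \<Theta>) u)"

end

theory Submission
  imports Defs
begin

text \<open>
  The domain narrows towards its last point \<open>(0, 0)\<close> like \<open>|x| < K (- t)\<^sup>q\<close>. The existence of a barrier and the irregularity of
  this point have different causes.

  For \<open>p < 2\<close> the equation has separable solutions that become extinct in finite time. The product of \<open>(- t)\<^bsup>1/(2-p)\<^esup>\<close>
  with a small concave radial profile is a supersolution (\<open>barrier_exists\<close>): it is positive for \<open>t < 0\<close>, up to the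
  lateral boundary and beyond, and tends to 0 with \<open>t\<close>. What has to be shown is that a classical supersolution lies above every
  weak solution with smaller boundary values (\<open>comparison_with_classical_supersolution\<close>). The weak
  solution is mollified in space and time, its difference from the supersolution is inserted into a pointwise energy
  argument (\<open>energy_inequality\<close>), and the monotonicity of the map \<open>v \<mapsto> |v|\<^sup>p\<^sup>-\<^sup>2 v\<close> is recovered in the limit
  (\<open>mollified_monotonicity\<close>).

  The point is irregular because at time \<open>- \<tau>\<close> a solution of size 1 needs the time \<open>w\<^sup>p\<close> to feel the boundary at distance
  \<open>w\<close>, and \<open>w\<^sup>p\<close> with \<open>w = K \<tau>\<^sup>q\<close> is much larger than the remaining time \<open>\<tau>\<close> when \<open>q p < 1\<close>. Hence a function of
  the upper class that starts with the value 1 stays above \<open>1/2\<close> on the axis, although the boundary values tend to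
  0 at the cusp point (\<open>upper_class_lower_bound\<close>). Since superparabolic functions are defined by comparison with
  solutions on boxes, the lower bound must come from explicit solutions. Affine functions already yield a minimum principle
  (\<open>superparabolic_minimum_principle\<close>), which gives the lower bounds 0 in the domain and 1 at the early times. From there, a sequence
  of boxes leads to the cusp point. On each of them the comparison function is an
  explicit radial solution (\<open>spreading_solution\<close>), and the losses form a convergent series.
\<close>

section \<open>Smooth functions\<close>

lemma C_k_imp_continuous: "C_k k f \<Longrightarrow> continuous_on UNIV f"
proof (cases k)
  case (Suc m)
  assume "C_k k f"
  then show ?thesis
    unfolding Suc by (auto simp: continuous_on_eq_continuous_at intro: differentiable_imp_continuous_within)
qed simp

lemma C_k_Suc_imp: "C_k (Suc k) f \<Longrightarrow> C_k k f"
proof (induction k arbitrary: f)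
  case 0
  then show ?case using C_k_imp_continuous by fastforce
next
  case (Suc k)
  then show ?case by (metis C_k.simps(2))
qed

lemma C_k_const: "C_k k (\<lambda>x::'a::real_normed_vector. c)"
  by (induction k arbitrary: c) simp_all

lemma C_k_linear:
  assumes "bounded_linear (L :: 'a::real_normed_vector \<Rightarrow> real)"
  shows "C_k k L"
proof (cases k)
  case 0
  then show ?thesis using assms by (simp add: linear_continuous_on)
next
  case (Suc m)
  have "frechet_derivative L (at x) = L" for x
    using frechet_derivative_at[OF bounded_linear.has_derivative[OF assms has_derivative_ident]] by simp
  then show ?thesis
    unfolding Suc using bounded_linear_imp_differentiable[OF assms] by (simp add: C_k_const)
qed

lemma C_k_add:
  "C_k k f \<Longrightarrow> C_k k g \<Longrightarrow> C_k k (\<lambda>x. f x + g x)"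
proof (induction k arbitrary: f g)
  case 0
  then show ?case by (auto intro: continuous_intros)
next
  case (Suc k)
  have "frechet_derivative (\<lambda>x. f x + g x) (at x) = (\<lambda>v. frechet_derivative f (at x) v + frechet_derivative g (at x) v)" for x
    using Suc.prems
    by (intro frechet_derivative_at[symmetric] has_derivative_add) (auto simp: frechet_derivative_works)
  with Suc show ?case by (auto intro!: differentiable_add)
qed

lemma C_k_mult:
  "C_k k f \<Longrightarrow> C_k k g \<Longrightarrow> C_k k (\<lambda>x. f x * g x)"
proof (induction k arbitrary: f g)
  case 0
  then show ?case by (auto intro: continuous_intros)
next
  case (Suc k)
  have eq: "frechet_derivative (\<lambda>x. f x * g x) (at x) =
      (\<lambda>v. f x * frechet_derivative g (at x) v + frechet_derivative f (at x) v * g x)" for x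
    using Suc.prems
    by (intro frechet_derivative_at[symmetric] has_derivative_mult) (auto simp: frechet_derivative_works)
  have "C_k k f" "C_k k g" using Suc.prems C_k_Suc_imp by blast+
  with Suc show ?case
    unfolding C_k.simps eq by (auto intro!: differentiable_mult C_k_add)
qed

text \<open>
  Translates and rescalings of a kernel and time slices of a test function are compositions of this form.
\<close>

lemma C_k_affine:
  assumes "bounded_linear L"
  shows "C_k k f \<Longrightarrow> C_k k (\<lambda>x. f (a + L x))"
proof (induction k arbitrary: f)
  case 0
  then show ?case
    using linear_continuous_on[OF assms]
    by (auto intro!: continuous_intros intro: continuous_on_compose2[of UNIV f])
next
  case (Suc k)
  have d: "((\<lambda>x. f (a + L x)) has_derivative (\<lambda>v. frechet_derivative f (at (a + L x)) (L v))) (at x)" for x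
  proof -
    have "((\<lambda>x. a + L x) has_derivative L) (at x)"
      using assms by (auto intro!: derivative_eq_intros bounded_linear.has_derivative[OF assms])
    then show ?thesis
      using has_derivative_compose[of "\<lambda>x. a + L x" L x UNIV f] Suc.prems
      by (auto simp: frechet_derivative_works)
  qed
  have eq: "frechet_derivative (\<lambda>x. f (a + L x)) (at x) = (\<lambda>v. frechet_derivative f (at (a + L x)) (L v))" for x
    using frechet_derivative_at[OF d] by simp
  show ?case
    unfolding C_k.simps eq using Suc d by (auto simp: differentiable_def)
qed

text \<open>
  The derivatives of \<open>exp (- 1 / s)\<close> are combinations of these functions, which is what makes
  them smooth across \<open>s = 0\<close>.
\<close>

definition flat_exp :: "nat \<Rightarrow> real \<Rightarrow> real" where
  "flat_exp m s = (if 0 < s then (1 / s) ^ m * exp (- (1 / s)) else 0)"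

lemma flat_exp_tendsto_0: "(flat_exp m \<longlongrightarrow> 0) (at 0)"
proof -
  have "((\<lambda>s. (1 / s) ^ m * exp (- (1 / s))) \<longlongrightarrow> 0) (at_right (0::real))"
  proof -
    have "((\<lambda>x. x ^ m / exp x) \<longlongrightarrow> (0::real)) at_top" by (rule tendsto_power_div_exp_0)
    from filterlim_compose[OF this filterlim_inverse_at_top_right]
    show ?thesis by (simp add: exp_minus divide_inverse)
  qed
  then have "(flat_exp m \<longlongrightarrow> 0) (at_right 0)"
    by (rule Lim_transform_eventually) (auto simp: flat_exp_def eventually_at_filter)
  moreover have "(flat_exp m \<longlongrightarrow> 0) (at_left 0)"
    by (rule Lim_transform_eventually[OF tendsto_const]) (auto simp: flat_exp_def eventually_at_filter)
  ultimately show ?thesis by (simp add: filterlim_split_at)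
qed

lemma DERIV_flat_exp:
  "(flat_exp m has_real_derivative flat_exp (m + 2) s - real m * flat_exp (m + 1) s) (at s)"
proof -
  consider "s > 0" | "s < 0" | "s = 0" by linarith
  then show ?thesis
  proof cases
    case 1
    have "((\<lambda>s. (1 / s) ^ m * exp (- (1 / s))) has_real_derivative
        flat_exp (m + 2) s - real m * flat_exp (m + 1) s) (at s)"
    proof -
      have "((\<lambda>s. (1 / s) ^ m * exp (- (1 / s))) has_real_derivative
          (real m * (1 / s) ^ (m - 1) * (- (1 / s\<^sup>2))) * exp (- (1 / s)) + (1 / s) ^ m * (exp (- (1 / s)) * (1 / s\<^sup>2))) (at s)"
      proof -
        have i: "((\<lambda>s. 1 / s) has_real_derivative - (1 / s\<^sup>2)) (at s)"
          using 1 DERIV_inverse[of s] by (simp add: inverse_eq_divide numeral_2_eq_2)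
        have e: "((\<lambda>s. exp (- (1 / s))) has_real_derivative exp (- (1 / s)) * (1 / s\<^sup>2)) (at s)"
          using DERIV_fun_exp[OF DERIV_minus[OF i]] by simp
        show ?thesis
          using DERIV_mult[OF DERIV_power[OF i, of m] e] by (simp add: mult_ac add.commute)
      qed
      moreover have "(real m * (1 / s) ^ (m - 1) * (- (1 / s\<^sup>2))) * exp (- (1 / s)) + (1 / s) ^ m * (exp (- (1 / s)) * (1 / s\<^sup>2))
          = flat_exp (m + 2) s - real m * flat_exp (m + 1) s"
        using 1 by (cases m) (simp_all add: flat_exp_def power2_eq_square algebra_simps add_divide_distrib)
      ultimately show ?thesis by simp
    qed
    then show ?thesis
      by (rule has_field_derivative_transform_within_open[of _ _ _ "{0<..}"]) (use 1 in \<open>auto simp: flat_exp_def\<close>)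
  next
    case 2
    have "((\<lambda>s. 0) has_real_derivative 0) (at s)" by simp
    then have "(flat_exp m has_real_derivative 0) (at s)"
      by (rule has_field_derivative_transform_within_open[of _ _ _ "{..<0}"]) (use 2 in \<open>auto simp: flat_exp_def\<close>)
    with 2 show ?thesis by (simp add: flat_exp_def)
  next
    case 3
    have "(\<lambda>h. (flat_exp m (0 + h) - flat_exp m 0) / h) \<midarrow>0\<rightarrow> 0"
    proof (rule Lim_transform_eventually[OF flat_exp_tendsto_0[of "Suc m"]])
      show "\<forall>\<^sub>F x in at 0. flat_exp (Suc m) x = (flat_exp m (0 + x) - flat_exp m 0) / x"
        by (auto simp: flat_exp_def eventually_at_filter)
    qed
    then show ?thesis unfolding 3 DERIV_def by (simp add: flat_exp_def)
  qed
qed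

text \<open>
  The square of the norm is used because, unlike the norm, it is smooth at the origin.
\<close>

definition bump :: "'a::euclidean_space \<Rightarrow> real" where
  "bump z = flat_exp 0 (1 - z \<bullet> z)"

lemma C_k_flat_exp_inner: "C_k k (\<lambda>z::'a::euclidean_space. flat_exp m (1 - z \<bullet> z))"
proof (induction k arbitrary: m)
  case 0
  have "continuous_on UNIV (flat_exp m)"
    by (meson DERIV_continuous_on DERIV_flat_exp)
  then show ?case
    by (auto intro!: continuous_intros intro: continuous_on_compose2[of UNIV "flat_exp m"])
next
  case (Suc k)
  have d: "((\<lambda>z::'a. flat_exp m (1 - z \<bullet> z)) has_derivative
     (\<lambda>v. (flat_exp (m + 2) (1 - z \<bullet> z) + (- real m) * flat_exp (m + 1) (1 - z \<bullet> z)) * ((-2) * (z \<bullet> v)))) (at z)" for z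
  proof -
    have "((\<lambda>z::'a. 1 - z \<bullet> z) has_derivative (\<lambda>v. (-2) * (z \<bullet> v))) (at z)"
      by (auto intro!: derivative_eq_intros simp: inner_commute)
    moreover have "(flat_exp m has_derivative
        (*) (flat_exp (m + 2) (1 - z \<bullet> z) + (- real m) * flat_exp (m + 1) (1 - z \<bullet> z))) (at (1 - z \<bullet> z))"
      using DERIV_flat_exp[of m "1 - z \<bullet> z"] by (simp add: has_field_derivative_def)
    ultimately show ?thesis by (rule has_derivative_compose)
  qed
  have l: "C_k k (\<lambda>z::'a. z \<bullet> v)" for v
    by (rule C_k_linear) (rule bounded_linear_inner_left)
  have eq: "frechet_derivative (\<lambda>z::'a. flat_exp m (1 - z \<bullet> z)) (at z) =
     (\<lambda>v. (flat_exp (m + 2) (1 - z \<bullet> z) + (- real m) * flat_exp (m + 1) (1 - z \<bullet> z)) * ((-2) * (z \<bullet> v)))" for z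
    using frechet_derivative_at[OF d] by simp
  show ?case
    unfolding C_k.simps eq
  proof (intro conjI allI)
    show "(\<lambda>z::'a. flat_exp m (1 - z \<bullet> z)) differentiable at x" for x
      using d differentiable_def by blast
  qed (intro C_k_mult C_k_add C_k_const l Suc)
qed

lemma bump_nonneg: "0 \<le> bump z" by (simp add: bump_def flat_exp_def)

lemma bump_eq_0: "1 \<le> norm z \<Longrightarrow> bump z = 0"
  using power_mono[of 1 "norm z" 2] by (simp add: bump_def flat_exp_def power2_norm_eq_inner)

lemma bump_0_pos: "0 < bump (0::'a::euclidean_space)" by (simp add: bump_def flat_exp_def)

lemma C_k_bump: "C_k k bump"
  using C_k_flat_exp_inner[of k 0] by (simp add: bump_def[abs_def])

section \<open>Directional derivatives and integration by parts\<close>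

text \<open>
  Derivatives along lines suffice for integration by parts, and the equation only contains derivatives in
  the coordinate directions. Hence differentiability in the sense of Frechet never has to be
  established for fluxes and mollified functions.
\<close>

definition has_dir_deriv :: "('a::real_normed_vector \<Rightarrow> real) \<Rightarrow> 'a \<Rightarrow> 'a \<Rightarrow> real \<Rightarrow> bool" where
  "has_dir_deriv f v z d \<longleftrightarrow> ((\<lambda>s. f (z + s *\<^sub>R v)) has_real_derivative d) (at 0)"

lemma has_dir_deriv_along_line:
  assumes "has_dir_deriv f v (z + s *\<^sub>R v) d"
  shows "((\<lambda>r. f (z + r *\<^sub>R v)) has_real_derivative d) (at s)"
proof -
  have "((\<lambda>r. f (z + (r + s) *\<^sub>R v)) has_real_derivative d) (at 0)"
    using assms by (simp add: has_dir_deriv_def algebra_simps)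
  then show ?thesis using DERIV_shift[of "\<lambda>r. f (z + r *\<^sub>R v)" d 0 s] by simp
qed

lemma has_dir_deriv_mult:
  "has_dir_deriv f v z a \<Longrightarrow> has_dir_deriv g v z b \<Longrightarrow> has_dir_deriv (\<lambda>x. f x * g x) v z (a * g z + f z * b)"
  unfolding has_dir_deriv_def by (auto dest: DERIV_mult simp: mult.commute add.commute)

lemma has_dir_deriv_diff:
  "has_dir_deriv f v z a \<Longrightarrow> has_dir_deriv g v z b \<Longrightarrow> has_dir_deriv (\<lambda>x. f x - g x) v z (a - b)"
  unfolding has_dir_deriv_def by (rule DERIV_diff)

lemma has_dir_deriv_const: "has_dir_deriv (\<lambda>x. c) v z 0"
  unfolding has_dir_deriv_def by simp

lemma has_dir_deriv_chain:
  assumes "has_dir_deriv f v z a" "(\<phi> has_real_derivative b) (at (f z))"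
  shows "has_dir_deriv (\<lambda>x. \<phi> (f x)) v z (b * a)"
  using assms unfolding has_dir_deriv_def
  by (intro DERIV_chain2[of \<phi>]) auto

lemma has_dir_deriv_unique: "has_dir_deriv f v z a \<Longrightarrow> has_dir_deriv f v z b \<Longrightarrow> a = b"
  unfolding has_dir_deriv_def by (rule DERIV_unique)

lemma has_dir_deriv_frechet:
  assumes "(f has_derivative f') (at z)"
  shows "has_dir_deriv f v z (f' v)"
proof -
  have "((\<lambda>s. z + s *\<^sub>R v) has_derivative (\<lambda>s. s *\<^sub>R v)) (at 0)"
    by (auto intro!: derivative_eq_intros)
  from has_derivative_compose[OF this, of f f'] assms
  have "((\<lambda>s. f (z + s *\<^sub>R v)) has_derivative (\<lambda>s. f' (s *\<^sub>R v))) (at 0)" by simp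
  moreover have "(\<lambda>s. f' (s *\<^sub>R v)) = (*) (f' v)"
    using linear_scale[OF has_derivative_linear[OF assms]] by (auto simp: mult.commute)
  ultimately show ?thesis by (simp add: has_dir_deriv_def has_field_derivative_def)
qed

lemma has_dir_deriv_test:
  "\<forall>k. C_k k \<phi> \<Longrightarrow> has_dir_deriv \<phi> v z (frechet_derivative \<phi> (at z) v)"
  by (rule has_dir_deriv_frechet) (metis C_k.simps(2) frechet_derivative_works)

lemma has_dir_deriv_transform:
  assumes "has_dir_deriv f v z d" "open W" "z \<in> W" "\<And>x. x \<in> W \<Longrightarrow> f x = g x"
  shows "has_dir_deriv g v z d"
proof -
  have o: "open ((\<lambda>s. z + s *\<^sub>R v) -` W)"
    by (rule open_vimage[OF assms(2)]) (auto intro!: continuous_intros)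
  show ?thesis
    using assms(1) unfolding has_dir_deriv_def
    by (rule has_field_derivative_transform_within_open[OF _ o]) (use assms in auto)
qed

lemma integrable_continuous_compact_support:
  fixes f :: "'a::euclidean_space \<Rightarrow> real"
  assumes "continuous_on UNIV f" "compact K" "\<And>z. z \<notin> K \<Longrightarrow> f z = 0"
  shows "integrable lborel f"
proof -
  have "integrable lborel (\<lambda>x. indicator K x *\<^sub>R f x)"
    by (rule borel_integrable_compact[OF assms(2)]) (use assms(1) continuous_on_subset in blast)
  moreover have "(\<lambda>x. indicator K x *\<^sub>R f x) = f"
    by (rule ext) (use assms(3) in \<open>auto simp: indicator_def\<close>)
  ultimately show ?thesis by simp
qed

lemma bounded_continuous_compact_support:
  fixes f :: "'a::euclidean_space \<Rightarrow> real"
  assumes "continuous_on UNIV f" "compact K" "\<And>z. z \<notin> K \<Longrightarrow> f z = 0"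
  obtains M where "M > 0" "\<And>z. \<bar>f z\<bar> \<le> M"
proof -
  have "bounded (f ` K)"
    using assms(1,2) by (intro compact_imp_bounded compact_continuous_image) (auto intro: continuous_on_subset)
  then obtain M where "M > 0" "\<And>z. z \<in> K \<Longrightarrow> norm (f z) \<le> M" by (auto simp: bounded_pos)
  then show thesis using that[of M] assms(3) by (metis abs_zero less_eq_real_def real_norm_def)
qed

lemma dir_deriv_off_support:
  assumes "compact K" "\<And>z. z \<notin> K \<Longrightarrow> \<psi> z = 0" "has_dir_deriv \<psi> v z d" "z \<notin> K"
  shows "d = 0"
proof -
  have "has_dir_deriv \<psi> v z 0"
    by (rule has_dir_deriv_transform[OF has_dir_deriv_const[of 0], of "- K"])
       (use assms compact_imp_closed in \<open>auto\<close>)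
  then show ?thesis using assms(3) has_dir_deriv_unique by blast
qed

text \<open>
  Translation invariance makes the integral of every difference quotient vanish; dominated
  convergence passes this on to the derivative.
\<close>

lemma integral_dir_deriv_eq_0:
  fixes \<psi> :: "'a::euclidean_space \<Rightarrow> real"
  assumes K: "compact K" "\<And>z. z \<notin> K \<Longrightarrow> \<psi> z = 0"
    and c: "continuous_on UNIV \<psi>" "continuous_on UNIV \<psi>'"
    and d: "\<And>z. has_dir_deriv \<psi> v z (\<psi>' z)"
  shows "(LINT z|lborel. \<psi>' z) = 0"
proof -
  have z: "\<psi>' z = 0" if "z \<notin> K" for z
    using dir_deriv_off_support[OF K d that] by simp
  obtain M where M: "M > 0" "\<And>z. \<bar>\<psi>' z\<bar> \<le> M"
    using bounded_continuous_compact_support[OF c(2) K(1) z] by metis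
  obtain R where R: "\<And>z. z \<in> K \<Longrightarrow> norm z \<le> R"
    using compact_imp_bounded[OF K(1)] by (auto simp: bounded_iff)
  define e where "e n = 1 / real (Suc n)" for n
  have e: "0 < e n" "e n \<le> 1" for n by (auto simp: e_def)
  define q where "q n z = (\<psi> (z + e n *\<^sub>R v) - \<psi> z) / e n" for n z
  have [measurable]: "\<psi> \<in> borel_measurable lborel" "\<psi>' \<in> borel_measurable lborel"
    using c by (auto intro: borel_measurable_continuous_onI)
  have I: "integrable lborel \<psi>"
    by (rule integrable_continuous_compact_support[OF c(1) K])
  have sh: "has_bochner_integral lborel (\<lambda>z. \<psi> (z + w)) (integral\<^sup>L lborel \<psi>)" for w
  proof -
    have "integrable lborel (\<lambda>z. \<psi> (w + z))"
      using I integrable_distr_eq[of "(+) w" lborel borel \<psi>] lborel_distr_plus[of w] by simp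
    moreover have "(LINT z|lborel. \<psi> (w + z)) = integral\<^sup>L lborel \<psi>"
      using integral_distr[of "(+) w" lborel borel \<psi>] lborel_distr_plus[of w] by simp
    ultimately show ?thesis by (simp add: has_bochner_integral_iff add.commute)
  qed
  have [measurable]: "q n \<in> borel_measurable lborel" for n
    unfolding q_def by measurable
  have q0: "integral\<^sup>L lborel (q n) = 0" for n
    unfolding q_def using sh[of "e n *\<^sub>R v"] I by (simp add: has_bochner_integral_iff)
  have lim: "(\<lambda>n. q n z) \<longlonglongrightarrow> \<psi>' z" for z
  proof -
    have "((\<lambda>h. (\<psi> (z + h *\<^sub>R v) - \<psi> z) / h) \<longlongrightarrow> \<psi>' z) (at 0)"
      using d[of z] by (simp add: has_dir_deriv_def DERIV_def)
    moreover have "filterlim e (at 0) sequentially"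
      unfolding filterlim_at
    proof
      show "\<forall>\<^sub>F x in sequentially. e x \<in> UNIV \<and> e x \<noteq> 0" using e by (simp add: less_imp_neq[symmetric])
      show "e \<longlonglongrightarrow> 0" unfolding e_def using LIMSEQ_inverse_real_of_nat by (simp add: inverse_eq_divide)
    qed
    ultimately show ?thesis unfolding q_def using filterlim_compose by fastforce
  qed
  have qM: "\<bar>q n z\<bar> \<le> M" for n z
  proof -
    obtain s where s: "\<psi> (z + e n *\<^sub>R v) - \<psi> (z + 0 *\<^sub>R v) = (e n - 0) * \<psi>' (z + s *\<^sub>R v)"
      using MVT2[of 0 "e n" "\<lambda>s. \<psi> (z + s *\<^sub>R v)" "\<lambda>s. \<psi>' (z + s *\<^sub>R v)"] e(1)[of n]
        has_dir_deriv_along_line[OF d] by blast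
    then show ?thesis using M(2) e(1)[of n] by (simp add: q_def)
  qed
  have qz: "q n z = 0" if "norm z > R + norm v" for n z
  proof -
    have "norm z \<le> norm (z + e n *\<^sub>R v) + norm v"
      using norm_triangle_ineq4[of "z + e n *\<^sub>R v" "e n *\<^sub>R v"] e[of n] mult_right_mono[OF e(2), of "norm v" n]
      by simp
    then have "z \<notin> K" "z + e n *\<^sub>R v \<notin> K" using R[of z] R[of "z + e n *\<^sub>R v"] that norm_ge_zero[of v] by linarith+
    then show ?thesis using K(2) by (simp add: q_def)
  qed
  have "(\<lambda>n. integral\<^sup>L lborel (q n)) \<longlonglongrightarrow> integral\<^sup>L lborel \<psi>'"
  proof (rule integral_dominated_convergence[where w = "\<lambda>z. M * indicator (cball 0 (R + norm v)) z"])
    show "integrable lborel (\<lambda>z. M * indicator (cball (0::'a) (R + norm v)) z)"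
      using emeasure_lborel_cball_finite by (intro integrable_mult_right integrable_real_indicator) auto
    show "AE z in lborel. norm (q n z) \<le> M * indicator (cball 0 (R + norm v)) z" for n
      using qM qz by (auto simp: indicator_def)
    show "AE x in lborel. (\<lambda>n. q n x) \<longlonglongrightarrow> \<psi>' x"
      using lim by simp
  qed simp_all
  then show ?thesis using q0 LIMSEQ_unique[OF _ tendsto_const] by fastforce
qed

text \<open>
  The function \<open>\<phi>\<close> is only given on \<open>W\<close>; its support \<open>K\<close> is compact in \<open>W\<close>, so that the product
  \<open>f \<phi>\<close> extends by zero.
\<close>

lemma integration_by_parts:
  fixes f \<phi> :: "'a::euclidean_space \<Rightarrow> real"
  assumes W: "open W" and K: "compact K" "K \<subseteq> W" "\<And>z. z \<in> W - K \<Longrightarrow> \<phi> z = 0"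
    and c: "continuous_on W f" "continuous_on W f'" "continuous_on W \<phi>" "continuous_on W \<phi>'"
    and df: "\<And>z. z \<in> W \<Longrightarrow> has_dir_deriv f v z (f' z)"
    and d\<phi>: "\<And>z. z \<in> W \<Longrightarrow> has_dir_deriv \<phi> v z (\<phi>' z)"
  shows "integrable lborel (\<lambda>z. indicator W z * (f' z * \<phi> z))"
    and "integrable lborel (\<lambda>z. indicator W z * (f z * \<phi>' z))"
    and "(LINT z|lborel. indicator W z * (f' z * \<phi> z)) = - (LINT z|lborel. indicator W z * (f z * \<phi>' z))"
proof -
  have oK: "open (- K)" using K(1) by (simp add: compact_imp_closed open_Compl)
  have z': "\<phi>' z = 0" if "z \<in> W - K" for z
  proof -
    have "has_dir_deriv \<phi> v z 0"
      by (rule has_dir_deriv_transform[OF has_dir_deriv_const[of 0], of "W - K"])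
         (use W K(1) K(3) that compact_imp_closed in \<open>auto\<close>)
    then show ?thesis using d\<phi> that has_dir_deriv_unique by blast
  qed
  have ext: "continuous_on UNIV (\<lambda>z. indicator W z * h z)"
    if "continuous_on W h" "\<And>z. z \<in> W - K \<Longrightarrow> h z = 0" for h :: "'a \<Rightarrow> real"
  proof -
    have "continuous_on (W \<union> - K) (\<lambda>z. indicator W z * h z)"
    proof (rule continuous_on_open_Un[OF W oK])
      show "continuous_on W (\<lambda>z. indicator W z * h z)"
        using that(1) by (rule continuous_on_eq) auto
      show "continuous_on (- K) (\<lambda>z. indicator W z * h z)"
        by (rule continuous_on_eq[OF continuous_on_const[of _ 0]]) (use that(2) in \<open>auto simp: indicator_def\<close>)
    qed
    moreover have "W \<union> - K = UNIV" using K(2) by auto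
    ultimately show ?thesis by simp
  qed
  have c1: "continuous_on UNIV (\<lambda>z. indicator W z * (f' z * \<phi> z))"
    by (rule ext) (use c K(3) in \<open>auto intro: continuous_intros\<close>)
  have c2: "continuous_on UNIV (\<lambda>z. indicator W z * (f z * \<phi>' z))"
    by (rule ext) (use c z' in \<open>auto intro: continuous_intros\<close>)
  have c3: "continuous_on UNIV (\<lambda>z. indicator W z * (f z * \<phi> z))"
    by (rule ext) (use c K(3) in \<open>auto intro: continuous_intros\<close>)
  have K0: "indicator W z * (f z * \<phi> z) = 0" "indicator W z * (f' z * \<phi> z) = 0"
    "indicator W z * (f z * \<phi>' z) = 0" if "z \<notin> K" for z
    using K(3) z' that by (auto simp: indicator_def)
  show I1: "integrable lborel (\<lambda>z. indicator W z * (f' z * \<phi> z))"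
    by (rule integrable_continuous_compact_support[OF c1 K(1)]) (rule K0)
  show I2: "integrable lborel (\<lambda>z. indicator W z * (f z * \<phi>' z))"
    by (rule integrable_continuous_compact_support[OF c2 K(1)]) (rule K0)
  have "(LINT z|lborel. indicator W z * (f' z * \<phi> z) + indicator W z * (f z * \<phi>' z)) = 0"
  proof (rule integral_dir_deriv_eq_0[OF K(1) _ c3])
    show "indicator W z * (f z * \<phi> z) = 0" if "z \<notin> K" for z using K0 that by blast
    show "continuous_on UNIV (\<lambda>z. indicator W z * (f' z * \<phi> z) + indicator W z * (f z * \<phi>' z))"
      using c1 c2 by (rule continuous_on_add)
    show "has_dir_deriv (\<lambda>z. indicator W z * (f z * \<phi> z)) v z
         (indicator W z * (f' z * \<phi> z) + indicator W z * (f z * \<phi>' z))" for z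
    proof (cases "z \<in> W")
      case True
      have "has_dir_deriv (\<lambda>x. f x * \<phi> x) v z (f' z * \<phi> z + f z * \<phi>' z)"
        using has_dir_deriv_mult[OF df d\<phi>] True by blast
      from has_dir_deriv_transform[OF this W True, of "\<lambda>z. indicator W z * (f z * \<phi> z)"] True
      show ?thesis by simp
    next
      case False
      have "has_dir_deriv (\<lambda>z. indicator W z * (f z * \<phi> z)) v z 0"
        by (rule has_dir_deriv_transform[OF has_dir_deriv_const[of 0] oK])
           (use False K(2,3) in \<open>auto simp: indicator_def\<close>)
      then show ?thesis using False by simp
    qed
  qed
  then show "(LINT z|lborel. indicator W z * (f' z * \<phi> z)) = - (LINT z|lborel. indicator W z * (f z * \<phi>' z))"
    using I1 I2 by simp
qed

section \<open>Mollification\<close>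

definition conv :: "('a::euclidean_space \<Rightarrow> real) \<Rightarrow> ('a \<Rightarrow> real) \<Rightarrow> 'a \<Rightarrow> real" where
  "conv K f z = (LINT y|lborel. K (z - y) * f y)"

lemma integrable_conv_integrand:
  fixes K f :: "'a::euclidean_space \<Rightarrow> real"
  assumes "continuous_on UNIV K" "\<And>z. \<bar>K z\<bar> \<le> B" "integrable lborel f"
  shows "integrable lborel (\<lambda>y. K (z - y) * f y)"
proof (rule Bochner_Integration.integrable_bound)
  show "integrable lborel (\<lambda>y. B * f y)" using assms(3) by simp
  have [measurable]: "K \<in> borel_measurable borel" "f \<in> borel_measurable borel"
    using assms by (auto intro: borel_measurable_continuous_onI)
  show "(\<lambda>y. K (z - y) * f y) \<in> borel_measurable lborel" by measurable
  have "\<bar>K (z - y)\<bar> \<le> \<bar>B\<bar>" for y using assms(2)[of "z - y"] by linarith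
  then show "AE y in lborel. norm (K (z - y) * f y) \<le> norm (B * f y)"
    by (auto simp: abs_mult intro!: mult_right_mono)
qed

lemma continuous_on_conv:
  fixes K f :: "'a::euclidean_space \<Rightarrow> real"
  assumes K: "continuous_on UNIV K" "\<And>z. \<bar>K z\<bar> \<le> B" and f: "integrable lborel f"
  shows "continuous_on UNIV (conv K f)"
proof -
  have [measurable]: "K \<in> borel_measurable borel" "f \<in> borel_measurable borel"
    using assms by (auto intro: borel_measurable_continuous_onI)
  have "(\<lambda>n. conv K f (x n)) \<longlonglongrightarrow> conv K f z" if "x \<longlonglongrightarrow> z" for x z
    unfolding conv_def
  proof (rule integral_dominated_convergence[where w = "\<lambda>y. B * \<bar>f y\<bar>"])
    show "integrable lborel (\<lambda>y. B * \<bar>f y\<bar>)" using f by simp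
    show "AE y in lborel. norm (K (x n - y) * f y) \<le> B * \<bar>f y\<bar>" for n
      using K(2) by (auto simp: abs_mult intro!: mult_right_mono)
    show "AE y in lborel. (\<lambda>n. K (x n - y) * f y) \<longlonglongrightarrow> K (z - y) * f y"
    proof (rule AE_I2)
      fix y
      have "(\<lambda>n. K (x n - y)) \<longlonglongrightarrow> K (z - y)"
        by (rule continuous_on_tendsto_compose[OF K(1) tendsto_diff[OF that tendsto_const]]) auto
      then show "(\<lambda>n. K (x n - y) * f y) \<longlonglongrightarrow> K (z - y) * f y"
        by (intro tendsto_intros)
    qed
  qed measurable
  then show ?thesis
    unfolding continuous_on_sequentially by (auto simp: o_def)
qed

text \<open>
  All derivatives fall on the kernel, so that nothing but integrability is required of \<open>f\<close>. The difference quotients of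
  the kernel are bounded by its derivative, and dominated convergence applies.
\<close>

lemma has_dir_deriv_conv:
  fixes K f :: "'a::euclidean_space \<Rightarrow> real"
  assumes K: "continuous_on UNIV K" "\<And>z. \<bar>K z\<bar> \<le> B"
    and K': "continuous_on UNIV K'" "\<And>z. \<bar>K' z\<bar> \<le> B'" and f: "integrable lborel f"
    and d: "\<And>z. has_dir_deriv K v z (K' z)"
  shows "has_dir_deriv (conv K f) v z (conv K' f z)"
  unfolding has_dir_deriv_def DERIV_def
proof (rule tendsto_at_iff_sequentially[THEN iffD2], intro allI impI)
  have [measurable]: "K \<in> borel_measurable borel" "K' \<in> borel_measurable borel" "f \<in> borel_measurable borel"
    using assms by (auto intro: borel_measurable_continuous_onI)
  fix x :: "nat \<Rightarrow> real"
  assume "\<forall>i. x i \<in> UNIV - {0}" and x: "x \<longlonglongrightarrow> 0"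
  then have x0: "x i \<noteq> 0" for i by auto
  have "(\<lambda>n. LINT y|lborel. (K (z - y + x n *\<^sub>R v) - K (z - y)) / x n * f y) \<longlonglongrightarrow> conv K' f z"
    unfolding conv_def
  proof (rule integral_dominated_convergence[where w = "\<lambda>y. B' * \<bar>f y\<bar>"])
    show "integrable lborel (\<lambda>y. B' * \<bar>f y\<bar>)" using f by simp
    show "AE y in lborel. norm ((K (z - y + x n *\<^sub>R v) - K (z - y)) / x n * f y) \<le> B' * \<bar>f y\<bar>" for n
    proof (rule AE_I2)
      fix y
      have "norm (K (z - y + x n *\<^sub>R v) - K (z - y + 0 *\<^sub>R v)) \<le> B' * norm (x n - 0)"
      proof (rule field_differentiable_bound[of UNIV "\<lambda>s. K (z - y + s *\<^sub>R v)" "\<lambda>s. K' (z - y + s *\<^sub>R v)"])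
        show "((\<lambda>s. K (z - y + s *\<^sub>R v)) has_field_derivative K' (z - y + s *\<^sub>R v)) (at s within UNIV)" for s
          using has_dir_deriv_along_line[OF d] by simp
      qed (use K'(2) in auto)
      then have "\<bar>(K (z - y + x n *\<^sub>R v) - K (z - y)) / x n\<bar> \<le> B'"
        using x0[of n] by (simp add: field_simps)
      then show "norm ((K (z - y + x n *\<^sub>R v) - K (z - y)) / x n * f y) \<le> B' * \<bar>f y\<bar>"
        unfolding real_norm_def abs_mult by (intro mult_right_mono) auto
    qed
    show "AE y in lborel. (\<lambda>n. (K (z - y + x n *\<^sub>R v) - K (z - y)) / x n * f y) \<longlonglongrightarrow> K' (z - y) * f y"
    proof (rule AE_I2)
      fix y
      have "((\<lambda>h. (K (z - y + h *\<^sub>R v) - K (z - y)) / h) \<longlongrightarrow> K' (z - y)) (at 0)"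
        using d[of "z - y"] by (simp add: has_dir_deriv_def DERIV_def)
      then have "(\<lambda>n. (K (z - y + x n *\<^sub>R v) - K (z - y)) / x n) \<longlonglongrightarrow> K' (z - y)"
        using x x0 by (auto simp: tendsto_at_iff_sequentially o_def)
      then show "(\<lambda>n. (K (z - y + x n *\<^sub>R v) - K (z - y)) / x n * f y) \<longlonglongrightarrow> K' (z - y) * f y"
        by (intro tendsto_intros)
    qed
  qed measurable
  moreover have "(LINT y|lborel. (K (z - y + s *\<^sub>R v) - K (z - y)) / s * f y) = (conv K f (z + s *\<^sub>R v) - conv K f z) / s" for s
  proof -
    have "(LINT y|lborel. (K (z - y + s *\<^sub>R v) - K (z - y)) / s * f y)
        = (LINT y|lborel. K (z + s *\<^sub>R v - y) * f y / s - K (z - y) * f y / s)"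
      by (intro Bochner_Integration.integral_cong) (auto simp: diff_divide_distrib algebra_simps)
    also have "\<dots> = (LINT y|lborel. K (z + s *\<^sub>R v - y) * f y / s) - (LINT y|lborel. K (z - y) * f y / s)"
      using integrable_conv_integrand[OF K f] by (intro Bochner_Integration.integral_diff) auto
    finally show ?thesis by (simp add: conv_def diff_divide_distrib)
  qed
  ultimately show "((\<lambda>h. (conv K f (z + (0 + h) *\<^sub>R v) - conv K f (z + 0 *\<^sub>R v)) / h) \<circ> x) \<longlonglongrightarrow> conv K' f z"
    by (simp only: o_def add_0 scaleR_zero_left add_0_right)
qed

text \<open>
  These properties are what the convergence of mollifications depends on; smoothness of the kernel
  enters only when it serves as a test function, and is assumed separately there.
\<close>

definition approx_kernel :: "real \<Rightarrow> ('a::euclidean_space \<Rightarrow> real) \<Rightarrow> bool" where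
  "approx_kernel e J \<longleftrightarrow> continuous_on UNIV J \<and> (\<forall>z. 0 \<le> J z) \<and> (\<forall>z. e \<le> norm z \<longrightarrow> J z = 0) \<and>
     (LINT z|lborel. J z) = 1"

lemma approx_kernelD:
  assumes "approx_kernel e J"
  shows "continuous_on UNIV J" "\<And>z. 0 \<le> J z" "\<And>z. e \<le> norm z \<Longrightarrow> J z = 0" "(LINT z|lborel. J z) = 1"
    "integrable lborel J"
proof -
  show *: "continuous_on UNIV J" "\<And>z. 0 \<le> J z" "\<And>z. e \<le> norm z \<Longrightarrow> J z = 0" "(LINT z|lborel. J z) = 1"
    using assms by (auto simp: approx_kernel_def)
  show "integrable lborel J"
    by (rule integrable_continuous_compact_support[OF *(1) compact_cball[of 0 e]]) (use *(3) in auto)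
qed

lemma approx_kernel_bounded:
  assumes "approx_kernel e J"
  obtains B where "B > 0" "\<And>z. \<bar>J z\<bar> \<le> B"
  by (rule bounded_continuous_compact_support[of J "cball 0 e"])
     (use approx_kernelD[OF assms] in \<open>auto\<close>)

lemma has_bochner_integral_reflect_shift:
  fixes g :: "'a::euclidean_space \<Rightarrow> real"
  assumes "integrable lborel g"
  shows "has_bochner_integral lborel (\<lambda>y. g (z - y)) (LINT y|lborel. g y)"
proof -
  have d: "distr lborel borel (\<lambda>y. z - y) = (lborel :: 'a measure)"
    using lborel_affine[of "-1" z] by (simp add: density_1 cong: distr_cong)
  have m: "(\<lambda>y. z - y) \<in> lborel \<rightarrow>\<^sub>M borel" by simp
  have g: "g \<in> borel_measurable borel" using assms by auto
  have "integrable lborel (\<lambda>y. g (z - y))"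
    using assms integrable_distr_eq[OF m g] d by simp
  moreover have "(LINT y|lborel. g (z - y)) = integral\<^sup>L lborel g"
    using integral_distr[OF m g] d by simp
  ultimately show ?thesis by (simp add: has_bochner_integral_iff)
qed

lemma conv_mono_bound:
  assumes J: "approx_kernel e J" and fg: "integrable lborel f" "integrable lborel g" "\<And>y. \<bar>f y\<bar> \<le> g y"
  shows "\<bar>conv J f z\<bar> \<le> conv J g z"
proof -
  obtain B where B: "B > 0" "\<And>z. \<bar>J z\<bar> \<le> B" using approx_kernel_bounded[OF J] by blast
  note i = integrable_conv_integrand[OF approx_kernelD(1)[OF J] B(2)]
  have "\<bar>conv J f z\<bar> \<le> (LINT y|lborel. \<bar>J (z - y) * f y\<bar>)"
    unfolding conv_def by (rule integral_abs_bound)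
  also have "\<dots> \<le> conv J g z"
    unfolding conv_def using i[OF fg(1)] i[OF fg(2)] approx_kernelD(2)[OF J] fg(3)
    by (intro integral_mono integrable_abs) (auto simp: abs_mult intro: mult_left_mono)
  finally show ?thesis .
qed

lemma conv_const_diff:
  assumes J: "approx_kernel e J" and f: "integrable lborel f"
  shows "conv J f z - c = (LINT y|lborel. J (z - y) * (f y - c))"
    "integrable lborel (\<lambda>y. J (z - y) * (f y - c))"
proof -
  obtain B where B: "B > 0" "\<And>z. \<bar>J z\<bar> \<le> B" using approx_kernel_bounded[OF J] by blast
  have i: "integrable lborel (\<lambda>y. J (z - y) * f y)"
    by (rule integrable_conv_integrand[OF approx_kernelD(1)[OF J] B(2) f])
  have j: "has_bochner_integral lborel (\<lambda>y. J (z - y)) 1"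
    using has_bochner_integral_reflect_shift[of J] approx_kernelD[OF J] by simp
  have eq: "(\<lambda>y. J (z - y) * (f y - c)) = (\<lambda>y. J (z - y) * f y - c * J (z - y))" by (auto simp: algebra_simps)
  show "integrable lborel (\<lambda>y. J (z - y) * (f y - c))"
    unfolding eq using i j by (auto simp: has_bochner_integral_iff)
  show "conv J f z - c = (LINT y|lborel. J (z - y) * (f y - c))"
    unfolding eq using i j by (auto simp: conv_def has_bochner_integral_iff)
qed

lemma conv_close:
  assumes J: "approx_kernel e J" and f: "integrable lborel f"
    and close: "\<And>y. norm (z - y) < e \<Longrightarrow> \<bar>f y - c\<bar> \<le> \<delta>"
  shows "\<bar>conv J f z - c\<bar> \<le> \<delta>"
proof -
  have j: "has_bochner_integral lborel (\<lambda>y. J (z - y)) 1"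
    using has_bochner_integral_reflect_shift[of J] approx_kernelD[OF J] by simp
  have "\<bar>conv J f z - c\<bar> \<le> (LINT y|lborel. \<bar>J (z - y) * (f y - c)\<bar>)"
    unfolding conv_const_diff(1)[OF J f] by (rule integral_abs_bound)
  also have "\<dots> \<le> (LINT y|lborel. \<delta> * J (z - y))"
  proof (rule integral_mono)
    show "integrable lborel (\<lambda>y. \<bar>J (z - y) * (f y - c)\<bar>)"
      using conv_const_diff(2)[OF J f] by (rule integrable_abs)
    show "integrable lborel (\<lambda>y. \<delta> * J (z - y))" using j by (auto simp: has_bochner_integral_iff)
    show "\<bar>J (z - y) * (f y - c)\<bar> \<le> \<delta> * J (z - y)" for y
    proof (cases "norm (z - y) < e")
      case True
      then show ?thesis
        using mult_right_mono[OF close[OF True] approx_kernelD(2)[OF J, of "z - y"]] approx_kernelD(2)[OF J, of "z - y"]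
        by (simp add: abs_mult mult.commute)
    next
      case False
      then show ?thesis using approx_kernelD(3)[OF J, of "z - y"] by simp
    qed
  qed
  also have "\<dots> = \<delta>" using j by (simp add: has_bochner_integral_iff)
  finally show ?thesis .
qed

text \<open>Convolution with a probability density does not increase the \<open>L\<^sup>1\<close> norm.\<close>

lemma conv_L1_bound:
  fixes J f :: "'a::euclidean_space \<Rightarrow> real"
  assumes J: "approx_kernel e J" and f: "integrable lborel f"
  shows "integrable lborel (conv J f)" "(LINT z|lborel. \<bar>conv J f z\<bar>) \<le> (LINT z|lborel. \<bar>f z\<bar>)"
proof -
  obtain B where B: "B > 0" "\<And>z. \<bar>J z\<bar> \<le> B" using approx_kernel_bounded[OF J] by blast
  note Jc = approx_kernelD(1)[OF J]
  have [measurable]: "J \<in> borel_measurable borel" "f \<in> borel_measurable borel" "conv J f \<in> borel_measurable borel"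
    using f Jc continuous_on_conv[OF Jc B(2) f] by (auto intro: borel_measurable_continuous_onI)
  have "(\<integral>\<^sup>+z. ennreal \<bar>conv J f z\<bar> \<partial>lborel) \<le> (\<integral>\<^sup>+z. (\<integral>\<^sup>+y. ennreal (J (z - y) * \<bar>f y\<bar>) \<partial>lborel) \<partial>lborel)"
  proof (rule nn_integral_mono)
    fix z
    have i: "integrable lborel (\<lambda>y. J (z - y) * \<bar>f y\<bar>)"
      by (rule integrable_conv_integrand[OF Jc B(2)]) (use f in simp)
    have "ennreal \<bar>conv J f z\<bar> \<le> ennreal (LINT y|lborel. J (z - y) * \<bar>f y\<bar>)"
      using conv_mono_bound[OF J f, of "\<lambda>y. \<bar>f y\<bar>" z] f by (simp add: conv_def ennreal_leI)
    also have "\<dots> = (\<integral>\<^sup>+y. ennreal (J (z - y) * \<bar>f y\<bar>) \<partial>lborel)"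
      using i approx_kernelD(2)[OF J] by (intro nn_integral_eq_integral[symmetric]) auto
    finally show "ennreal \<bar>conv J f z\<bar> \<le> (\<integral>\<^sup>+y. ennreal (J (z - y) * \<bar>f y\<bar>) \<partial>lborel)" .
  qed
  also have "\<dots> = (\<integral>\<^sup>+y. (\<integral>\<^sup>+z. ennreal (J (z - y) * \<bar>f y\<bar>) \<partial>lborel) \<partial>lborel)"
    by (rule lborel_pair.Fubini') measurable
  also have "\<dots> = (\<integral>\<^sup>+y. ennreal \<bar>f y\<bar> \<partial>lborel)"
  proof (rule nn_integral_cong)
    fix y
    have "(\<integral>\<^sup>+z. ennreal (J (z - y) * \<bar>f y\<bar>) \<partial>lborel) = (\<integral>\<^sup>+z. ennreal (J (- y + z)) \<partial>lborel) * ennreal \<bar>f y\<bar>"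
      using approx_kernelD(2)[OF J] by (simp add: ennreal_mult nn_integral_multc)
    also have "(\<integral>\<^sup>+z. ennreal (J (- y + z)) \<partial>lborel) = (\<integral>\<^sup>+z. ennreal (J z) \<partial>lborel)"
      using nn_integral_distr[of "(+) (- y)" lborel borel "\<lambda>z. ennreal (J z)"] lborel_distr_plus[of "- y"] by simp
    also have "\<dots> = 1"
      using nn_integral_eq_integral[OF approx_kernelD(5)[OF J]] approx_kernelD[OF J] by simp
    finally show "(\<integral>\<^sup>+z. ennreal (J (z - y) * \<bar>f y\<bar>) \<partial>lborel) = ennreal \<bar>f y\<bar>" by simp
  qed
  also have "\<dots> = ennreal (LINT z|lborel. \<bar>f z\<bar>)"
    using f by (intro nn_integral_eq_integral) auto
  finally have le: "(\<integral>\<^sup>+z. ennreal \<bar>conv J f z\<bar> \<partial>lborel) \<le> ennreal (LINT z|lborel. \<bar>f z\<bar>)" .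
  show I: "integrable lborel (conv J f)"
    by (rule integrableI_bounded) (use le in \<open>auto intro: le_less_trans\<close>)
  have "ennreal (LINT z|lborel. \<bar>conv J f z\<bar>) \<le> ennreal (LINT z|lborel. \<bar>f z\<bar>)"
    using le nn_integral_eq_integral[of lborel "\<lambda>z. \<bar>conv J f z\<bar>"] I by simp
  then show "(LINT z|lborel. \<bar>conv J f z\<bar>) \<le> (LINT z|lborel. \<bar>f z\<bar>)"
    by (subst (asm) ennreal_le_iff) auto
qed

text \<open>
  For an indicator function, regularity of Lebesgue measure leaves a set of small measure between a closed
  and an open set, and Urysohn's lemma interpolates there. The property passes to sums and to dominated limits.
\<close>

lemma integrable_approx_continuous:
  fixes f :: "'a::euclidean_space \<Rightarrow> real"
  assumes "integrable lborel f" "\<delta> > 0"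
  shows "\<exists>g. continuous_on UNIV g \<and> integrable lborel g \<and> (LINT z|lborel. \<bar>f z - g z\<bar>) < \<delta>"
  using assms
proof (induction f arbitrary: \<delta> rule: integrable_induct)
  case (base A c)
  define e where "e = \<delta> / (2 * (\<bar>c\<bar> + 1))"
  have e: "e > 0" using base.prems by (simp add: e_def)
  have A: "A \<in> sets lebesgue" using base by simp
  obtain U where U: "open U" "A \<subseteq> U" "U - A \<in> lmeasurable" "emeasure lebesgue (U - A) < ennreal e"
    using sets_lebesgue_outer_open[OF A e] by blast
  obtain C where C: "closed C" "C \<subseteq> A" "A - C \<in> lmeasurable" "emeasure lebesgue (A - C) < ennreal e"
    using sets_lebesgue_inner_closed[OF A e] by blast
  have UC: "emeasure lborel (U - C) < 2 * ennreal e"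
  proof -
    have "emeasure lborel (U - C) = emeasure lebesgue (U - C)"
      using U C by simp
    also have eq: "U - C = (U - A) \<union> (A - C)" using U C by auto
    also have "emeasure lebesgue ((U - A) \<union> (A - C)) \<le> emeasure lebesgue (U - A) + emeasure lebesgue (A - C)"
      using U C by (intro emeasure_subadditive) auto
    also have "\<dots> < ennreal e + ennreal e" using U C by (intro add_strict_mono) auto
    finally show ?thesis by (simp add: mult_2 eq)
  qed
  then have UC': "emeasure lborel (U - C) < ennreal (2 * e)"
    using e by (simp add: ennreal_mult)
  then have fin: "emeasure lborel (U - C) < \<infinity>"
    using less_trans[OF _ ennreal_less_top] by simp
  have iUC: "integrable lborel (indicator (U - C) :: 'a \<Rightarrow> real)"
    using fin U C by (intro integrable_real_indicator) auto
  have mUC: "measure lborel (U - C) < 2 * e"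
  proof -
    have "emeasure lborel (U - C) = ennreal (measure lborel (U - C))"
      using fin by (intro emeasure_eq_ennreal_measure) auto
    then show ?thesis using UC' by (simp add: ennreal_less_iff)
  qed
  obtain g where g: "continuous_on UNIV g" "\<And>x. g x \<in> closed_segment c (0::real)" "\<And>x. x \<in> C \<Longrightarrow> g x = c" "\<And>x. x \<in> - U \<Longrightarrow> g x = 0"
  proof (rule Urysohn[of C "- U" c 0])
    show "C \<inter> - U = {}" using C U by auto
  qed (use C U in auto)
  have gb: "\<bar>indicator A x *\<^sub>R c - g x\<bar> \<le> \<bar>c\<bar> * indicator (U - C) x" for x
    using g(2)[of x] g(3)[of x] g(4)[of x] U(2) C(2)
    by (auto simp: indicator_def closed_segment_eq_real_ivl split: if_splits)
  have [measurable]: "g \<in> borel_measurable borel" "A \<in> sets borel"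
    using g(1) base by (auto intro: borel_measurable_continuous_onI)
  have iA: "integrable lborel (\<lambda>x. indicator A x *\<^sub>R c)"
    using base by (intro integrable_scaleR_left integrable_real_indicator) auto
  have id: "integrable lborel (\<lambda>x. indicator A x *\<^sub>R c - g x)"
  proof (rule Bochner_Integration.integrable_bound)
    show "integrable lborel (\<lambda>x. \<bar>c\<bar> * indicator (U - C) x :: real)" using iUC by simp
  qed (use gb in auto)
  have "integrable lborel g" using Bochner_Integration.integrable_diff[OF iA id] by simp
  moreover have "(LINT x|lborel. \<bar>indicator A x *\<^sub>R c - g x\<bar>) < \<delta>"
  proof -
    have "(LINT x|lborel. \<bar>indicator A x *\<^sub>R c - g x\<bar>) \<le> (LINT x|lborel. \<bar>c\<bar> * indicator (U - C) x)"
      by (rule integral_mono) (use id iUC gb in auto)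
    also have "\<dots> = \<bar>c\<bar> * measure lborel (U - C)" using U C by simp
    also have "\<dots> \<le> \<bar>c\<bar> * (2 * e)" using mUC by (intro mult_left_mono) auto
    also have "\<dots> < \<delta>" using base.prems by (simp add: e_def field_simps)
    finally show ?thesis .
  qed
  ultimately show ?case using g(1) by blast
next
  case (add f1 f2)
  obtain g1 g2 where g: "continuous_on UNIV g1" "integrable lborel g1" "(LINT z|lborel. \<bar>f1 z - g1 z\<bar>) < \<delta> / 2"
    "continuous_on UNIV g2" "integrable lborel g2" "(LINT z|lborel. \<bar>f2 z - g2 z\<bar>) < \<delta> / 2"
    using add.IH[of "\<delta> / 2"] add.prems by (metis half_gt_zero)
  have "(LINT z|lborel. \<bar>f1 z + f2 z - (g1 z + g2 z)\<bar>) \<le> (LINT z|lborel. \<bar>f1 z - g1 z\<bar> + \<bar>f2 z - g2 z\<bar>)"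
    by (rule integral_mono) (use add.hyps g in auto)
  also have "\<dots> = (LINT z|lborel. \<bar>f1 z - g1 z\<bar>) + (LINT z|lborel. \<bar>f2 z - g2 z\<bar>)"
    by (rule Bochner_Integration.integral_add) (use add.hyps g in auto)
  also have "\<dots> < \<delta>" using g by linarith
  finally show ?case using g by (intro exI[of _ "\<lambda>z. g1 z + g2 z"]) (auto intro: continuous_intros)
next
  case (lim f s)
  have [measurable]: "f \<in> borel_measurable lborel" "\<And>i. s i \<in> borel_measurable lborel" using lim.hyps(1,4) by auto
  have "(\<lambda>i. LINT z|lborel. \<bar>f z - s i z\<bar>) \<longlonglongrightarrow> (LINT (z::'a)|lborel. 0)"
  proof (rule integral_dominated_convergence[where w = "\<lambda>z. 3 * \<bar>f z\<bar>"])
    show "AE x in lborel. (\<lambda>i. \<bar>f x - s i x\<bar>) \<longlonglongrightarrow> 0"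
    proof (rule AE_I2)
      fix x
      have "(\<lambda>i. \<bar>f x - s i x\<bar>) \<longlonglongrightarrow> \<bar>f x - f x\<bar>" using lim.hyps(2)[of x] by (intro tendsto_intros) auto
      then show "(\<lambda>i. \<bar>f x - s i x\<bar>) \<longlonglongrightarrow> 0" by simp
    qed
    show "AE x in lborel. norm \<bar>f x - s i x\<bar> \<le> 3 * \<bar>f x\<bar>" for i
    proof (rule AE_I2)
      fix x
      have "\<bar>s i x\<bar> \<le> 2 * \<bar>f x\<bar>" using lim.hyps(3)[of x i] by simp
      then show "norm \<bar>f x - s i x\<bar> \<le> 3 * \<bar>f x\<bar>" by simp
    qed
  qed (use lim.hyps(4) in auto)
  then have "eventually (\<lambda>i. (LINT z|lborel. \<bar>f z - s i z\<bar>) < \<delta> / 2) sequentially"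
    using lim.prems by (intro order_tendstoD) auto
  then obtain i where i: "(LINT z|lborel. \<bar>f z - s i z\<bar>) < \<delta> / 2"
    using eventually_happens by (auto simp: eventually_sequentially)
  obtain g where g: "continuous_on UNIV g" "integrable lborel g" "(LINT z|lborel. \<bar>s i z - g z\<bar>) < \<delta> / 2"
    using lim.IH[of "\<delta> / 2" i] lim.prems by auto
  have "(LINT z|lborel. \<bar>f z - g z\<bar>) \<le> (LINT z|lborel. \<bar>f z - s i z\<bar> + \<bar>s i z - g z\<bar>)"
    by (rule integral_mono) (use lim.hyps(1,4) g in auto)
  also have "\<dots> = (LINT z|lborel. \<bar>f z - s i z\<bar>) + (LINT z|lborel. \<bar>s i z - g z\<bar>)"
    by (rule Bochner_Integration.integral_add) (use lim.hyps(1,4) g in auto)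
  also have "\<dots> < \<delta>" using g i by linarith
  finally show ?case using g by blast
qed

lemma integrable_approx_continuous_compact:
  fixes f :: "'a::euclidean_space \<Rightarrow> real"
  assumes f: "integrable lborel f" and "\<delta> > 0"
  obtains g R where "continuous_on UNIV g" "integrable lborel g" "\<And>z. R \<le> norm z \<Longrightarrow> g z = 0"
    "(LINT z|lborel. \<bar>f z - g z\<bar>) < \<delta>"
proof -
  obtain g where g: "continuous_on UNIV g" "integrable lborel g" "(LINT z|lborel. \<bar>f z - g z\<bar>) < \<delta> / 2"
    using integrable_approx_continuous[OF f, of "\<delta> / 2"] \<open>\<delta> > 0\<close> by auto
  define cut where "cut n z = max 0 (min 1 (real n - norm z))" for n and z :: 'a
  have cut: "0 \<le> cut n z" "cut n z \<le> 1" "real n \<le> norm z \<Longrightarrow> cut n z = 0" "norm z \<le> real n - 1 \<Longrightarrow> cut n z = 1" for n z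
    by (auto simp: cut_def)
  have cutc: "continuous_on UNIV (cut n)" for n unfolding cut_def[abs_def] by (intro continuous_intros)
  have [measurable]: "g \<in> borel_measurable lborel" "cut n \<in> borel_measurable lborel" for n
    using g cutc by (auto intro: borel_measurable_continuous_onI)
  have lim: "(\<lambda>n. LINT z|lborel. \<bar>g z - cut n z * g z\<bar>) \<longlonglongrightarrow> (LINT (z::'a)|lborel. 0)"
  proof (rule integral_dominated_convergence[where w = "\<lambda>z. \<bar>g z\<bar>"])
    show "AE z in lborel. (\<lambda>n. \<bar>g z - cut n z * g z\<bar>) \<longlonglongrightarrow> 0"
    proof (rule AE_I2)
      fix z :: 'a
      obtain N where N: "norm z + 1 \<le> real N" using real_arch_simple by blast
      have "eventually (\<lambda>n. 0 = \<bar>g z - cut n z * g z\<bar>) sequentially"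
        using eventually_ge_at_top[of N] by eventually_elim (use N cut(4)[of z] in auto)
      then show "(\<lambda>n. \<bar>g z - cut n z * g z\<bar>) \<longlonglongrightarrow> 0"
        by (rule Lim_transform_eventually[OF tendsto_const])
    qed
    show "AE z in lborel. norm \<bar>g z - cut n z * g z\<bar> \<le> \<bar>g z\<bar>" for n
    proof (rule AE_I2)
      fix z
      have "g z - cut n z * g z = (1 - cut n z) * g z" by (simp add: algebra_simps)
      moreover have "\<bar>1 - cut n z\<bar> \<le> 1" using cut(1)[of n z] cut(2)[of n z] by auto
      ultimately show "norm \<bar>g z - cut n z * g z\<bar> \<le> \<bar>g z\<bar>"
        using mult_right_mono[of "\<bar>1 - cut n z\<bar>" 1 "\<bar>g z\<bar>"] by (simp add: abs_mult)
    qed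
  qed (use g in auto)
  then have "eventually (\<lambda>i. (LINT z|lborel. \<bar>g z - cut i z * g z\<bar>) < \<delta> / 2) sequentially"
    using \<open>\<delta> > 0\<close> by (intro order_tendstoD) auto
  then obtain n where n: "(LINT z|lborel. \<bar>g z - cut n z * g z\<bar>) < \<delta> / 2"
    by (auto simp: eventually_sequentially)
  have i: "integrable lborel (\<lambda>z. cut n z * g z)"
    by (rule Bochner_Integration.integrable_bound[OF g(2)])
       (use cut in \<open>auto simp: abs_mult intro!: mult_left_le_one_le\<close>)
  show thesis
  proof (rule that[of "\<lambda>z. cut n z * g z" "real n"])
    show "continuous_on UNIV (\<lambda>z. cut n z * g z)" using cutc g by (intro continuous_intros)
    have "(LINT z|lborel. \<bar>f z - cut n z * g z\<bar>) \<le> (LINT z|lborel. \<bar>f z - g z\<bar> + \<bar>g z - cut n z * g z\<bar>)"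
      by (rule integral_mono) (use f g i in auto)
    also have "\<dots> = (LINT z|lborel. \<bar>f z - g z\<bar>) + (LINT z|lborel. \<bar>g z - cut n z * g z\<bar>)"
      by (rule Bochner_Integration.integral_add) (use f g i in auto)
    finally show "(LINT z|lborel. \<bar>f z - cut n z * g z\<bar>) < \<delta>" using g n by linarith
  qed (use i cut in auto)
qed

text \<open>
  For a continuous function of compact support the convergence is uniform on a bounded set. The general case follows by density,
  since convolution is a contraction in \<open>L\<^sup>1\<close>.
\<close>

lemma conv_tendsto_L1:
  fixes f :: "'a::euclidean_space \<Rightarrow> real"
  assumes J: "\<And>n. approx_kernel (e n) (J n)" and e: "e \<longlonglongrightarrow> 0" and f: "integrable lborel f"
  shows "(\<lambda>n. LINT z|lborel. \<bar>conv (J n) f z - f z\<bar>) \<longlonglongrightarrow> 0"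
proof (rule LIMSEQ_I)
  fix r :: real assume r: "r > 0"
  obtain g R where g: "continuous_on UNIV g" "integrable lborel g" "\<And>z. R \<le> norm z \<Longrightarrow> g z = 0"
    "(LINT z|lborel. \<bar>f z - g z\<bar>) < r / 4"
    using integrable_approx_continuous_compact[OF f, of "r / 4"] r by auto
  define m where "m = measure lborel (cball (0::'a) (R + 1)) + 1"
  have m: "m > 0" unfolding m_def using measure_nonneg[of lborel "cball (0::'a) (R + 1)"] by linarith
  have "uniformly_continuous_on (cball 0 (R + 2)) g"
    using g(1) by (intro compact_uniformly_continuous) (auto intro: continuous_on_subset)
  then obtain d where d: "d > 0"
    "\<And>x y. x \<in> cball 0 (R + 2) \<Longrightarrow> y \<in> cball 0 (R + 2) \<Longrightarrow> dist y x < d \<Longrightarrow> dist (g y) (g x) < r / (4 * m)"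
    unfolding uniformly_continuous_on_def using r m by (metis divide_pos_pos mult_pos_pos zero_less_numeral)
  have "eventually (\<lambda>n. e n < min d 1) sequentially" using e d by (intro order_tendstoD(2)) auto
  then obtain N where N: "\<And>n. n \<ge> N \<Longrightarrow> e n < min d 1" by (auto simp: eventually_sequentially)
  have "norm ((LINT z|lborel. \<bar>conv (J n) f z - f z\<bar>) - 0) < r" if "n \<ge> N" for n
  proof -
    note Jn = J[of n]
    obtain B where B: "B > 0" "\<And>z. \<bar>J n z\<bar> \<le> B" using approx_kernel_bounded[OF Jn] by blast
    have fg: "integrable lborel (\<lambda>z. f z - g z)" using f g by simp
    have lin: "conv (J n) (\<lambda>z. f z - g z) z = conv (J n) f z - conv (J n) g z" for z
      using integrable_conv_integrand[OF approx_kernelD(1)[OF Jn] B(2) f]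
        integrable_conv_integrand[OF approx_kernelD(1)[OF Jn] B(2) g(2)]
      by (simp add: conv_def right_diff_distrib)
    have pt: "\<bar>conv (J n) g z - g z\<bar> \<le> r / (4 * m) * indicator (cball 0 (R + 1)) z" for z
    proof (cases "norm z \<le> R + 1")
      case True
      have "\<bar>conv (J n) g z - g z\<bar> \<le> r / (4 * m)"
      proof (rule conv_close[OF Jn g(2)])
        fix y assume y: "norm (z - y) < e n"
        then have "norm y \<le> R + 2" using N[OF that] True norm_triangle_ineq3[of z y] by linarith
        moreover have "dist y z < d" using y N[OF that] by (simp add: dist_norm norm_minus_commute)
        ultimately have "dist (g y) (g z) < r / (4 * m)" using True by (intro d(2)) auto
        then show "\<bar>g y - g z\<bar> \<le> r / (4 * m)" by (simp add: dist_real_def)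
      qed
      then show ?thesis using True by simp
    next
      case False
      have "\<bar>conv (J n) g z - g z\<bar> \<le> 0"
      proof (rule conv_close[OF Jn g(2)])
        fix y assume y: "norm (z - y) < e n"
        then have "norm y \<ge> R" using N[OF that] False norm_triangle_ineq2[of z y] by linarith
        then show "\<bar>g y - g z\<bar> \<le> 0" using g(3)[of y] g(3)[of z] False by simp
      qed
      then show ?thesis using False by simp
    qed
    have ig: "integrable lborel (\<lambda>z. \<bar>conv (J n) g z - g z\<bar>)" using conv_L1_bound(1)[OF Jn g(2)] g by simp
    have "(LINT z|lborel. \<bar>conv (J n) g z - g z\<bar>) \<le> (LINT z|lborel. r / (4 * m) * indicator (cball (0::'a) (R + 1)) z)"
    proof (intro integral_mono ig pt integrable_mult_right integrable_real_indicator)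
      show "emeasure lborel (cball (0::'a) (R + 1)) < \<infinity>" using emeasure_lborel_cball_finite by auto
    qed simp
    also have "\<dots> = r / (4 * m) * (m - 1)"
      by (simp add: m_def)
    also have "\<dots> < r / 4" using r m by (simp add: field_simps)
    finally have 2: "(LINT z|lborel. \<bar>conv (J n) g z - g z\<bar>) < r / 4" .
    have "(LINT z|lborel. \<bar>conv (J n) f z - f z\<bar>) \<le>
        (LINT z|lborel. \<bar>conv (J n) (\<lambda>z. f z - g z) z\<bar> + \<bar>conv (J n) g z - g z\<bar> + \<bar>f z - g z\<bar>)"
    proof (rule integral_mono)
      show "integrable lborel (\<lambda>z. \<bar>conv (J n) f z - f z\<bar>)" using conv_L1_bound(1)[OF Jn f] f by simp
      show "integrable lborel (\<lambda>z. \<bar>conv (J n) (\<lambda>z. f z - g z) z\<bar> + \<bar>conv (J n) g z - g z\<bar> + \<bar>f z - g z\<bar>)"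
        using conv_L1_bound(1)[OF Jn fg] ig f g by (intro Bochner_Integration.integrable_add) auto
    qed (simp add: lin)
    also have "\<dots> = (LINT z|lborel. \<bar>conv (J n) (\<lambda>z. f z - g z) z\<bar>) + (LINT z|lborel. \<bar>conv (J n) g z - g z\<bar>)
        + (LINT z|lborel. \<bar>f z - g z\<bar>)"
      using conv_L1_bound(1)[OF Jn fg] ig f g by simp
    also have "\<dots> < r"
      using conv_L1_bound(2)[OF Jn fg] 2 g(4) r by linarith
    finally show ?thesis by simp
  qed
  then show "\<exists>no. \<forall>n\<ge>no. norm ((LINT z|lborel. \<bar>conv (J n) f z - f z\<bar>) - 0) < r" by blast
qed

lemma integral_lower_bound_ball:
  fixes f :: "'a::euclidean_space \<Rightarrow> real"
  assumes "integrable lborel f" "\<And>z. 0 \<le> f z" "\<And>z. z \<in> ball x r \<Longrightarrow> c \<le> f z"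
  shows "c * measure lborel (ball x r) \<le> (LINT z|lborel. f z)"
proof -
  have "(LINT z|lborel. c * indicator (ball x r) z) \<le> (LINT z|lborel. f z)"
  proof (intro integral_mono assms(1) integrable_mult_right integrable_real_indicator)
    show "emeasure lborel (ball x r) < \<infinity>" using emeasure_lborel_ball_finite by auto
    show "c * indicator (ball x r) z \<le> f z" for z
      using assms(2)[of z] assms(3)[of z] by (cases "z \<in> ball x r") auto
  qed simp
  then show ?thesis by simp
qed

lemma measure_ball_pos: "r > 0 \<Longrightarrow> 0 < measure lborel (ball (x::'a::euclidean_space) r)"
  using content_ball_pos[of r x] by simp

lemma smooth_kernel_exists:
  assumes "e > 0"
  obtains J :: "'a::euclidean_space \<Rightarrow> real" where "approx_kernel e J" "\<And>k. C_k k J"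
proof -
  define b where "b z = bump (0 + inverse e *\<^sub>R z)" for z :: 'a
  have Ck: "C_k k b" for k
    unfolding b_def by (rule C_k_affine[OF bounded_linear_scaleR_right C_k_bump])
  have c: "continuous_on UNIV b" using Ck C_k_imp_continuous by blast
  have z: "b z = 0" if "e \<le> norm z" for z
    unfolding b_def by (rule bump_eq_0) (use that assms in \<open>simp add: field_simps\<close>)
  have nn: "0 \<le> b z" for z by (simp add: b_def bump_nonneg)
  have I: "integrable lborel b"
    by (rule integrable_continuous_compact_support[OF c compact_cball[of 0 e]]) (use z in auto)
  have b0: "b 0 > 0" using bump_0_pos[where 'a='a] by (simp add: b_def)
  have "isCont b 0" using c by (simp add: continuous_on_eq_continuous_at)
  then obtain r where r: "r > 0" "\<And>z. dist z 0 < r \<Longrightarrow> dist (b z) (b 0) < b 0 / 2"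
    using b0 unfolding continuous_at_eps_delta by (metis half_gt_zero)
  have r2: "b 0 / 2 \<le> b z" if "z \<in> ball 0 r" for z
    proof -
    have "\<bar>b z - b 0\<bar> < b 0 / 2" using r(2)[of z] that by (simp add: dist_real_def dist_norm)
    then have "b 0 - b z < b 0 / 2" by (metis abs_less_iff minus_diff_eq)
    then show ?thesis by (simp add: field_simps)
  qed
  have pos: "(LINT z|lborel. b z) > 0"
    using integral_lower_bound_ball[OF I nn r2] measure_ball_pos[OF r(1), of 0] b0
    by (smt (verit) half_gt_zero mult_pos_pos)
  show thesis
  proof (rule that[of "\<lambda>z. (1 / (LINT z|lborel. b z)) * b z"])
    show "C_k k (\<lambda>z. (1 / (LINT z|lborel. b z)) * b z)" for k
      by (rule C_k_mult[OF C_k_const Ck])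
    show "approx_kernel e (\<lambda>z. (1 / (LINT z|lborel. b z)) * b z)"
      unfolding approx_kernel_def using pos nn z c by (auto intro!: continuous_intros)
  qed
qed

section \<open>Classical solutions are weak solutions\<close>

lemma test_functionE:
  assumes "test_function U \<phi>"
  obtains K where "compact K" "K \<subseteq> U" "\<And>z. z \<notin> K \<Longrightarrow> \<phi> z = 0"
    "continuous_on UNIV \<phi>" "\<And>v. continuous_on UNIV (\<lambda>z. frechet_derivative \<phi> (at z) v)"
    "\<And>z v. has_dir_deriv \<phi> v z (frechet_derivative \<phi> (at z) v)"
proof (rule that[of "closure {z. \<phi> z \<noteq> 0}"])
  have Ck: "\<forall>k. C_k k \<phi>"
    using assms unfolding test_function_def by (rule conjunct1)
  show "compact (closure {z. \<phi> z \<noteq> 0})" "closure {z. \<phi> z \<noteq> 0} \<subseteq> U"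
    using assms unfolding test_function_def compactly_contained_def by blast+
  show "\<phi> z = 0" if "z \<notin> closure {z. \<phi> z \<noteq> 0}" for z
    using that closure_subset[of "{z. \<phi> z \<noteq> 0}"] by blast
  show "continuous_on UNIV \<phi>" by (rule C_k_imp_continuous[OF spec[OF Ck]])
  show "continuous_on UNIV (\<lambda>z. frechet_derivative \<phi> (at z) v)" for v
  proof -
    show ?thesis using spec[OF Ck, of "Suc 0"] by simp
  qed
  show "has_dir_deriv \<phi> v z (frechet_derivative \<phi> (at z) v)" for z v
    by (rule has_dir_deriv_test[OF Ck])
qed

lemma LINT_lebesgue_on:
  fixes f :: "'a::euclidean_space \<Rightarrow> real"
  assumes "W \<in> sets borel" "(\<lambda>z. indicator W z * f z) \<in> borel_measurable borel"
  shows "(LINT z|lebesgue_on W. f z) = (LINT z|lborel. indicator W z * f z)"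
proof -
  have "(LINT z|lebesgue_on W. f z) = (LINT z|lebesgue. indicator W z *\<^sub>R f z)"
    using assms(1) by (intro integral_restrict_space) auto
  also have "\<dots> = (LINT z|lborel. indicator W z * f z)"
    using integral_completion[of "\<lambda>z. indicator W z * f z" lborel] assms(2) by simp
  finally show ?thesis .
qed

lemma LINT_lebesgue_on_continuous:
  fixes f :: "'a::euclidean_space \<Rightarrow> real"
  assumes "open W" "continuous_on W f"
  shows "(LINT z|lebesgue_on W. f z) = (LINT z|lborel. indicator W z * f z)"
  using borel_measurable_continuous_on_indicator[of W f] assms
  by (intro LINT_lebesgue_on) (auto simp: mult.commute)

text \<open>
  Supplies every integrability condition in the definition of a weak solution for functions that are
  continuous up to the boundary of a bounded open set.
\<close>

lemma Lp_on_continuous: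
  fixes f :: "'a::euclidean_space \<Rightarrow> 'b::euclidean_space"
  assumes "open U" "U \<subseteq> S" "compact S" "continuous_on S f" "p > 0"
  shows "Lp_on p U f"
proof -
  have U: "U \<in> lmeasurable" using bounded_subset[OF compact_imp_bounded[OF assms(3)] assms(2)] assms(1)
    by (intro bounded_set_imp_lmeasurable) auto
  have c: "continuous_on U f" by (rule continuous_on_subset[OF assms(4,2)])
  have "bounded (f ` S)" using assms by (intro compact_imp_bounded compact_continuous_image)
  then obtain M where M: "M > 0" "\<And>x. x \<in> S \<Longrightarrow> norm (f x) \<le> M" by (auto simp: bounded_pos)
  have m: "f \<in> borel_measurable (lebesgue_on U)"
    using c U by (intro continuous_imp_measurable_on_sets_lebesgue) auto
  interpret finite_measure "lebesgue_on U" using U by (rule finite_measure_lebesgue_on)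
  have "integrable (lebesgue_on U) (\<lambda>x. norm (f x) powr p)"
  proof (rule integrable_const_bound[where B = "M powr p"])
    show "AE x in lebesgue_on U. norm (norm (f x) powr p) \<le> M powr p"
      using M assms by (intro AE_I2) (auto intro!: powr_mono2)
  qed (use m in measurable)
  with m show ?thesis by (simp add: Lp_on_def)
qed

lemma compactly_contained_cylinder:
  assumes "compactly_contained (U \<times> {s<..<t}) W" "s < (t::real)"
  shows "compact (closure U)" "closure U \<times> {s..t} \<subseteq> W" "closure (U \<times> {s<..<t}) = closure U \<times> {s..t}"
proof -
  show *: "closure (U \<times> {s<..<t}) = closure U \<times> {s..t}"
    using assms(2) by (simp add: closure_Times)
  then have c: "compact (closure U \<times> {s..t})" and "closure U \<times> {s..t} \<subseteq> W"
    using assms by (auto simp: compactly_contained_def)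
  then show "closure U \<times> {s..t} \<subseteq> W" by simp
  have "fst ` (closure U \<times> {s..t}) = closure U" using assms(2) by force
  then show "compact (closure U)"
    using compact_continuous_image[OF continuous_on_fst[OF continuous_on_id] c] by simp
qed

lemma has_dir_deriv_slice:
  "has_dir_deriv h (v, 0) (x, t) d \<Longrightarrow> has_dir_deriv (\<lambda>x. h (x, t)) v x d"
  by (simp add: has_dir_deriv_def)

text \<open>
  The flux \<open>F\<close> is differentiated as a function of its own, because \<open>|\<nabla>h|\<^sup>p\<^sup>-\<^sup>2\<nabla>h\<close> can be continuously differentiable
  where the gradient vanishes although the power \<open>|\<nabla>h|\<^sup>p\<^sup>-\<^sup>2\<close> is singular there. Integration by parts in all the coordinate directions
  gives the weak equation, and integration by parts on time slices shows that \<open>hx\<close> is the weak gradient.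
\<close>

lemma classical_imp_p_parabolic:
  fixes h :: "(real^'n) \<times> real \<Rightarrow> real" and hx F :: "(real^'n) \<times> real \<Rightarrow> real^'n"
    and ht :: "(real^'n) \<times> real \<Rightarrow> real" and dF :: "'n \<Rightarrow> (real^'n) \<times> real \<Rightarrow> real"
  assumes p: "1 < p" and W: "open W"
    and cont: "continuous_on W h" "continuous_on W hx" "continuous_on W ht" "continuous_on W F"
      "\<And>i. continuous_on W (dF i)"
    and hx: "\<And>z i. z \<in> W \<Longrightarrow> has_dir_deriv h (axis i 1, 0) z (hx z $ i)"
    and ht: "\<And>z. z \<in> W \<Longrightarrow> has_dir_deriv h (0, 1) z (ht z)"
    and F: "\<And>z. z \<in> W \<Longrightarrow> F z = norm (hx z) powr (p - 2) *\<^sub>R hx z"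
    and dF: "\<And>z i. z \<in> W \<Longrightarrow> has_dir_deriv (\<lambda>z. F z $ i) (axis i 1, 0) z (dF i z)"
    and eq: "\<And>z. z \<in> W \<Longrightarrow> ht z = (\<Sum>i\<in>UNIV. dF i z)"
  shows "p_parabolic p W h"
  unfolding p_parabolic_def
proof (rule conjI[OF cont(1)], unfold weak_solution_def, intro allI impI conjI)
  fix U :: "(real^'n) set" and s t :: real
  assume a: "open U \<and> s < t \<and> compactly_contained (U \<times> {s<..<t}) W"
  then have U: "open U" "s < t" by auto
  note cc = compactly_contained_cylinder[OF conjunct2[OF conjunct2[OF a]] U(2)]
  define C where "C = U \<times> {s<..<t}"
  have C: "open C" unfolding C_def using U by (simp add: open_Times)
  have CW: "C \<subseteq> W" using cc(2) closure_subset[of U] unfolding C_def by (auto simp: subset_iff)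
  have cmp: "compact (closure U \<times> {s..t})" using cc(1) by (intro compact_Times) auto
  have CS: "C \<subseteq> closure U \<times> {s..t}" unfolding C_def using closure_subset[of U] by auto
  have contC: "continuous_on (closure U \<times> {s..t}) f" if "continuous_on W f" for f :: "_ \<Rightarrow> 'c::topological_space"
    by (rule continuous_on_subset[OF that cc(2)])
  have slice: "continuous_on (closure U) (\<lambda>x. f (x, \<tau>))" if "continuous_on W f" "\<tau> \<in> {s..t}" for f :: "_ \<Rightarrow> 'c::topological_space" and \<tau>
    by (rule continuous_on_compose2[OF contC[OF that(1)]]) (use that in \<open>auto intro!: continuous_intros\<close>)
  have UM: "U \<in> lmeasurable"
    using bounded_subset[OF compact_imp_bounded[OF cc(1)] closure_subset] U(1)
    by (intro bounded_set_imp_lmeasurable) auto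
  show "in_CL2 U s t (\<lambda>z. ereal (h z))"
    unfolding in_CL2_def
  proof
    show "\<forall>\<tau>\<in>{s..t}. Lp_ereal_on 2 U (\<lambda>x. ereal (h (x, \<tau>)))"
      unfolding Lp_ereal_on_def
      using Lp_on_continuous[OF U(1) closure_subset cc(1) slice[OF cont(1)]] by simp
    have "bounded (h ` (closure U \<times> {s..t}))"
      by (intro compact_imp_bounded compact_continuous_image contC cont cmp)
    then obtain M where M: "M > 0" "\<And>z. z \<in> closure U \<times> {s..t} \<Longrightarrow> norm (h z) \<le> M" by (auto simp: bounded_pos)
    interpret fm: finite_measure "lebesgue_on U" using UM by (rule finite_measure_lebesgue_on)
    have "(\<lambda>n. LINT x|lebesgue_on U. \<bar>h (x, r n)\<bar>\<^sup>2) \<longlonglongrightarrow> (LINT x|lebesgue_on U. \<bar>h (x, r0)\<bar>\<^sup>2)"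
      if r: "\<And>n. r n \<in> {s..t}" "r0 \<in> {s..t}" "r \<longlonglongrightarrow> r0" for r r0
    proof (rule integral_dominated_convergence[where w = "\<lambda>x. M\<^sup>2"])
      have "continuous_on U (\<lambda>x. h (x, \<tau>))" if "\<tau> \<in> {s..t}" for \<tau>
        using slice[OF cont(1) that] closure_subset continuous_on_subset by blast
      then have [measurable]: "(\<lambda>x. h (x, \<tau>)) \<in> borel_measurable (lebesgue_on U)" if "\<tau> \<in> {s..t}" for \<tau>
        using that UM by (intro continuous_imp_measurable_on_sets_lebesgue) auto
      show "(\<lambda>x. \<bar>h (x, r0)\<bar>\<^sup>2) \<in> borel_measurable (lebesgue_on U)"
        "(\<lambda>x. \<bar>h (x, r n)\<bar>\<^sup>2) \<in> borel_measurable (lebesgue_on U)" for n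
        using r by measurable
      show "AE x in lebesgue_on U. (\<lambda>n. \<bar>h (x, r n)\<bar>\<^sup>2) \<longlonglongrightarrow> \<bar>h (x, r0)\<bar>\<^sup>2"
      proof (rule AE_I2)
        fix x assume "x \<in> space (lebesgue_on U)"
        then have x: "x \<in> closure U" using closure_subset by (auto simp: space_restrict_space)
        have "(\<lambda>n. h (x, r n)) \<longlonglongrightarrow> h (x, r0)"
          by (rule continuous_on_tendsto_compose[OF contC[OF cont(1)]]) (use x r in \<open>auto intro!: tendsto_intros\<close>)
        then show "(\<lambda>n. \<bar>h (x, r n)\<bar>\<^sup>2) \<longlonglongrightarrow> \<bar>h (x, r0)\<bar>\<^sup>2" by (intro tendsto_intros)
      qed
      show "AE x in lebesgue_on U. norm (\<bar>h (x, r n)\<bar>\<^sup>2) \<le> M\<^sup>2" for n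
      proof (rule AE_I2)
        fix x assume "x \<in> space (lebesgue_on U)"
        then have x: "x \<in> closure U" using closure_subset by (auto simp: space_restrict_space)
        then show "norm (\<bar>h (x, r n)\<bar>\<^sup>2) \<le> M\<^sup>2" using M(2)[of "(x, r n)"] r(1)[of n]
          power_mono[of "\<bar>h (x, r n)\<bar>" M 2] by simp
      qed
    qed simp
    then show "continuous_on {s..t} (\<lambda>t. LINT x|lebesgue_on U. \<bar>real_of_ereal (ereal (h (x, t)))\<bar>\<^sup>2)"
      unfolding continuous_on_sequentially by (simp add: o_def)
  qed
  have W1p: "W1p_with_gradient p U (\<lambda>x. ereal (h (x, \<tau>))) (\<lambda>x. hx (x, \<tau>))" if \<tau>: "\<tau> \<in> {s<..<t}" for \<tau>
    unfolding W1p_with_gradient_def Lp_ereal_on_def real_of_ereal.simps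
  proof (intro conjI allI impI)
    have \<tau>': "\<tau> \<in> {s..t}" using \<tau> by auto
    show "Lp_on p U (\<lambda>x. h (x, \<tau>))" "Lp_on p U (\<lambda>x. hx (x, \<tau>))"
      using p by (auto intro: Lp_on_continuous[OF U(1) closure_subset cc(1) slice] cont \<tau>')
    fix \<phi> :: "real^'n \<Rightarrow> real" and i
    assume "test_function U \<phi>"
    then obtain K where K: "compact K" "K \<subseteq> U" "\<And>z. z \<notin> K \<Longrightarrow> \<phi> z = 0"
      "continuous_on UNIV \<phi>" "\<And>v. continuous_on UNIV (\<lambda>z. frechet_derivative \<phi> (at z) v)"
      "\<And>z v. has_dir_deriv \<phi> v z (frechet_derivative \<phi> (at z) v)"
      using test_functionE by blast
    have cU: "continuous_on U (\<lambda>x. h (x, \<tau>))" "continuous_on U (\<lambda>x. hx (x, \<tau>) $ i)"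
      "continuous_on U \<phi>" "continuous_on U (\<lambda>z. frechet_derivative \<phi> (at z) (axis i 1))"
      using continuous_on_subset[OF slice[OF cont(1) \<tau>'] closure_subset]
        continuous_on_component[OF continuous_on_subset[OF slice[OF cont(2) \<tau>'] closure_subset]]
        continuous_on_subset[OF K(4) subset_UNIV] continuous_on_subset[OF K(5) subset_UNIV] by blast+
    have xW: "(x, \<tau>) \<in> W" if "x \<in> U" for x using CW that \<tau> by (auto simp: C_def)
    have "(LINT z|lborel. indicator U z * (hx (z, \<tau>) $ i * \<phi> z)) =
      - (LINT z|lborel. indicator U z * (h (z, \<tau>) * frechet_derivative \<phi> (at z) (axis i 1)))"
      by (rule integration_by_parts(3)[OF U(1) K(1,2) _ cU(1,2,3,4)])
         (use K(3,6) has_dir_deriv_slice[OF hx[OF xW]] in \<open>auto\<close>)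
    then show "(LINT x|lebesgue_on U. h (x, \<tau>) * frechet_derivative \<phi> (at x) (axis i 1)) =
        - (LINT x|lebesgue_on U. hx (x, \<tau>) $ i * \<phi> x)"
      using cU by (simp add: LINT_lebesgue_on_continuous[OF U(1)] continuous_on_mult)
  qed auto
  show "\<exists>g. LpW1p_with_gradient p U s t (\<lambda>z. ereal (h z)) g \<and>
       (\<forall>\<phi>. test_function (U \<times> {s<..<t}) \<phi> \<longrightarrow>
          (LINT z|lebesgue_on (U \<times> {s<..<t}). (norm (g z) powr (p - 2) *\<^sub>R g z) \<bullet> space_gradient \<phi> z) -
          (LINT z|lebesgue_on (U \<times> {s<..<t}). real_of_ereal (ereal (h z)) * time_derivative \<phi> z) = 0)"
    unfolding C_def[symmetric]
  proof (intro exI[of _ hx] conjI allI impI)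
    show "LpW1p_with_gradient p U s t (\<lambda>z. ereal (h z)) hx"
      unfolding LpW1p_with_gradient_def Lp_ereal_on_def C_def[symmetric] real_of_ereal.simps
      using W1p Lp_on_continuous[OF C CS cmp contC[OF cont(1)]] Lp_on_continuous[OF C CS cmp contC[OF cont(2)]] p
      by (auto intro!: AE_I2 simp: space_restrict_space)
    fix \<phi> assume "test_function C \<phi>"
    then obtain K where K: "compact K" "K \<subseteq> C" "\<And>z. z \<notin> K \<Longrightarrow> \<phi> z = 0"
      "continuous_on UNIV \<phi>" "\<And>v. continuous_on UNIV (\<lambda>z. frechet_derivative \<phi> (at z) v)"
      "\<And>z v. has_dir_deriv \<phi> v z (frechet_derivative \<phi> (at z) v)"
      using test_functionE by blast
    let ?D = "\<lambda>v z. frechet_derivative \<phi> (at z) v"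
    have cC: "continuous_on C h" "continuous_on C ht" "continuous_on C (\<lambda>z. F z $ i)" "continuous_on C (dF i)"
       "continuous_on C \<phi>" "continuous_on C (?D v)" for i v
      using continuous_on_subset[OF cont(1) CW] continuous_on_subset[OF cont(3) CW]
        continuous_on_component[OF continuous_on_subset[OF cont(4) CW]] continuous_on_subset[OF cont(5) CW]
        continuous_on_subset[OF K(4) subset_UNIV] continuous_on_subset[OF K(5) subset_UNIV] by blast+
    have A: "integrable lborel (\<lambda>z. indicator C z * (dF i z * \<phi> z))"
      "integrable lborel (\<lambda>z. indicator C z * (F z $ i * ?D (axis i 1, 0) z))"
      "(LINT z|lborel. indicator C z * (dF i z * \<phi> z)) = - (LINT z|lborel. indicator C z * (F z $ i * ?D (axis i 1, 0) z))" for i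
    proof -
      have k: "\<phi> z = 0" if "z \<in> C - K" for z using K(3) that by blast
      have d: "has_dir_deriv (\<lambda>z. F z $ i) (axis i 1, 0) z (dF i z)" if "z \<in> C" for z
        using dF that CW by blast
      note ibp = integration_by_parts[OF C K(1,2) k cC(3)[of i] cC(4)[of i] cC(5) cC(6)[of "(axis i 1, 0)"] d K(6)]
      show "integrable lborel (\<lambda>z. indicator C z * (dF i z * \<phi> z))"
        "integrable lborel (\<lambda>z. indicator C z * (F z $ i * ?D (axis i 1, 0) z))"
        "(LINT z|lborel. indicator C z * (dF i z * \<phi> z)) = - (LINT z|lborel. indicator C z * (F z $ i * ?D (axis i 1, 0) z))"
        using ibp by simp_all
    qed
    have B: "(LINT z|lborel. indicator C z * (ht z * \<phi> z)) = - (LINT z|lborel. indicator C z * (h z * ?D (0, 1) z))"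
    proof (rule integration_by_parts(3)[OF C K(1,2) _ cC(1) cC(2) cC(5) cC(6)[of "(0, 1)"]])
      show "\<phi> z = 0" if "z \<in> C - K" for z using K(3) that by blast
      show "has_dir_deriv h (0, 1) z (ht z)" if "z \<in> C" for z using ht that CW by blast
    qed (rule K(6))
    have "(LINT z|lebesgue_on C. (norm (hx z) powr (p - 2) *\<^sub>R hx z) \<bullet> space_gradient \<phi> z) =
       (LINT z|lebesgue_on C. (\<Sum>i\<in>UNIV. F z $ i * ?D (axis i 1, 0) z))"
      using F CW by (intro Bochner_Integration.integral_cong)
        (auto simp: inner_vec_def space_gradient_def space_restrict_space subset_iff)
    also have "\<dots> = (LINT z|lborel. indicator C z * (\<Sum>i\<in>UNIV. F z $ i * ?D (axis i 1, 0) z))"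
      by (intro LINT_lebesgue_on_continuous[OF C] continuous_on_sum continuous_on_mult cC)
    also have "\<dots> = (\<Sum>i\<in>UNIV. (LINT z|lborel. indicator C z * (F z $ i * ?D (axis i 1, 0) z)))"
      unfolding sum_distrib_left by (rule Bochner_Integration.integral_sum) (rule A(2))
    also have "\<dots> = - (\<Sum>i\<in>UNIV. (LINT z|lborel. indicator C z * (dF i z * \<phi> z)))"
      using A(3) by (simp add: sum_negf)
    also have "(\<Sum>i\<in>UNIV. (LINT z|lborel. indicator C z * (dF i z * \<phi> z))) = (LINT z|lborel. (\<Sum>i\<in>UNIV. indicator C z * (dF i z * \<phi> z)))"
      by (rule Bochner_Integration.integral_sum[symmetric]) (rule A(1))
    also have "\<dots> = (LINT z|lborel. indicator C z * (ht z * \<phi> z))"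
    proof (rule Bochner_Integration.integral_cong[OF refl])
      fix z
      show "(\<Sum>i\<in>UNIV. indicator C z * (dF i z * \<phi> z)) = indicator C z * (ht z * \<phi> z)"
        using eq[of z] CW by (cases "z \<in> C") (auto simp: sum_distrib_right)
    qed
    also have "\<dots> = - (LINT z|lborel. indicator C z * (h z * ?D (0, 1) z))" by (rule B)
    also have "(LINT z|lborel. indicator C z * (h z * ?D (0, 1) z)) = (LINT z|lebesgue_on C. h z * time_derivative \<phi> z)"
      unfolding time_derivative_def
      by (rule LINT_lebesgue_on_continuous[OF C, symmetric]) (intro continuous_intros cC)
    finally show "(LINT z|lebesgue_on C. (norm (hx z) powr (p - 2) *\<^sub>R hx z) \<bullet> space_gradient \<phi> z) -
      (LINT z|lebesgue_on C. real_of_ereal (ereal (h z)) * time_derivative \<phi> z) = 0" by simp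
  qed
qed

section \<open>The weak formulation in terms of Borel functions\<close>

text \<open>
  Fubini's theorem and convolution are formulated for Borel measurable functions, whereas weak
  gradients are only Lebesgue measurable on the cylinder.
\<close>

lemma borel_version_on:
  fixes f :: "'a::euclidean_space \<Rightarrow> 'b::euclidean_space"
  assumes C: "C \<in> sets borel" and f: "f \<in> borel_measurable (lebesgue_on C)"
  shows "\<exists>f'. f' \<in> borel_measurable borel \<and> (\<forall>z. z \<notin> C \<longrightarrow> f' z = 0) \<and>
    (AE z in lborel. z \<in> C \<longrightarrow> f' z = f z)"
proof -
  have m: "(\<lambda>z. indicator C z * (f z \<bullet> b)) \<in> borel_measurable lebesgue" for b
  proof -
    have "(\<lambda>z. f z \<bullet> b) \<in> borel_measurable (lebesgue_on C)" using f by measurable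
    then show ?thesis using C borel_measurable_restrict_space_iff[of C lebesgue "\<lambda>z. f z \<bullet> b"] by simp
  qed
  have "\<forall>b. \<exists>g'. g' \<in> borel_measurable lborel \<and> (AE z in lborel. indicator C z * (f z \<bullet> b) = g' z)"
    using completion_ex_borel_measurable_real[OF m] by blast
  from choice[OF this] obtain G where "\<forall>b. G b \<in> borel_measurable lborel \<and> (AE z in lborel. indicator C z * (f z \<bullet> b) = G b z)"
    by blast
  then have G: "G b \<in> borel_measurable lborel" "AE z in lborel. indicator C z * (f z \<bullet> b) = G b z" for b by auto
  define f' where "f' z = (\<Sum>b\<in>Basis. (indicator C z * G b z) *\<^sub>R b)" for z :: 'a
  have [measurable]: "G b \<in> borel_measurable borel" for b using G(1) by simp
  show ?thesis
  proof (intro exI[of _ f'] conjI allI impI)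
    show "f' \<in> borel_measurable borel" unfolding f'_def using C by measurable
    show "f' z = 0" if "z \<notin> C" for z using that by (simp add: f'_def)
    have "AE z in lborel. \<forall>b\<in>Basis. indicator C z * (f z \<bullet> b) = G b z"
      by (rule AE_finite_allI) (auto intro: G(2))
    then show "AE z in lborel. z \<in> C \<longrightarrow> f' z = f z"
    proof eventually_elim
      case (elim z)
      show ?case
      proof
        assume z: "z \<in> C"
        then have "f' z = (\<Sum>b\<in>Basis. (f z \<bullet> b) *\<^sub>R b)" unfolding f'_def using elim by (intro sum.cong) auto
        then show "f' z = f z" by (simp add: euclidean_representation)
      qed
    qed
  qed
qed

lemma LINT_lebesgue_on_AE:
  fixes f f' :: "'a::euclidean_space \<Rightarrow> real"
  assumes C: "C \<in> sets borel" and f: "f \<in> borel_measurable (lebesgue_on C)"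
    and f': "f' \<in> borel_measurable borel" "\<And>z. z \<notin> C \<Longrightarrow> f' z = 0" "AE z in lborel. z \<in> C \<longrightarrow> f' z = f z"
  shows "(LINT z|lebesgue_on C. f z) = (LINT z|lborel. f' z)"
proof -
  have m: "(\<lambda>z. indicator C z * f z) \<in> borel_measurable lebesgue"
    using f C borel_measurable_restrict_space_iff[of C lebesgue f] by simp
  have "(LINT z|lebesgue_on C. f z) = (LINT z|lebesgue. indicator C z *\<^sub>R f z)"
    using C by (intro integral_restrict_space) auto
  also have "\<dots> = (LINT z|lebesgue. f' z)"
  proof (rule integral_cong_AE)
    show "f' \<in> borel_measurable lebesgue" using f'(1) by (simp add: measurable_completion)
    have "AE z in lebesgue. z \<in> C \<longrightarrow> f' z = f z" using f'(3) by (rule AE_completion)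
    then show "AE z in lebesgue. indicator C z *\<^sub>R f z = f' z"
      by eventually_elim (auto simp: indicator_def f'(2))
  qed (use m in simp)
  also have "\<dots> = (LINT z|lborel. f' z)" using f'(1) by (intro integral_completion) simp
  finally show ?thesis .
qed

lemma AE_lebesgue_on_iff:
  fixes C :: "'a::euclidean_space set"
  assumes "C \<in> sets borel"
  shows "(AE z in lebesgue_on C. P z) \<longleftrightarrow> (AE z in lborel. z \<in> C \<longrightarrow> P z)"
  using assms by (subst AE_restrict_space_iff) (auto simp: AE_completion_iff)

text \<open>
  The exceptional null set is first enlarged to a Borel set, whose slices can be measured.
\<close>

lemma AE_lborel_slices:
  fixes P :: "'a::euclidean_space \<times> 'b::euclidean_space \<Rightarrow> bool"
  assumes "AE z in lborel. P z"
  shows "AE y in lborel. AE x in lborel. P (x, y)"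
proof -
  obtain N where N: "{z. \<not> P z} \<subseteq> N" "N \<in> sets lborel" "emeasure lborel N = 0"
    using AE_E[OF assms] by auto
  have "AE z in (lborel :: ('a \<times> 'b) measure). z \<notin> N"
    using N by (intro AE_not_in) auto
  then have "AE z in (lborel \<Otimes>\<^sub>M lborel). z \<notin> N" unfolding lborel_prod .
  then have "AE x in lborel. AE y in lborel. (x, y) \<notin> N" using lborel_pair.AE_pair by fastforce
  moreover have "{z \<in> space (lborel \<Otimes>\<^sub>M lborel). (fst z, snd z) \<notin> N} \<in> sets (lborel \<Otimes>\<^sub>M lborel)"
  proof -
    have "{z \<in> space (lborel \<Otimes>\<^sub>M lborel). (fst z, snd z) \<notin> N} = - N" by (auto simp: space_pair_measure)
    then show ?thesis unfolding lborel_prod using N by auto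
  qed
  ultimately have "AE y in lborel. AE x in lborel. (x, y) \<notin> N"
    by (subst (asm) lborel_pair.AE_commute)
  then show ?thesis by eventually_elim (use N(1) in \<open>auto elim!: eventually_mono\<close>)
qed

lemma test_function_slice:
  assumes "test_function (U \<times> I) (\<phi> :: 'a::real_normed_vector \<times> 'b::real_normed_vector \<Rightarrow> real)" "\<tau> \<in> I"
  shows "test_function U (\<lambda>x. \<phi> (x, \<tau>))"
    "frechet_derivative (\<lambda>x. \<phi> (x, \<tau>)) (at x) v = frechet_derivative \<phi> (at (x, \<tau>)) (v, 0)"
proof -
  have Ck: "C_k k \<phi>" for k using assms by (simp add: test_function_def)
  have L: "bounded_linear (\<lambda>x::'a. (x, 0::'b))" by (intro bounded_linear_Pair bounded_linear_ident bounded_linear_zero)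
  have Ck': "C_k k (\<lambda>x. \<phi> (x, \<tau>))" for k
    using C_k_affine[OF L Ck, of k "(0, \<tau>)"] by simp
  obtain K where K: "compact K" "K \<subseteq> U \<times> I" "\<And>z. z \<notin> K \<Longrightarrow> \<phi> z = 0"
    using test_functionE[OF assms(1)] by metis
  define K' where "K' = fst ` (K \<inter> snd -` {\<tau>})"
  have "compact K'" unfolding K'_def
  proof (rule compact_continuous_image[OF continuous_on_fst[OF continuous_on_id]])
    have "closed (snd -` {\<tau>} :: ('a \<times> 'b) set)"
      by (rule closed_vimage) (auto intro!: continuous_intros)
    then show "compact (K \<inter> snd -` {\<tau>})" using K(1) by (rule compact_Int_closed[rotated])
  qed
  moreover have "{x. \<phi> (x, \<tau>) \<noteq> 0} \<subseteq> K'" unfolding K'_def using K(3) by force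
  ultimately have "closure {x. \<phi> (x, \<tau>) \<noteq> 0} \<subseteq> K'"
    by (simp add: closure_minimal compact_imp_closed)
  moreover have "K' \<subseteq> U" using K(2) by (auto simp: K'_def)
  moreover have "compact (K' \<inter> closure {x. \<phi> (x, \<tau>) \<noteq> 0})"
    using \<open>compact K'\<close> by (rule compact_Int_closed) simp
  ultimately have "compactly_contained {x. \<phi> (x, \<tau>) \<noteq> 0} U"
    unfolding compactly_contained_def by (auto simp: inf.absorb2)
  then show "test_function U (\<lambda>x. \<phi> (x, \<tau>))" using Ck' by (simp add: test_function_def)
  have "\<phi> differentiable at (x, \<tau>)" using Ck[of "Suc 0"] by simp
  then have "(\<phi> has_derivative frechet_derivative \<phi> (at (x, \<tau>))) (at (x, \<tau>))"
    by (simp add: frechet_derivative_works)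
  moreover have "((\<lambda>x. (x, \<tau>)) has_derivative (\<lambda>v. (v, 0))) (at x)"
    by (auto intro!: derivative_eq_intros)
  ultimately have "((\<lambda>x. \<phi> (x, \<tau>)) has_derivative (\<lambda>v. frechet_derivative \<phi> (at (x, \<tau>)) (v, 0))) (at x)"
    by (rule has_derivative_compose[rotated])
  then show "frechet_derivative (\<lambda>x. \<phi> (x, \<tau>)) (at x) v = frechet_derivative \<phi> (at (x, \<tau>)) (v, 0)"
    by (simp add: frechet_derivative_at[symmetric])
qed

text \<open>
  The weak gradient is prescribed on time slices; integrating over time turns it into a weak
  gradient in space-time.
\<close>

lemma slice_gradient_imp_spacetime_gradient:
  fixes h :: "(real^'n) \<times> real \<Rightarrow> real" and g gb :: "(real^'n) \<times> real \<Rightarrow> real^'n"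
  assumes U: "open U" "s < t" and L: "LpW1p_with_gradient p U s t (\<lambda>z. ereal (h z)) g"
    and h: "continuous_on (U \<times> {s<..<t}) h"
    and gb: "gb \<in> borel_measurable borel" "\<And>z. z \<notin> U \<times> {s<..<t} \<Longrightarrow> gb z = 0"
      "AE z in lborel. z \<in> U \<times> {s<..<t} \<longrightarrow> gb z = g z" "integrable lborel (\<lambda>z. gb z $ i)"
    and \<phi>: "test_function (U \<times> {s<..<t}) \<phi>"
  shows "(LINT z|lborel. indicator (U \<times> {s<..<t}) z * (h z * frechet_derivative \<phi> (at z) (axis i 1, 0))) =
     - (LINT z|lborel. gb z $ i * \<phi> z)"
proof -
  let ?C = "U \<times> {s<..<t}"
  let ?D = "\<lambda>z. frechet_derivative \<phi> (at z) (axis i 1, 0)"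
  obtain K where K: "compact K" "K \<subseteq> ?C" "\<And>z. z \<notin> K \<Longrightarrow> \<phi> z = 0"
    "continuous_on UNIV \<phi>" "\<And>v. continuous_on UNIV (\<lambda>z. frechet_derivative \<phi> (at z) v)"
    "\<And>z v. has_dir_deriv \<phi> v z (frechet_derivative \<phi> (at z) v)"
    by (rule test_functionE[OF \<phi>]) blast
  have C: "open ?C" using U by (simp add: open_Times)
  obtain B where B: "B > 0" "\<And>z. \<bar>\<phi> z\<bar> \<le> B"
    using bounded_continuous_compact_support[OF K(4,1,3)] by metis
  have [measurable]: "\<phi> \<in> borel_measurable borel" "?D \<in> borel_measurable borel"
    using K(4,5) by (auto intro: borel_measurable_continuous_onI)
  define F1 where "F1 z = indicator ?C z * (h z * ?D z)" for z
  define F2 where "F2 z = gb z $ i * \<phi> z" for z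
  have D0: "?D z = 0" if "z \<notin> K" for z
    by (rule dir_deriv_off_support[OF K(1,3,6) that])
  have I1: "integrable lborel F1"
  proof -
    have cK: "continuous_on K (\<lambda>z. h z * ?D z)"
      by (intro continuous_intros continuous_on_subset[OF h K(2)] continuous_on_subset[OF K(5) subset_UNIV])
    have "integrable lborel (\<lambda>x. indicator K x *\<^sub>R (h x * ?D x))"
      by (rule borel_integrable_compact[OF K(1) cK])
    moreover have "F1 = (\<lambda>x. indicator K x *\<^sub>R (h x * ?D x))"
      unfolding F1_def by (rule ext) (use K(2) D0 in \<open>auto simp: indicator_def\<close>)
    ultimately show ?thesis by simp
  qed
  have [measurable]: "(\<lambda>z. gb z $ i) \<in> borel_measurable borel" using gb(4) by auto
  have I2: "integrable lborel F2"
    unfolding F2_def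
  proof (rule Bochner_Integration.integrable_bound)
    show "integrable lborel (\<lambda>z. B * (gb z $ i))" using gb(4) by simp
    show "AE z in lborel. norm (gb z $ i * \<phi> z) \<le> norm (B * (gb z $ i))"
    proof (rule AE_I2)
      fix z
      show "norm (gb z $ i * \<phi> z) \<le> norm (B * (gb z $ i))"
        using mult_right_mono[OF B(2)[of z], of "\<bar>gb z $ i\<bar>"] B(1) by (simp add: abs_mult mult.commute)
    qed
  qed measurable
  have P1: "integrable (lborel \<Otimes>\<^sub>M lborel) (case_prod (\<lambda>x y. F1 (x, y)))"
    and P2: "integrable (lborel \<Otimes>\<^sub>M lborel) (case_prod (\<lambda>x y. F2 (x, y)))"
    using I1 I2 by (simp_all add: lborel_prod)
  have E1: "(LINT z|lborel. F1 z) = (LINT \<tau>|lborel. (LINT x|lborel. F1 (x, \<tau>)))"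
    using lborel_pair.integral_snd[OF P1] by (simp add: lborel_prod)
  have E2: "(LINT z|lborel. F2 z) = (LINT \<tau>|lborel. (LINT x|lborel. F2 (x, \<tau>)))"
    using lborel_pair.integral_snd[OF P2] by (simp add: lborel_prod)
  have "AE \<tau> in lborel. \<tau> \<in> {s<..<t} \<longrightarrow> W1p_with_gradient p U (\<lambda>x. ereal (h (x, \<tau>))) (\<lambda>x. g (x, \<tau>))"
    using L unfolding LpW1p_with_gradient_def by (subst (asm) AE_lebesgue_on_iff) auto
  moreover have "AE \<tau> in lborel. AE x in lborel. (x, \<tau>) \<in> ?C \<longrightarrow> gb (x, \<tau>) = g (x, \<tau>)"
    by (rule AE_lborel_slices[OF gb(3)])
  ultimately have "AE \<tau> in lborel. (LINT x|lborel. F1 (x, \<tau>)) = - (LINT x|lborel. F2 (x, \<tau>))"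
  proof eventually_elim
    case (elim \<tau>)
    show ?case
    proof (cases "\<tau> \<in> {s<..<t}")
      case False
      then have "F1 (x, \<tau>) = 0" "F2 (x, \<tau>) = 0" for x using gb(2) by (auto simp: F1_def F2_def)
      then show ?thesis by simp
    next
      case True
      note W = elim(1)[rule_format, OF True]
      note sl = test_function_slice[OF \<phi> True]
      have eq: "(LINT x|lebesgue_on U. h (x, \<tau>) * ?D (x, \<tau>)) = - (LINT x|lebesgue_on U. g (x, \<tau>) $ i * \<phi> (x, \<tau>))"
        using W sl by (auto simp: W1p_with_gradient_def)
      have "continuous_on U (\<lambda>x. h (x, \<tau>))"
        by (rule continuous_on_compose2[OF h]) (use True in \<open>auto intro!: continuous_intros\<close>)
      moreover have "continuous_on U (\<lambda>x. ?D (x, \<tau>))"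
        by (rule continuous_on_compose2[OF K(5)]) (auto intro!: continuous_intros)
      ultimately have "(LINT x|lebesgue_on U. h (x, \<tau>) * ?D (x, \<tau>)) = (LINT x|lborel. indicator U x * (h (x, \<tau>) * ?D (x, \<tau>)))"
        by (intro LINT_lebesgue_on_continuous[OF U(1)] continuous_on_mult)
      also have "\<dots> = (LINT x|lborel. F1 (x, \<tau>))"
        unfolding F1_def using True by (intro Bochner_Integration.integral_cong) (auto simp: indicator_def)
      finally have l: "(LINT x|lebesgue_on U. h (x, \<tau>) * ?D (x, \<tau>)) = (LINT x|lborel. F1 (x, \<tau>))" .
      have r: "(LINT x|lebesgue_on U. g (x, \<tau>) $ i * \<phi> (x, \<tau>)) = (LINT x|lborel. F2 (x, \<tau>))"
      proof (rule LINT_lebesgue_on_AE)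
        show "U \<in> sets borel" using U by simp
        have "(\<lambda>x. g (x, \<tau>)) \<in> borel_measurable (lebesgue_on U)"
          using W by (auto simp: W1p_with_gradient_def Lp_on_def)
        then have "(\<lambda>x. g (x, \<tau>) $ i) \<in> borel_measurable (lebesgue_on U)"
          by (rule borel_measurable_continuous_on[OF continuous_on_component[OF continuous_on_id]])
        moreover have "(\<lambda>x. \<phi> (x, \<tau>)) \<in> borel_measurable (lebesgue_on U)"
        proof (rule continuous_imp_measurable_on_sets_lebesgue)
          show "continuous_on U (\<lambda>x. \<phi> (x, \<tau>))"
            by (rule continuous_on_compose2[OF K(4)]) (auto intro!: continuous_intros)
        qed (use U in auto)
        ultimately show "(\<lambda>x. g (x, \<tau>) $ i * \<phi> (x, \<tau>)) \<in> borel_measurable (lebesgue_on U)"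
          by (rule borel_measurable_times)
        show "(\<lambda>x. F2 (x, \<tau>)) \<in> borel_measurable borel" unfolding F2_def by measurable
        show "F2 (x, \<tau>) = 0" if "x \<notin> U" for x using that gb(2) by (simp add: F2_def)
        show "AE x in lborel. x \<in> U \<longrightarrow> F2 (x, \<tau>) = g (x, \<tau>) $ i * \<phi> (x, \<tau>)"
          using elim(2) by eventually_elim (use True in \<open>auto simp: F2_def\<close>)
      qed
      show ?thesis using eq l r by simp
    qed
  qed
  then have "(LINT \<tau>|lborel. (LINT x|lborel. F1 (x, \<tau>))) = (LINT \<tau>|lborel. - (LINT x|lborel. F2 (x, \<tau>)))"
    using lborel_pair.integrable_snd[OF P1] lborel_pair.integrable_snd[OF P2]
    by (intro integral_cong_AE) auto
  then show ?thesis using E1 E2 by (simp add: F1_def F2_def)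
qed

text \<open>
  The vector field whose divergence is the \<open>p\<close>-Laplacian when \<open>v\<close> is the gradient.
\<close>

definition p_flux :: "real \<Rightarrow> 'a::real_normed_vector \<Rightarrow> 'a" where
  "p_flux p v = norm v powr (p - 2) *\<^sub>R v"

lemma norm_p_flux: "1 < p \<Longrightarrow> norm (p_flux p v) = norm v powr (p - 1)"
proof (cases "v = 0")
  case False
  have "norm v powr (p - 2) * norm v = norm v powr (p - 2) * norm v powr 1" using False by simp
  also have "\<dots> = norm v powr (p - 1)" unfolding powr_add[symmetric] by simp
  finally show ?thesis by (simp add: p_flux_def)
qed (simp add: p_flux_def)

lemma powr_le_1_plus_powr:
  fixes x a p :: real
  assumes "0 \<le> x" "0 < a" "a \<le> p"
  shows "x powr a \<le> 1 + x powr p"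
proof (cases "x \<le> 1")
  case True
  then have "x powr a \<le> 1" using assms powr_mono2[of a x 1] by simp
  then show ?thesis by (metis add_increasing2 powr_ge_zero)
next
  case False
  then have "x powr a \<le> x powr p" using assms by (intro powr_mono) auto
  then show ?thesis by linarith
qed

text \<open>
  Both \<open>|g|\<close> and \<open>|g|\<^sup>p\<^sup>-\<^sup>1\<close> are at most \<open>1 + |g|\<^sup>p\<close>. One integrable function thus dominates the gradient and its flux.
\<close>

lemma gradient_flux_bounds:
  fixes g :: "'a::euclidean_space \<Rightarrow> real^'n"
  assumes p: "1 < p" and C: "C \<in> sets borel" "bounded C"
    and g: "g \<in> borel_measurable borel" "\<forall>z. z \<notin> C \<longrightarrow> g z = 0" "integrable lborel (\<lambda>z. norm (g z) powr p)"
  shows "integrable lborel (\<lambda>z. indicator C z + norm (g z) powr p)"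
    and "\<bar>g z $ i\<bar> \<le> indicator C z + norm (g z) powr p"
    and "\<bar>p_flux p (g z) $ i\<bar> \<le> indicator C z + norm (g z) powr p"
    and "integrable lborel (\<lambda>z. g z $ i)" and "integrable lborel (\<lambda>z. p_flux p (g z) $ i)"
proof -
  have g0: "g z = 0" if "z \<notin> C" for z using g(2) that by blast
  have "integrable lborel (indicator C :: 'a \<Rightarrow> real)"
    using C emeasure_bounded_finite by (intro integrable_real_indicator) auto
  then show iQ: "integrable lborel (\<lambda>z. indicator C z + norm (g z) powr p)" using g(3) by simp
  show gQ: "\<bar>g z $ i\<bar> \<le> indicator C z + norm (g z) powr p" for z i
    using g0[of z] component_le_norm_cart[of "g z" i] powr_le_1_plus_powr[of "norm (g z)" 1 p] p
    by (cases "z \<in> C") auto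
  show FQ: "\<bar>p_flux p (g z) $ i\<bar> \<le> indicator C z + norm (g z) powr p" for z i
    using g0[of z] component_le_norm_cart[of "p_flux p (g z)" i] powr_le_1_plus_powr[of "norm (g z)" "p - 1" p] p
    by (cases "z \<in> C") (auto simp: norm_p_flux p_flux_def[of p 0])
  have fluxm: "(\<lambda>z. p_flux p (g z)) \<in> borel_measurable borel" unfolding p_flux_def using g(1) by measurable
  have cm: "(\<lambda>z. f z $ i) \<in> borel_measurable lborel" if "f \<in> borel_measurable borel" for f :: "'a \<Rightarrow> real^'n"
    using borel_measurable_continuous_on[OF continuous_on_component[OF continuous_on_id] that] by simp
  have Q0: "0 \<le> indicator C z + norm (g z) powr p" for z by simp
  show "integrable lborel (\<lambda>z. g z $ i)"
    by (rule Bochner_Integration.integrable_bound[OF iQ cm[OF g(1)]], rule AE_I2)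
      (simp only: real_norm_def abs_of_nonneg[OF Q0] gQ)
  show "integrable lborel (\<lambda>z. p_flux p (g z) $ i)"
    by (rule Bochner_Integration.integrable_bound[OF iQ cm[OF fluxm]], rule AE_I2)
      (simp only: real_norm_def abs_of_nonneg[OF Q0] FQ)
qed

text \<open>
  The gradient is a Borel function on the whole space that vanishes outside \<open>C\<close>. The two equations say that it is a weak
  gradient in space-time and that \<open>h\<close> solves the \<open>p\<close>-parabolic equation weakly in \<open>C\<close>.
\<close>

definition borel_weak_gradient ::
  "real \<Rightarrow> ((real^'n) \<times> real) set \<Rightarrow> ((real^'n) \<times> real \<Rightarrow> real) \<Rightarrow> ((real^'n) \<times> real \<Rightarrow> real^'n) \<Rightarrow> bool" where
  "borel_weak_gradient p C h g \<longleftrightarrow>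
     g \<in> borel_measurable borel \<and> (\<forall>z. z \<notin> C \<longrightarrow> g z = 0) \<and> integrable lborel (\<lambda>z. norm (g z) powr p) \<and>
     (\<forall>\<phi> i. test_function C \<phi> \<longrightarrow>
       (LINT z|lborel. indicator C z * (h z * frechet_derivative \<phi> (at z) (axis i 1, 0))) =
       - (LINT z|lborel. g z $ i * \<phi> z)) \<and>
     (\<forall>\<phi>. test_function C \<phi> \<longrightarrow>
       (\<Sum>i\<in>UNIV. LINT z|lborel. p_flux p (g z) $ i * frechet_derivative \<phi> (at z) (axis i 1, 0)) =
       (LINT z|lborel. indicator C z * (h z * frechet_derivative \<phi> (at z) (0, 1))))"

lemma p_parabolic_borel_gradient:
  fixes h :: "(real^'n) \<times> real \<Rightarrow> real"
  assumes p: "1 < p" and h: "p_parabolic p W h" and U: "open U" "s < t" "compactly_contained (U \<times> {s<..<t}) W"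
  shows "\<exists>g. borel_weak_gradient p (U \<times> {s<..<t}) h g"
proof -
  let ?C = "U \<times> {s<..<t}"
  have C: "open ?C" using U by (simp add: open_Times)
  then have Cb: "?C \<in> sets borel" by simp
  have "?C \<subseteq> W" using U(3) closure_subset[of ?C] unfolding compactly_contained_def by blast
  then have hC: "continuous_on ?C h" using h continuous_on_subset[of W h ?C] unfolding p_parabolic_def by blast
  obtain g0 where g0: "LpW1p_with_gradient p U s t (\<lambda>z. ereal (h z)) g0"
    "\<And>\<phi>. test_function ?C \<phi> \<Longrightarrow>
       (LINT z|lebesgue_on ?C. (norm (g0 z) powr (p - 2) *\<^sub>R g0 z) \<bullet> space_gradient \<phi> z) -
       (LINT z|lebesgue_on ?C. real_of_ereal (ereal (h z)) * time_derivative \<phi> z) = 0"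
  proof -
    have ws: "weak_solution p W (\<lambda>z. ereal (h z))" using h unfolding p_parabolic_def by (rule conjunct2)
    show thesis
      using ws[unfolded weak_solution_def, THEN spec, THEN spec, THEN spec, THEN mp, OF conjI[OF U(1) conjI[OF U(2,3)]], THEN conjunct2]
        that by blast
  qed
  have m0: "g0 \<in> borel_measurable (lebesgue_on ?C)" and i0: "integrable (lebesgue_on ?C) (\<lambda>z. norm (g0 z) powr p)"
    using g0(1) by (auto simp: LpW1p_with_gradient_def Lp_on_def)
  from borel_version_on[OF Cb m0]
  obtain g where g': "g \<in> borel_measurable borel \<and> (\<forall>z. z \<notin> ?C \<longrightarrow> g z = 0) \<and> (AE z in lborel. z \<in> ?C \<longrightarrow> g z = g0 z)"
    by (rule exE)
  note g = conjunct1[OF g'] conjunct1[OF conjunct2[OF g'], rule_format] conjunct2[OF conjunct2[OF g']]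
  note [measurable] = g(1)
  have gP: "integrable lborel (\<lambda>z. norm (g z) powr p)"
  proof -
    have 1: "integrable lebesgue (\<lambda>z. indicator ?C z *\<^sub>R (norm (g0 z) powr p))"
      using i0 Cb by (subst (asm) integrable_restrict_space) auto
    have 2: "AE z in lebesgue. indicator ?C z *\<^sub>R (norm (g0 z) powr p) = norm (g z) powr p"
      using AE_completion[OF g(3)] by eventually_elim (auto simp: indicator_def g(2))
    have 3: "(\<lambda>z. norm (g z) powr p) \<in> borel_measurable lebesgue"
      by (intro measurable_completion) measurable
    have "integrable lebesgue (\<lambda>z. norm (g z) powr p)"
      by (rule integrable_cong_AE_imp[OF 1 3 2])
    then show ?thesis by (subst (asm) integrable_completion) auto
  qed
  have bC: "bounded ?C"
    using bounded_subset[OF compact_imp_bounded[OF conjunct1[OF U(3)[unfolded compactly_contained_def]]] closure_subset] .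
  note bounds = gradient_flux_bounds[OF p Cb bC g(1) conjunct1[OF conjunct2[OF g']] gP]
  note gi = bounds(4) and Fi = bounds(5)
  show ?thesis
    unfolding borel_weak_gradient_def
  proof (intro exI[of _ g] conjI allI impI g(1,2) gP)
    show "(LINT z|lborel. indicator ?C z * (h z * frechet_derivative \<phi> (at z) (axis i 1, 0))) =
       - (LINT z|lborel. g z $ i * \<phi> z)" if "test_function ?C \<phi>" for \<phi> i
      by (rule slice_gradient_imp_spacetime_gradient[OF U(1,2) g0(1) hC g gi that])
    fix \<phi> assume \<phi>: "test_function ?C \<phi>"
    obtain K where K: "compact K" "K \<subseteq> ?C" "\<And>z. z \<notin> K \<Longrightarrow> \<phi> z = 0"
      "continuous_on UNIV \<phi>" "\<And>v. continuous_on UNIV (\<lambda>z. frechet_derivative \<phi> (at z) v)"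
      "\<And>z v. has_dir_deriv \<phi> v z (frechet_derivative \<phi> (at z) v)"
      by (rule test_functionE[OF \<phi>]) blast
    let ?D = "\<lambda>v z. frechet_derivative \<phi> (at z) v"
    have Dm[measurable]: "?D v \<in> borel_measurable borel" for v
      by (rule borel_measurable_continuous_onI[OF K(5)])
    have Fm: "(\<lambda>z. p_flux p (g z) $ i) \<in> borel_measurable borel" for i
      using borel_measurable_continuous_on[OF continuous_on_component[OF continuous_on_id] g(1), of i]
      unfolding p_flux_def by simp
    have FD: "integrable lborel (\<lambda>z. p_flux p (g z) $ i * ?D v z)" for i v
    proof -
      have D0: "?D v z = 0" if "z \<notin> K" for z
        by (rule dir_deriv_off_support[OF K(1,3,6) that])
      obtain B where B: "B > 0" "\<And>z. \<bar>?D v z\<bar> \<le> B"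
        using bounded_continuous_compact_support[OF K(5,1) D0] by metis
      show ?thesis
      proof (rule Bochner_Integration.integrable_bound)
        show "integrable lborel (\<lambda>z. B * (p_flux p (g z) $ i))" using Fi by simp
        show "(\<lambda>z. p_flux p (g z) $ i * ?D v z) \<in> borel_measurable lborel"
          using Fm[of i] Dm[of v] by simp
        show "AE z in lborel. norm (p_flux p (g z) $ i * ?D v z) \<le> norm (B * (p_flux p (g z) $ i))"
        proof (rule AE_I2)
          fix z
          show "norm (p_flux p (g z) $ i * ?D v z) \<le> norm (B * (p_flux p (g z) $ i))"
            using mult_right_mono[OF B(2)[of z], of "\<bar>p_flux p (g z) $ i\<bar>"] B(1) by (simp add: abs_mult mult.commute)
        qed
      qed
    qed
    have "(\<Sum>i\<in>UNIV. LINT z|lborel. p_flux p (g z) $ i * ?D (axis i 1, 0) z) =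
        (LINT z|lborel. (\<Sum>i\<in>UNIV. p_flux p (g z) $ i * ?D (axis i 1, 0) z))"
      using FD by simp
    also have "\<dots> = (LINT z|lebesgue_on ?C. (norm (g0 z) powr (p - 2) *\<^sub>R g0 z) \<bullet> space_gradient \<phi> z)"
    proof (rule LINT_lebesgue_on_AE[OF Cb, symmetric])
      show "(\<lambda>z. \<Sum>i\<in>UNIV. p_flux p (g z) $ i * ?D (axis i 1, 0) z) \<in> borel_measurable borel"
        using Fm Dm by (intro borel_measurable_sum borel_measurable_times) auto
      show "(\<Sum>i\<in>UNIV. p_flux p (g z) $ i * ?D (axis i 1, 0) z) = 0" if "z \<notin> ?C" for z
        using g(2)[OF that] by (simp add: p_flux_def)
      show "AE z in lborel. z \<in> ?C \<longrightarrow> (\<Sum>i\<in>UNIV. p_flux p (g z) $ i * ?D (axis i 1, 0) z) =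
          (norm (g0 z) powr (p - 2) *\<^sub>R g0 z) \<bullet> space_gradient \<phi> z"
        using g(3) by eventually_elim (auto simp: p_flux_def inner_vec_def space_gradient_def)
      have "?D v \<in> borel_measurable (lebesgue_on ?C)" for v
        using continuous_on_subset[OF K(5) subset_UNIV, of ?C] Cb
        by (intro continuous_imp_measurable_on_sets_lebesgue) auto
      moreover have "(\<lambda>z. g0 z $ i) \<in> borel_measurable (lebesgue_on ?C)" for i
        by (rule borel_measurable_continuous_on[OF continuous_on_component[OF continuous_on_id] m0])
      ultimately show "(\<lambda>z. (norm (g0 z) powr (p - 2) *\<^sub>R g0 z) \<bullet> space_gradient \<phi> z) \<in> borel_measurable (lebesgue_on ?C)"
        unfolding inner_vec_def space_gradient_def using m0 by simp
    qed
    also have "\<dots> = (LINT z|lebesgue_on ?C. h z * ?D (0, 1) z)"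
      using g0(2)[OF \<phi>] by (simp add: time_derivative_def)
    also have "\<dots> = (LINT z|lborel. indicator ?C z * (h z * ?D (0, 1) z))"
      by (rule LINT_lebesgue_on_continuous[OF C])
        (intro continuous_on_mult hC continuous_on_subset[OF K(5) subset_UNIV])
    finally show "(\<Sum>i\<in>UNIV. LINT z|lborel. p_flux p (g z) $ i * ?D (axis i 1, 0) z) =
       (LINT z|lborel. indicator ?C z * (h z * ?D (0, 1) z))" .
  qed
qed

section \<open>Comparison of weak solutions with classical supersolutions\<close>

text \<open>
  The monotonicity that makes the \<open>p\<close>-Laplacian elliptic.
\<close>

lemma p_flux_monotone:
  fixes a b :: "'a::real_inner"
  assumes "1 < p"
  shows "0 \<le> (p_flux p a - p_flux p b) \<bullet> (a - b)"
proof -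
  have sq: "norm v powr (p - 2) * (v \<bullet> v) = norm v powr (p - 1) * norm v" for v :: 'a
    using norm_p_flux[OF assms, of v] by (simp add: p_flux_def power2_norm_eq_inner[symmetric] power2_eq_square)
  have ineq: "norm v powr (p - 2) * (v \<bullet> w) \<le> norm v powr (p - 1) * norm w" for v w :: 'a
  proof -
    have "norm v powr (p - 2) * (v \<bullet> w) \<le> norm v powr (p - 2) * (norm v * norm w)"
      by (intro mult_left_mono norm_cauchy_schwarz) auto
    also have "\<dots> = norm v powr (p - 1) * norm w"
      using norm_p_flux[OF assms, of v] by (simp add: p_flux_def)
    finally show ?thesis .
  qed
  have "0 \<le> (norm a powr (p - 1) - norm b powr (p - 1)) * (norm a - norm b)"
  proof (cases "norm a \<le> norm b")
    case True
    then have "norm a powr (p - 1) \<le> norm b powr (p - 1)" using assms by (intro powr_mono2) auto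
    then show ?thesis using True by (intro mult_nonpos_nonpos) auto
  next
    case False
    then have "norm b powr (p - 1) \<le> norm a powr (p - 1)" using assms by (intro powr_mono2) auto
    then show ?thesis using False by (intro mult_nonneg_nonneg) auto
  qed
  also have "\<dots> \<le> (p_flux p a - p_flux p b) \<bullet> (a - b)"
    using ineq[of a b] ineq[of b a] sq[of a] sq[of b]
    by (simp add: p_flux_def inner_diff_left inner_diff_right algebra_simps inner_commute)
  finally show ?thesis .
qed

lemma DERIV_max_0_power:
  "((\<lambda>r::real. max 0 r ^ Suc (Suc n)) has_real_derivative real (Suc (Suc n)) * max 0 r ^ Suc n) (at r)"
proof -
  consider "r > 0" | "r < 0" | "r = 0" by linarith
  then show ?thesis
  proof cases
    case 1
    have "((\<lambda>r. r ^ Suc (Suc n)) has_real_derivative real (Suc (Suc n)) * r ^ Suc n) (at r)"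
      using DERIV_pow[of "Suc (Suc n)" r] by simp
    then have "((\<lambda>r::real. max 0 r ^ Suc (Suc n)) has_real_derivative real (Suc (Suc n)) * r ^ Suc n) (at r)"
      by (rule has_field_derivative_transform_within_open[of _ _ _ "{0<..}"]) (use 1 in auto)
    then show ?thesis using 1 by (simp add: max_def)
  next
    case 2
    have "((\<lambda>r. 0) has_real_derivative 0) (at r)" by simp
    then have "((\<lambda>r::real. max 0 r ^ Suc (Suc n)) has_real_derivative 0) (at r)"
      by (rule has_field_derivative_transform_within_open[of _ _ _ "{..<0}"]) (use 2 in auto)
    then show ?thesis using 2 by (simp add: max_def)
  next
    case 3
    have "(\<lambda>h::real. max 0 h ^ Suc n) \<midarrow>0\<rightarrow> max 0 0 ^ Suc n"
      by (intro tendsto_intros)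
    then have "(\<lambda>h. max 0 h ^ Suc n) \<midarrow>0\<rightarrow> (0::real)" by simp
    then have "(\<lambda>h::real. (max 0 (0 + h) ^ Suc (Suc n) - max 0 0 ^ Suc (Suc n)) / h) \<midarrow>0\<rightarrow> 0"
      by (rule Lim_transform_eventually) (auto simp: eventually_at_filter max_def)
    then show ?thesis unfolding 3 DERIV_def by simp
  qed
qed

text \<open>
  The cut-off \<open>((\<tau> - t)\<^sub>+)\<^sup>2\<close> in time replaces integration up to time \<open>\<tau>\<close>, and testing with the square of
  \<open>(e - \<sigma>)\<^sub>+\<close> instead of \<open>(e - \<sigma>)\<^sub>+\<close> itself keeps all functions differentiable.
\<close>

lemma energy_inequality:
  fixes e :: "(real^'n) \<times> real \<Rightarrow> real" and ex E :: "'n \<Rightarrow> (real^'n) \<times> real \<Rightarrow> real"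
    and et :: "(real^'n) \<times> real \<Rightarrow> real" and dE :: "'n \<Rightarrow> (real^'n) \<times> real \<Rightarrow> real"
  assumes V: "open V" and D: "compact D" "D \<subseteq> V"
    and c: "continuous_on V e" "continuous_on V et" "\<And>i. continuous_on V (ex i)" "\<And>i. continuous_on V (E i)"
      "\<And>i. continuous_on V (dE i)"
    and et: "\<And>z. z \<in> V \<Longrightarrow> has_dir_deriv e (0, 1) z (et z)"
    and ex: "\<And>z i. z \<in> V \<Longrightarrow> has_dir_deriv e (axis i 1, 0) z (ex i z)"
    and dE: "\<And>z i. z \<in> V \<Longrightarrow> has_dir_deriv (E i) (axis i 1, 0) z (dE i z)"
    and sub: "\<And>z. z \<in> V \<Longrightarrow> et z \<le> (\<Sum>i\<in>UNIV. dE i z)"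
    and supp: "\<And>z. z \<in> V \<Longrightarrow> \<sigma> < e z \<Longrightarrow> snd z < \<tau> \<Longrightarrow> z \<in> D"
  shows "integrable lborel (\<lambda>z. indicator V z * (2 / 3 * max 0 (e z - \<sigma>) ^ 3 * max 0 (\<tau> - snd z)))"
    and "(LINT z|lborel. indicator V z * (2 / 3 * max 0 (e z - \<sigma>) ^ 3 * max 0 (\<tau> - snd z)))
      \<le> (LINT z|lborel. indicator V z *
          (2 * max 0 (e z - \<sigma>) * (max 0 (\<tau> - snd z))\<^sup>2 * (- (\<Sum>i\<in>UNIV. ex i z * E i z))))"
proof -
  define S where "S z = (max 0 (e z - \<sigma>))\<^sup>2" for z
  define \<Phi> where "\<Phi> z = max 0 (e z - \<sigma>) ^ 3" for z
  define \<eta> where "\<eta> z = (max 0 (\<tau> - snd z))\<^sup>2" for z :: "(real^'n) \<times> real"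
  have cS: "continuous_on V S" "continuous_on V \<Phi>" "continuous_on V \<eta>"
    unfolding S_def \<Phi>_def \<eta>_def by (intro continuous_intros c)+
  have dS: "has_dir_deriv S v z (2 * max 0 (e z - \<sigma>) * a)" and d\<Phi>: "has_dir_deriv \<Phi> v z (3 * S z * a)"
    if "has_dir_deriv e v z a" for v z a
  proof -
    have "has_dir_deriv (\<lambda>z. e z - \<sigma>) v z (a - 0)"
      by (rule has_dir_deriv_diff[OF that has_dir_deriv_const])
    then have 1: "has_dir_deriv (\<lambda>z. e z - \<sigma>) v z a" by simp
    show "has_dir_deriv S v z (2 * max 0 (e z - \<sigma>) * a)" "has_dir_deriv \<Phi> v z (3 * S z * a)"
      using has_dir_deriv_chain[OF 1 DERIV_max_0_power[of 0]] has_dir_deriv_chain[OF 1 DERIV_max_0_power[of 1]]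
      by (simp_all add: S_def[abs_def] \<Phi>_def[abs_def] numeral_2_eq_2 numeral_3_eq_3)
  qed
  have d\<eta>: "has_dir_deriv \<eta> (v, r) z (2 * max 0 (\<tau> - snd z) * (- r))" for v r z
  proof -
    have 1: "has_dir_deriv (\<lambda>z. \<tau> - snd z) (v, r) z (- r)"
      unfolding has_dir_deriv_def by (auto intro!: derivative_eq_intros)
    show ?thesis
      using has_dir_deriv_chain[OF 1 DERIV_max_0_power[of 0]]
      by (simp add: \<eta>_def[abs_def] numeral_2_eq_2)
  qed
  have m0: "max 0 (e z - \<sigma>) = 0 \<or> max 0 (\<tau> - snd z) = 0" if "z \<in> V" "z \<notin> D" for z
  proof -
    have "e z \<le> \<sigma> \<or> \<tau> \<le> snd z" using supp[of z] that by linarith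
    then show ?thesis by auto
  qed
  have z0: "S z * \<eta> z = 0" "\<Phi> z * \<eta> z = 0" if "z \<in> V - D" for z
    using m0[of z] that by (auto simp: S_def \<Phi>_def \<eta>_def)
  have sum_int: "integrable lborel (\<lambda>z. indicator V z * f z)"
    if "continuous_on V f" "\<And>z. z \<in> V - D \<Longrightarrow> f z = 0" for f :: "(real^'n) \<times> real \<Rightarrow> real"
  proof -
    have "integrable lborel (\<lambda>z. indicator D z *\<^sub>R f z)"
      by (rule borel_integrable_compact[OF D(1) continuous_on_subset[OF that(1) D(2)]])
    moreover have "(\<lambda>z. indicator D z *\<^sub>R f z) = (\<lambda>z. indicator V z * f z)"
      by (rule ext) (use that(2) D(2) in \<open>auto simp: indicator_def\<close>)
    ultimately show ?thesis by simp
  qed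
  show I1: "integrable lborel (\<lambda>z. indicator V z * (2 / 3 * max 0 (e z - \<sigma>) ^ 3 * max 0 (\<tau> - snd z)))"
    by (rule sum_int, intro continuous_intros c) (auto dest!: m0)
  have I2: "integrable lborel (\<lambda>z. indicator V z * (S z * \<eta> z * et z))"
    by (rule sum_int, intro continuous_intros c cS) (use z0 in auto)
  have I3: "integrable lborel (\<lambda>z. indicator V z * (dE i z * (S z * \<eta> z)))" for i
    by (rule sum_int, intro continuous_intros c cS) (use z0 in auto)
  have I4: "integrable lborel (\<lambda>z. indicator V z * (E i z * (2 * max 0 (e z - \<sigma>) * ex i z * \<eta> z)))" for i
    by (rule sum_int, intro continuous_intros c cS) (auto dest!: m0 simp: \<eta>_def)
  have "(LINT z|lborel. indicator V z * (0 * (\<Phi> z * \<eta> z))) =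
     - (LINT z|lborel. indicator V z * (1 * (3 * S z * et z * \<eta> z + \<Phi> z * (2 * max 0 (\<tau> - snd z) * (- 1)))))"
  proof (rule integration_by_parts(3)[OF V D(1,2)])
    show "has_dir_deriv (\<lambda>z. \<Phi> z * \<eta> z) (0, 1) z (3 * S z * et z * \<eta> z + \<Phi> z * (2 * max 0 (\<tau> - snd z) * (- 1)))" if "z \<in> V" for z
      by (rule has_dir_deriv_mult[OF d\<Phi>[OF et[OF that]] d\<eta>])
    show "has_dir_deriv (\<lambda>z. 1) (0, 1) z 0" for z :: "(real^'n) \<times> real" by (rule has_dir_deriv_const)
  qed (use z0 in \<open>auto intro!: continuous_intros c cS\<close>)
  then have "(LINT z|lborel. indicator V z * (3 * S z * et z * \<eta> z + \<Phi> z * (2 * max 0 (\<tau> - snd z) * (- 1)))) = 0" by simp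
  also have "(LINT z|lborel. indicator V z * (3 * S z * et z * \<eta> z + \<Phi> z * (2 * max 0 (\<tau> - snd z) * (- 1)))) =
     (LINT z|lborel. 3 * (indicator V z * (S z * \<eta> z * et z)) - 3 * (indicator V z * (2 / 3 * max 0 (e z - \<sigma>) ^ 3 * max 0 (\<tau> - snd z))))"
    by (intro Bochner_Integration.integral_cong) (auto simp: \<Phi>_def algebra_simps)
  also have "\<dots> = 3 * (LINT z|lborel. indicator V z * (S z * \<eta> z * et z)) -
      3 * (LINT z|lborel. indicator V z * (2 / 3 * max 0 (e z - \<sigma>) ^ 3 * max 0 (\<tau> - snd z)))"
    by (subst Bochner_Integration.integral_diff[OF integrable_mult_right[OF I2] integrable_mult_right[OF I1]])
      (simp only: integral_mult_right_zero)
  finally have "(LINT z|lborel. indicator V z * (2 / 3 * max 0 (e z - \<sigma>) ^ 3 * max 0 (\<tau> - snd z))) =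
      (LINT z|lborel. indicator V z * (S z * \<eta> z * et z))" by simp
  also have "\<dots> \<le> (LINT z|lborel. (\<Sum>i\<in>UNIV. indicator V z * (dE i z * (S z * \<eta> z))))"
  proof (rule integral_mono[OF I2])
    show "integrable lborel (\<lambda>z. \<Sum>i\<in>UNIV. indicator V z * (dE i z * (S z * \<eta> z)))"
      by (rule Bochner_Integration.integrable_sum) (rule I3)
    fix z
    show "indicator V z * (S z * \<eta> z * et z) \<le> (\<Sum>i\<in>UNIV. indicator V z * (dE i z * (S z * \<eta> z)))"
    proof (cases "z \<in> V")
      case True
      have "S z * \<eta> z * et z \<le> S z * \<eta> z * (\<Sum>i\<in>UNIV. dE i z)"
        by (rule mult_left_mono[OF sub[OF True]]) (auto simp: S_def \<eta>_def)
      then show ?thesis using True by (simp add: sum_distrib_left mult.commute)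
    qed simp
  qed
  also have "\<dots> = (\<Sum>i\<in>UNIV. LINT z|lborel. indicator V z * (dE i z * (S z * \<eta> z)))"
    by (rule Bochner_Integration.integral_sum) (rule I3)
  also have "\<dots> = (\<Sum>i\<in>UNIV. - (LINT z|lborel. indicator V z * (E i z * (2 * max 0 (e z - \<sigma>) * ex i z * \<eta> z))))"
  proof (rule sum.cong[OF refl])
    fix i :: 'n
    have "(LINT z|lborel. indicator V z * (dE i z * (S z * \<eta> z))) =
      - (LINT z|lborel. indicator V z * (E i z * (2 * max 0 (e z - \<sigma>) * ex i z * \<eta> z + S z * (2 * max 0 (\<tau> - snd z) * (- 0)))))"
    proof (rule integration_by_parts(3)[OF V D(1,2)])
      show "has_dir_deriv (\<lambda>z. S z * \<eta> z) (axis i 1, 0) z (2 * max 0 (e z - \<sigma>) * ex i z * \<eta> z + S z * (2 * max 0 (\<tau> - snd z) * (- 0)))" if "z \<in> V" for z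
        by (rule has_dir_deriv_mult[OF dS[OF ex[OF that]] d\<eta>])
    qed (use z0 dE in \<open>auto intro!: continuous_intros c cS\<close>)
    then show "(LINT z|lborel. indicator V z * (dE i z * (S z * \<eta> z))) =
      - (LINT z|lborel. indicator V z * (E i z * (2 * max 0 (e z - \<sigma>) * ex i z * \<eta> z)))" by simp
  qed
  also have "\<dots> = - (\<Sum>i\<in>UNIV. LINT z|lborel. indicator V z * (E i z * (2 * max 0 (e z - \<sigma>) * ex i z * \<eta> z)))"
    by (rule sum_negf)
  also have "(\<Sum>i\<in>UNIV. LINT z|lborel. indicator V z * (E i z * (2 * max 0 (e z - \<sigma>) * ex i z * \<eta> z))) =
      (LINT z|lborel. (\<Sum>i\<in>UNIV. indicator V z * (E i z * (2 * max 0 (e z - \<sigma>) * ex i z * \<eta> z))))"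
    by (rule Bochner_Integration.integral_sum[symmetric]) (rule I4)
  also have "- \<dots> = (LINT z|lborel. - (\<Sum>i\<in>UNIV. indicator V z * (E i z * (2 * max 0 (e z - \<sigma>) * ex i z * \<eta> z))))"
    by (rule Bochner_Integration.integral_minus[symmetric])
  also have "\<dots> = (LINT z|lborel. indicator V z *
          (2 * max 0 (e z - \<sigma>) * (max 0 (\<tau> - snd z))\<^sup>2 * (- (\<Sum>i\<in>UNIV. ex i z * E i z))))"
    by (intro Bochner_Integration.integral_cong refl)
      (simp add: \<eta>_def sum_distrib_left sum_negf[symmetric] algebra_simps)
  finally show "(LINT z|lborel. indicator V z * (2 / 3 * max 0 (e z - \<sigma>) ^ 3 * max 0 (\<tau> - snd z)))
      \<le> (LINT z|lborel. indicator V z *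
          (2 * max 0 (e z - \<sigma>) * (max 0 (\<tau> - snd z))\<^sup>2 * (- (\<Sum>i\<in>UNIV. ex i z * E i z))))" .
qed

text \<open>
  The product of the mollified gradient and the mollified flux is controlled by the mollification of
  \<open>|g|\<^sup>p\<close>, because \<open>a b\<^sup>p\<^sup>-\<^sup>1 \<le> a\<^sup>p + b\<^sup>p\<close>.
\<close>

lemma conv_product_bound:
  assumes J: "approx_kernel e J" and a: "integrable lborel a" and b: "integrable lborel b" and c: "integrable lborel c"
    and ab: "\<And>y y'. \<bar>a y\<bar> * \<bar>b y'\<bar> \<le> c y + c y'"
  shows "\<bar>conv J a z\<bar> * \<bar>conv J b z\<bar> \<le> 2 * conv J c z"
proof -
  obtain B where B: "B > 0" "\<And>z. \<bar>J z\<bar> \<le> B" using approx_kernel_bounded[OF J] by blast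
  note i = integrable_conv_integrand[OF approx_kernelD(1)[OF J] B(2)]
  have j: "has_bochner_integral lborel (\<lambda>y. J (z - y)) 1"
    using has_bochner_integral_reflect_shift[of J] approx_kernelD[OF J] by simp
  have ia: "integrable lborel (\<lambda>y. \<bar>a y\<bar>)" and ib: "integrable lborel (\<lambda>y. \<bar>b y\<bar>)" using a b by auto
  define A where "A = conv J (\<lambda>y. \<bar>a y\<bar>) z"
  define Bb where "Bb = conv J (\<lambda>y. \<bar>b y\<bar>) z"
  have A: "\<bar>conv J a z\<bar> \<le> A" unfolding A_def by (rule conv_mono_bound[OF J a ia]) simp
  have Bb: "\<bar>conv J b z\<bar> \<le> Bb" unfolding Bb_def by (rule conv_mono_bound[OF J b ib]) simp
  have 1: "\<bar>a y\<bar> * Bb \<le> c y + conv J c z" for y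
  proof -
    have "\<bar>a y\<bar> * Bb = (LINT y'|lborel. J (z - y') * (\<bar>a y\<bar> * \<bar>b y'\<bar>))"
    proof -
      have "\<bar>a y\<bar> * Bb = (LINT y'|lborel. \<bar>a y\<bar> * (J (z - y') * \<bar>b y'\<bar>))"
        unfolding Bb_def conv_def by simp
      then show ?thesis by (simp add: mult.left_commute)
    qed
    also have "\<dots> \<le> (LINT y'|lborel. J (z - y') * c y + J (z - y') * c y')"
    proof (rule integral_mono)
      show "integrable lborel (\<lambda>y'. J (z - y') * (\<bar>a y\<bar> * \<bar>b y'\<bar>))"
        using i[of "\<lambda>y'. \<bar>a y\<bar> * \<bar>b y'\<bar>" z] ib by simp
      show "integrable lborel (\<lambda>y'. J (z - y') * c y + J (z - y') * c y')"
        using i[OF c, of z] j by (simp add: has_bochner_integral_iff)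
      show "J (z - y') * (\<bar>a y\<bar> * \<bar>b y'\<bar>) \<le> J (z - y') * c y + J (z - y') * c y'" for y'
        using mult_left_mono[OF ab[of y y'] approx_kernelD(2)[OF J, of "z - y'"]] by (simp add: distrib_left)
    qed
    also have "\<dots> = c y + conv J c z"
      using i[OF c, of z] j by (simp add: has_bochner_integral_iff conv_def)
    finally show ?thesis .
  qed
  have "A * Bb = (LINT y|lborel. J (z - y) * (\<bar>a y\<bar> * Bb))"
  proof -
    have "A * Bb = (LINT y|lborel. J (z - y) * \<bar>a y\<bar> * Bb)"
      unfolding A_def conv_def by simp
    then show ?thesis by (simp add: mult.assoc)
  qed
  also have "\<dots> \<le> (LINT y|lborel. J (z - y) * c y + J (z - y) * conv J c z)"
  proof (rule integral_mono)
    show "integrable lborel (\<lambda>y. J (z - y) * (\<bar>a y\<bar> * Bb))"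
      using i[of "\<lambda>y. \<bar>a y\<bar> * Bb" z] ia by simp
    show "integrable lborel (\<lambda>y. J (z - y) * c y + J (z - y) * conv J c z)"
      using i[OF c, of z] j by (simp add: has_bochner_integral_iff)
    show "J (z - y) * (\<bar>a y\<bar> * Bb) \<le> J (z - y) * c y + J (z - y) * conv J c z" for y
      using mult_left_mono[OF 1[of y] approx_kernelD(2)[OF J, of "z - y"]] by (simp add: distrib_left)
  qed
  also have "\<dots> = 2 * conv J c z"
    using i[OF c, of z] j by (simp add: has_bochner_integral_iff conv_def)
  finally have "A * Bb \<le> 2 * conv J c z" .
  moreover have "\<bar>conv J a z\<bar> * \<bar>conv J b z\<bar> \<le> A * Bb"
    using A Bb by (intro mult_mono) auto
  ultimately show ?thesis by linarith
qed

lemma powr_product_le: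
  fixes a b :: real
  assumes "0 \<le> a" "0 \<le> b" "1 < p"
  shows "a * b powr (p - 1) \<le> a powr p + b powr p"
proof -
  have *: "x * x powr (p - 1) = x powr p" if "0 \<le> x" for x :: real
    using norm_p_flux[OF assms(3), of x] that
    by (cases "x = 0") (auto simp: powr_mult_base)
  show ?thesis
  proof (cases "a \<le> b")
    case True
    then have "a * b powr (p - 1) \<le> b * b powr (p - 1)" by (intro mult_right_mono) auto
    then show ?thesis using *[OF assms(2)] by (metis add_increasing powr_ge_zero order_trans)
  next
    case False
    then have "a * b powr (p - 1) \<le> a * a powr (p - 1)" using assms by (intro mult_left_mono powr_mono2) auto
    then show ?thesis using *[OF assms(1)] by (metis add_increasing2 powr_ge_zero order_trans)
  qed
qed

text \<open>
  In the limit the product of the differences is nonnegative by monotonicity. Almost everywhere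
  convergence along a subsequence and the previous bound, whose right-hand side converges in
  \<open>L\<^sup>1\<close>, show that its negative part vanishes.
\<close>

lemma mollified_monotonicity:
  fixes g a :: "'a::euclidean_space \<Rightarrow> real^'n"
  assumes p: "1 < p" and C: "C \<in> sets borel" "bounded C" and D: "D \<in> sets borel" "bounded D"
    and g: "g \<in> borel_measurable borel" "\<And>z. z \<notin> C \<Longrightarrow> g z = 0" "integrable lborel (\<lambda>z. norm (g z) powr p)"
    and J: "\<And>k. approx_kernel (e k) (J k)" and e: "e \<longlonglongrightarrow> 0"
    and a: "continuous_on D a" "continuous_on D (\<lambda>z. p_flux p (a z))"
    and M: "M \<ge> 0" "\<And>z. z \<in> D \<Longrightarrow> norm (a z) \<le> M" "\<And>z. z \<in> D \<Longrightarrow> norm (p_flux p (a z)) \<le> M"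
  defines "X \<equiv> \<lambda>k z. \<Sum>i\<in>UNIV. (conv (J k) (\<lambda>z. g z $ i) z - a z $ i) *
      (conv (J k) (\<lambda>z. p_flux p (g z) $ i) z - p_flux p (a z) $ i)"
  shows "\<exists>r. strict_mono r \<and> (\<lambda>k. LINT z|lborel. indicator D z * max 0 (- X (r k) z)) \<longlonglongrightarrow> 0"
    and "integrable lborel (\<lambda>z. indicator D z * max 0 (- X k z))"
proof -
  define Q where "Q z = indicator C z + norm (g z) powr p" for z
  have bfin: "integrable lborel (indicator S :: 'a \<Rightarrow> real)" if "S \<in> sets borel" "bounded S" for S :: "'a set"
    using that emeasure_bounded_finite by (intro integrable_real_indicator) auto
  have g0: "\<forall>z. z \<notin> C \<longrightarrow> g z = 0" using g(2) by blast
  note bounds = gradient_flux_bounds[OF p C g(1) g0 g(3)]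
  have iQ: "integrable lborel Q" unfolding Q_def by (rule bounds(1))
  have Q0: "0 \<le> Q z" for z by (simp add: Q_def)
  have gQ: "\<bar>g z $ i\<bar> \<le> Q z" and FQ: "\<bar>p_flux p (g z) $ i\<bar> \<le> Q z" for z i
    unfolding Q_def by (rule bounds(2)) (rule bounds(3))
  have ig: "integrable lborel (\<lambda>z. g z $ i)" and iF: "integrable lborel (\<lambda>z. p_flux p (g z) $ i)" for i
    by (rule bounds(4)) (rule bounds(5))
  have prod: "\<bar>g y $ i\<bar> * \<bar>p_flux p (g y') $ i\<bar> \<le> Q y + Q y'" for y y' i
  proof -
    have "\<bar>g y $ i\<bar> * \<bar>p_flux p (g y') $ i\<bar> \<le> norm (g y) * norm (p_flux p (g y'))"
      by (intro mult_mono component_le_norm_cart) auto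
    also have "\<dots> \<le> norm (g y) powr p + norm (g y') powr p"
      unfolding norm_p_flux[OF p] by (rule powr_product_le) (use p in auto)
    also have "\<dots> \<le> Q y + Q y'" by (simp add: Q_def)
    finally show ?thesis .
  qed
  define A where "A = real CARD('n) * (2 + 2 * M + M\<^sup>2)"
  have A: "A \<ge> 0" using M(1) by (simp add: A_def)
  have JQ0: "0 \<le> conv (J k) Q z" for k z
    using conv_mono_bound[OF J iQ iQ, of k z] Q0 by simp
  have Xb: "\<bar>X k z\<bar> \<le> A * (conv (J k) Q z + 1)" if "z \<in> D" for k z
  proof -
    have "\<bar>X k z\<bar> \<le> (\<Sum>i\<in>(UNIV::'n set). (2 + 2 * M + M\<^sup>2) * (conv (J k) Q z + 1))"
      unfolding X_def
    proof (rule order_trans[OF sum_abs], rule sum_mono)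
      fix i :: 'n
      let ?u = "\<bar>conv (J k) (\<lambda>z. g z $ i) z\<bar>" and ?v = "\<bar>conv (J k) (\<lambda>z. p_flux p (g z) $ i) z\<bar>" and ?q = "conv (J k) Q z"
      have u: "?u \<le> ?q" by (rule conv_mono_bound[OF J ig iQ gQ])
      have v: "?v \<le> ?q" by (rule conv_mono_bound[OF J iF iQ FQ])
      have uv: "?u * ?v \<le> 2 * ?q" by (rule conv_product_bound[OF J ig iF iQ prod])
      have b: "\<bar>a z $ i\<bar> \<le> M" using component_le_norm_cart[of "a z" i] M(2)[OF that] by linarith
      have c: "\<bar>p_flux p (a z) $ i\<bar> \<le> M" using component_le_norm_cart[of "p_flux p (a z)" i] M(3)[OF that] by linarith
      have "\<bar>(conv (J k) (\<lambda>z. g z $ i) z - a z $ i) * (conv (J k) (\<lambda>z. p_flux p (g z) $ i) z - p_flux p (a z) $ i)\<bar>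
         \<le> (?u + M) * (?v + M)"
        unfolding abs_mult using b c by (intro mult_mono) auto
      also have "\<dots> = ?u * ?v + M * ?u + M * ?v + M\<^sup>2" by (simp add: algebra_simps power2_eq_square)
      also have "\<dots> \<le> 2 * ?q + M * ?q + M * ?q + M\<^sup>2"
        using uv mult_left_mono[OF u M(1)] mult_left_mono[OF v M(1)] by linarith
      also have "\<dots> \<le> (2 + 2 * M + M\<^sup>2) * (?q + 1)"
        using JQ0[of k z] M(1) by (simp add: algebra_simps)
      finally show "\<bar>(conv (J k) (\<lambda>z. g z $ i) z - a z $ i) * (conv (J k) (\<lambda>z. p_flux p (g z) $ i) z - p_flux p (a z) $ i)\<bar>
         \<le> (2 + 2 * M + M\<^sup>2) * (?q + 1)" .
    qed
    then show ?thesis by (simp add: A_def)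
  qed
  have cJ: "continuous_on UNIV (conv (J k) f)" if "integrable lborel f" for k f
  proof -
    obtain B where "B > 0" "\<And>z. \<bar>J k z\<bar> \<le> B" using approx_kernel_bounded[OF J] by blast
    then show ?thesis using continuous_on_conv[OF approx_kernelD(1)[OF J] _ that] by blast
  qed
  have cJm: "conv (J k) f \<in> borel_measurable borel" if "integrable lborel f" for k f
    using cJ[OF that] by (rule borel_measurable_continuous_onI)
  have Xc: "continuous_on D (X k)" for k
    unfolding X_def
    by (intro continuous_intros a continuous_on_component continuous_on_subset[OF cJ[OF ig] subset_UNIV]
        continuous_on_subset[OF cJ[OF iF] subset_UNIV])
  have "(\<lambda>z. indicator D z *\<^sub>R max 0 (- X k z)) \<in> borel_measurable borel" for k
    by (rule borel_measurable_continuous_on_indicator[OF D(1)]) (intro continuous_intros Xc)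
  then have Xm: "(\<lambda>z. indicator D z * max 0 (- X k z)) \<in> borel_measurable lborel" for k by simp
  have iD: "integrable lborel (indicator D :: 'a \<Rightarrow> real)" 
    using D emeasure_bounded_finite by (intro integrable_real_indicator) auto
  have Xi: "integrable lborel (\<lambda>z. indicator D z * max 0 (- X k z))" for k
  proof (rule Bochner_Integration.integrable_bound)
    show "integrable lborel (\<lambda>z. A * (conv (J k) Q z + indicator D z))"
      using conv_L1_bound(1)[OF J iQ] iD by simp
    show "AE z in lborel. norm (indicator D z * max 0 (- X k z)) \<le> norm (A * (conv (J k) Q z + indicator D z))"
      using Xb JQ0 A by (intro AE_I2) (auto simp: indicator_def abs_le_iff intro: order_trans[OF _ abs_ge_self])
  qed (rule Xm)
  show "integrable lborel (\<lambda>z. indicator D z * max 0 (- X k z))" by (rule Xi)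
  \<comment> \<open>one scalar sequence that controls all components at once\<close>
  define T where "T k z = (\<Sum>i\<in>(UNIV::'n set). \<bar>conv (J k) (\<lambda>z. g z $ i) z - g z $ i\<bar> +
      \<bar>conv (J k) (\<lambda>z. p_flux p (g z) $ i) z - p_flux p (g z) $ i\<bar>)" for k z
  have i1: "integrable lborel (\<lambda>z. \<bar>conv (J k) (\<lambda>z. g z $ i) z - g z $ i\<bar>)"
    "integrable lborel (\<lambda>z. \<bar>conv (J k) (\<lambda>z. p_flux p (g z) $ i) z - p_flux p (g z) $ i\<bar>)" for k i
    using conv_L1_bound(1)[OF J ig] conv_L1_bound(1)[OF J iF] ig iF by auto
  have Ti: "integrable lborel (T k)" for k
    unfolding T_def by (intro Bochner_Integration.integrable_sum Bochner_Integration.integrable_add i1)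
  have "(\<lambda>k. LINT z|lborel. norm (T k z)) \<longlonglongrightarrow> 0"
  proof -
    have "(LINT z|lborel. norm (T k z)) = (\<Sum>i\<in>(UNIV::'n set). (LINT z|lborel. \<bar>conv (J k) (\<lambda>z. g z $ i) z - g z $ i\<bar>) +
      (LINT z|lborel. \<bar>conv (J k) (\<lambda>z. p_flux p (g z) $ i) z - p_flux p (g z) $ i\<bar>))" for k
    proof -
      have "(LINT z|lborel. norm (T k z)) = (LINT z|lborel. T k z)"
        unfolding T_def by (intro Bochner_Integration.integral_cong) (auto intro!: abs_of_nonneg sum_nonneg)
      also have "\<dots> = (\<Sum>i\<in>(UNIV::'n set). (LINT z|lborel. \<bar>conv (J k) (\<lambda>z. g z $ i) z - g z $ i\<bar> +
          \<bar>conv (J k) (\<lambda>z. p_flux p (g z) $ i) z - p_flux p (g z) $ i\<bar>))"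
        unfolding T_def by (rule Bochner_Integration.integral_sum) (intro Bochner_Integration.integrable_add i1)
      also have "\<dots> = (\<Sum>i\<in>(UNIV::'n set). (LINT z|lborel. \<bar>conv (J k) (\<lambda>z. g z $ i) z - g z $ i\<bar>) +
      (LINT z|lborel. \<bar>conv (J k) (\<lambda>z. p_flux p (g z) $ i) z - p_flux p (g z) $ i\<bar>))"
        by (intro sum.cong refl Bochner_Integration.integral_add i1)
      finally show ?thesis .
    qed
    moreover have "(\<lambda>k. \<Sum>i\<in>(UNIV::'n set). (LINT z|lborel. \<bar>conv (J k) (\<lambda>z. g z $ i) z - g z $ i\<bar>) +
      (LINT z|lborel. \<bar>conv (J k) (\<lambda>z. p_flux p (g z) $ i) z - p_flux p (g z) $ i\<bar>)) \<longlonglongrightarrow> (\<Sum>i\<in>(UNIV::'n set). 0 + 0)"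
      by (intro tendsto_sum tendsto_add conv_tendsto_L1[OF J e] ig iF)
    ultimately show ?thesis by simp
  qed
  from tendsto_L1_AE_subseq[OF Ti this] obtain r where r: "strict_mono r" "AE z in lborel. (\<lambda>k. T (r k) z) \<longlonglongrightarrow> 0"
    by blast
  have ae: "AE z in lborel. (\<lambda>k. indicator D z * max 0 (- X (r k) z)) \<longlonglongrightarrow> 0"
    using r(2)
  proof eventually_elim
    case (elim z)
    have T1: "\<bar>conv (J k) (\<lambda>z. g z $ i) z - g z $ i\<bar> \<le> T k z" "\<bar>conv (J k) (\<lambda>z. p_flux p (g z) $ i) z - p_flux p (g z) $ i\<bar> \<le> T k z" for k i
    proof -
      have "\<bar>conv (J k) (\<lambda>z. g z $ i) z - g z $ i\<bar> + \<bar>conv (J k) (\<lambda>z. p_flux p (g z) $ i) z - p_flux p (g z) $ i\<bar> \<le> T k z"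
        unfolding T_def
        by (rule member_le_sum[of i UNIV "\<lambda>i. \<bar>conv (J k) (\<lambda>z. g z $ i) z - g z $ i\<bar> + \<bar>conv (J k) (\<lambda>z. p_flux p (g z) $ i) z - p_flux p (g z) $ i\<bar>"]) auto
      then show "\<bar>conv (J k) (\<lambda>z. g z $ i) z - g z $ i\<bar> \<le> T k z" "\<bar>conv (J k) (\<lambda>z. p_flux p (g z) $ i) z - p_flux p (g z) $ i\<bar> \<le> T k z"
        by linarith+
    qed
    have l1: "(\<lambda>k. conv (J (r k)) (\<lambda>z. g z $ i) z) \<longlonglongrightarrow> g z $ i" for i
      by (rule LIM_zero_cancel, rule Lim_null_comparison[OF _ elim]) (use T1 in auto)
    have l2: "(\<lambda>k. conv (J (r k)) (\<lambda>z. p_flux p (g z) $ i) z) \<longlonglongrightarrow> p_flux p (g z) $ i" for i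
      by (rule LIM_zero_cancel, rule Lim_null_comparison[OF _ elim]) (use T1 in auto)
    have "(\<lambda>k. indicator D z * max 0 (- X (r k) z)) \<longlonglongrightarrow> indicator D z * max 0 (- (\<Sum>i\<in>UNIV. (g z $ i - a z $ i) *
      (p_flux p (g z) $ i - p_flux p (a z) $ i)))"
      unfolding X_def by (intro tendsto_intros l1 l2)
    moreover have "(\<Sum>i\<in>UNIV. (g z $ i - a z $ i) * (p_flux p (g z) $ i - p_flux p (a z) $ i)) \<ge> 0"
      using p_flux_monotone[OF p, of "g z" "a z"] by (simp add: inner_vec_def mult.commute)
    ultimately show ?case by simp
  qed
  have lim1: "(\<lambda>k. LINT z|lborel. min (A * (Q z + 1)) (indicator D z * max 0 (- X (r k) z))) \<longlonglongrightarrow> (LINT (z::'a)|lborel. 0)"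
  proof (rule integral_dominated_convergence[where w = "\<lambda>z. A * (Q z + indicator D z)"])
    show "integrable lborel (\<lambda>z. A * (Q z + indicator D z))" using iQ iD by simp
    have "(\<lambda>z. A * (Q z + 1)) \<in> borel_measurable lborel" using iQ by auto
    then show "(\<lambda>z. min (A * (Q z + 1)) (indicator D z * max 0 (- X (r k) z))) \<in> borel_measurable lborel" for k
      by (rule borel_measurable_min[OF Xm])
    have AQ: "0 \<le> A * (Q z + 1)" for z using A Q0[of z] by simp
    show "AE z in lborel. (\<lambda>k. min (A * (Q z + 1)) (indicator D z * max 0 (- X (r k) z))) \<longlonglongrightarrow> 0"
      using ae
    proof eventually_elim
      case (elim z)
      have "(\<lambda>k. min (A * (Q z + 1)) (indicator D z * max 0 (- X (r k) z))) \<longlonglongrightarrow> min (A * (Q z + 1)) 0"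
        by (intro tendsto_intros elim)
      then show ?case unfolding min_absorb2[OF AQ] .
    qed
    show "AE z in lborel. norm (min (A * (Q z + 1)) (indicator D z * max 0 (- X (r k) z))) \<le> A * (Q z + indicator D z)" for k
    proof (rule AE_I2)
      fix z
      show "norm (min (A * (Q z + 1)) (indicator D z * max 0 (- X (r k) z))) \<le> A * (Q z + indicator D z)"
        using AQ[of z] A Q0[of z] by (cases "z \<in> D") auto
    qed
  qed simp
  have QL1: "(\<lambda>k. LINT z|lborel. \<bar>conv (J (r k)) Q z - Q z\<bar>) \<longlonglongrightarrow> 0"
    using LIMSEQ_subseq_LIMSEQ[OF conv_tendsto_L1[OF J e iQ] r(1)] by (simp add: o_def)
  have upper: "(LINT z|lborel. indicator D z * max 0 (- X (r k) z)) \<le>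
      (LINT z|lborel. min (A * (Q z + 1)) (indicator D z * max 0 (- X (r k) z))) + A * (LINT z|lborel. \<bar>conv (J (r k)) Q z - Q z\<bar>)" for k
  proof -
    have iJ: "integrable lborel (\<lambda>z. \<bar>conv (J (r k)) Q z - Q z\<bar>)" using conv_L1_bound(1)[OF J iQ] iQ by simp
    have im: "integrable lborel (\<lambda>z. min (A * (Q z + 1)) (indicator D z * max 0 (- X (r k) z)))"
    proof (rule Bochner_Integration.integrable_bound[OF Xi[of "r k"]])
      have "(\<lambda>z. A * (Q z + 1)) \<in> borel_measurable lborel" using iQ by auto
      then show "(\<lambda>z. min (A * (Q z + 1)) (indicator D z * max 0 (- X (r k) z))) \<in> borel_measurable lborel"
        by (rule borel_measurable_min[OF Xm])
      show "AE z in lborel. norm (min (A * (Q z + 1)) (indicator D z * max 0 (- X (r k) z))) \<le> norm (indicator D z * max 0 (- X (r k) z))"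
      proof (rule AE_I2)
        fix z
        have "0 \<le> A * (Q z + 1)" using A Q0[of z] by simp
        then show "norm (min (A * (Q z + 1)) (indicator D z * max 0 (- X (r k) z))) \<le> norm (indicator D z * max 0 (- X (r k) z))"
          by (auto simp: indicator_def)
      qed
    qed
    have "(LINT z|lborel. indicator D z * max 0 (- X (r k) z)) \<le>
      (LINT z|lborel. min (A * (Q z + 1)) (indicator D z * max 0 (- X (r k) z)) + A * \<bar>conv (J (r k)) Q z - Q z\<bar>)"
    proof (rule integral_mono[OF Xi])
      show "integrable lborel (\<lambda>z. min (A * (Q z + 1)) (indicator D z * max 0 (- X (r k) z)) + A * \<bar>conv (J (r k)) Q z - Q z\<bar>)"
        using im iJ by simp
      fix z
      let ?x = "max 0 (- X (r k) z)"
      show "indicator D z * ?x \<le> min (A * (Q z + 1)) (indicator D z * ?x) + A * \<bar>conv (J (r k)) Q z - Q z\<bar>"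
      proof (cases "z \<in> D")
        case True
        have "?x \<le> \<bar>X (r k) z\<bar>" by auto
        also have "\<dots> \<le> A * (conv (J (r k)) Q z + 1)" by (rule Xb[OF True])
        also have "\<dots> = A * (Q z + 1) + A * (conv (J (r k)) Q z - Q z)" by (simp add: algebra_simps)
        also have "\<dots> \<le> A * (Q z + 1) + A * \<bar>conv (J (r k)) Q z - Q z\<bar>" using A by (intro add_left_mono mult_left_mono) auto
        finally have "?x \<le> A * (Q z + 1) + A * \<bar>conv (J (r k)) Q z - Q z\<bar>" .
        moreover have "0 \<le> A * \<bar>conv (J (r k)) Q z - Q z\<bar>" using A by simp
        moreover have "x' \<le> min y' x' + c'" if "x' \<le> y' + c'" "0 \<le> c'" for x' y' c' :: real
          using that by (auto simp: min_def)
        ultimately have "?x \<le> min (A * (Q z + 1)) ?x + A * \<bar>conv (J (r k)) Q z - Q z\<bar>" by blast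
        then show ?thesis using True by simp
      next
        case False
        have "0 \<le> A * (Q z + 1)" using A Q0[of z] by simp
        then show ?thesis using False A by simp
      qed
    qed
    also have "\<dots> = (LINT z|lborel. min (A * (Q z + 1)) (indicator D z * max 0 (- X (r k) z))) + A * (LINT z|lborel. \<bar>conv (J (r k)) Q z - Q z\<bar>)"
      using im iJ by simp
    finally show ?thesis .
  qed
  have "(\<lambda>k. LINT z|lborel. indicator D z * max 0 (- X (r k) z)) \<longlonglongrightarrow> 0"
  proof (rule tendsto_sandwich[OF _ _ tendsto_const])
    show "\<forall>\<^sub>F k in sequentially. 0 \<le> (LINT z|lborel. indicator D z * max 0 (- X (r k) z))"
      by (intro always_eventually allI integral_nonneg_AE AE_I2) auto
    show "(\<lambda>k. (LINT z|lborel. min (A * (Q z + 1)) (indicator D z * max 0 (- X (r k) z))) +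
       A * (LINT z|lborel. \<bar>conv (J (r k)) Q z - Q z\<bar>)) \<longlonglongrightarrow> 0"
      using tendsto_add[OF lim1 tendsto_mult[OF tendsto_const[of A] QL1]] by simp
  qed (use upper in auto)
  then show "\<exists>r. strict_mono r \<and> (\<lambda>k. LINT z|lborel. indicator D z * max 0 (- X (r k) z)) \<longlonglongrightarrow> 0"
    using r(1) by blast
qed

text \<open>
  Mollification turns the weak equation into a pointwise one, at points whose distance to the
  complement of the cylinder exceeds the scale of the kernel.
\<close>

lemma mollified_weak_solution:
  fixes h :: "(real^'n) \<times> real \<Rightarrow> real" and g :: "(real^'n) \<times> real \<Rightarrow> real^'n"
  assumes hC: "integrable lborel (\<lambda>z. indicator C z * h z)" and g: "\<And>i. integrable lborel (\<lambda>z. g z $ i)"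
    and F: "\<And>i. integrable lborel (\<lambda>z. p_flux p (g z) $ i)"
    and w: "borel_weak_gradient p C h g"
    and J: "approx_kernel e J" "\<And>k. C_k k J"
  defines "ht \<equiv> conv (\<lambda>z. frechet_derivative J (at z) (0, 1)) (\<lambda>z. indicator C z * h z)"
    and "dF \<equiv> \<lambda>i. conv (\<lambda>z. frechet_derivative J (at z) (axis i 1, 0)) (\<lambda>z. p_flux p (g z) $ i)"
  shows "continuous_on UNIV ht" "\<And>i. continuous_on UNIV (dF i)"
    "\<And>z. has_dir_deriv (conv J (\<lambda>z. indicator C z * h z)) (0, 1) z (ht z)"
    "\<And>z i. has_dir_deriv (conv J (\<lambda>z. p_flux p (g z) $ i)) (axis i 1, 0) z (dF i z)"
    "\<And>z i. cball z e \<subseteq> C \<Longrightarrow> has_dir_deriv (conv J (\<lambda>z. indicator C z * h z)) (axis i 1, 0) z (conv J (\<lambda>z. g z $ i) z)"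
    "\<And>z. cball z e \<subseteq> C \<Longrightarrow> ht z = (\<Sum>i\<in>UNIV. dF i z)"
proof -
  let ?h = "\<lambda>z. indicator C z * h z"
  let ?D = "\<lambda>v z. frechet_derivative J (at z) v"
  note JD = approx_kernelD[OF J(1)]
  have dJ: "has_dir_deriv J v z (?D v z)" for v z
    by (rule has_dir_deriv_test) (use J(2) in blast)
  have J0: "J z = 0" if "z \<notin> cball 0 e" for z using JD(3)[of z] that by simp
  have cD: "continuous_on UNIV (?D v)" for v
    using J(2)[of "Suc 0"] unfolding C_k.simps by blast
  have D0: "?D v z = 0" if "z \<notin> cball 0 e" for v z
    by (rule dir_deriv_off_support[OF compact_cball J0 dJ that])
  have "\<exists>B. \<forall>z. \<bar>?D v z\<bar> \<le> B" for v
    using bounded_continuous_compact_support[OF cD compact_cball D0] by metis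
  then obtain BD where BD: "\<And>v z. \<bar>?D v z\<bar> \<le> BD v" by metis
  obtain BJ where BJ: "\<And>z. \<bar>J z\<bar> \<le> BJ" using approx_kernel_bounded[OF J(1)] by metis
  have dconv: "has_dir_deriv (conv J f) v z (conv (?D v) f z)" if "integrable lborel f" for f v z
    by (rule has_dir_deriv_conv[OF JD(1) BJ cD BD that dJ])
  have cconv: "continuous_on UNIV (conv (?D v) f)" if "integrable lborel f" for f v
    by (rule continuous_on_conv[OF cD BD that])
  have test: "test_function C (\<lambda>y. J (z - y))" and
    testD: "frechet_derivative (\<lambda>y. J (z - y)) (at y) v = - ?D v (z - y)"
    if "cball z e \<subseteq> C" for z y v
  proof -
    have Ck: "C_k k (\<lambda>y. J (z + (- y)))" for k
      by (rule C_k_affine[OF _ J(2)]) (intro bounded_linear_minus bounded_linear_ident)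
    have "{y. J (z - y) \<noteq> 0} \<subseteq> cball z e"
    proof
      fix y assume "y \<in> {y. J (z - y) \<noteq> 0}"
      then have "\<not> e \<le> norm (z - y)" using JD(3)[of "z - y"] by auto
      then show "y \<in> cball z e" by (simp add: dist_norm)
    qed
    then have "closure {y. J (z - y) \<noteq> 0} \<subseteq> cball z e" by (simp add: closure_minimal)
    moreover have "compact (cball z e \<inter> closure {y. J (z - y) \<noteq> 0})"
      by (rule compact_Int_closed[OF compact_cball closed_closure])
    ultimately have "compactly_contained {y. J (z - y) \<noteq> 0} C"
      unfolding compactly_contained_def using that by (simp add: inf.absorb2 subset_trans[of _ "cball z e" C])
    then show "test_function C (\<lambda>y. J (z - y))" using Ck by (simp add: test_function_def)
    have "J differentiable at (z - y)" using J(2)[of "Suc 0"] unfolding C_k.simps by blast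
    then have d: "(J has_derivative frechet_derivative J (at (z - y))) (at (z - y))"
      by (simp add: frechet_derivative_works)
    have "((\<lambda>y. z - y) has_derivative (\<lambda>v. - v)) (at y)" by (auto intro!: derivative_eq_intros)
    from has_derivative_compose[OF this d]
    have "frechet_derivative (\<lambda>y. J (z - y)) (at y) v = ?D (- v) (z - y)"
      by (simp add: frechet_derivative_at[symmetric])
    also have "\<dots> = - ?D v (z - y)" using linear_neg[OF has_derivative_linear[OF d]] .
    finally show "frechet_derivative (\<lambda>y. J (z - y)) (at y) v = - ?D v (z - y)" .
  qed
  have m: "(LINT y|lborel. f y * (- ?D v (z - y))) = - conv (?D v) f z" for f v z
    by (simp add: conv_def mult.commute)
  have mh: "(LINT y|lborel. indicator C y * (h y * (- ?D v (z - y)))) = - conv (?D v) ?h z" for v z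
    using m[where f = ?h and v = v and z = z] by (simp add: mult.assoc)
  show "continuous_on UNIV ht" "\<And>i. continuous_on UNIV (dF i)"
    unfolding ht_def dF_def by (rule cconv[OF hC], rule cconv[OF F])
  show "has_dir_deriv (conv J ?h) (0, 1) z (ht z)" for z
    unfolding ht_def by (rule dconv[OF hC])
  show "has_dir_deriv (conv J (\<lambda>z. p_flux p (g z) $ i)) (axis i 1, 0) z (dF i z)" for z i
    unfolding dF_def by (rule dconv[OF F])
  fix z :: "(real^'n) \<times> real" assume z: "cball z e \<subseteq> C"
  have wg: "(LINT z|lborel. indicator C z * (h z * frechet_derivative \<phi> (at z) (axis i 1, 0))) =
       - (LINT z|lborel. g z $ i * \<phi> z)"
    and eq: "(\<Sum>i\<in>UNIV. LINT z|lborel. p_flux p (g z) $ i * frechet_derivative \<phi> (at z) (axis i 1, 0)) =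
       (LINT z|lborel. indicator C z * (h z * frechet_derivative \<phi> (at z) (0, 1)))"
    if "test_function C \<phi>" for \<phi> i
    using w that unfolding borel_weak_gradient_def by blast+
  show "ht z = (\<Sum>i\<in>UNIV. dF i z)"
    using eq[OF test[OF z]] unfolding testD[OF z] m mh ht_def dF_def by (simp add: sum_negf)
  fix i
  have "conv (?D (axis i 1, 0)) ?h z = conv J (\<lambda>z. g z $ i) z"
    using wg[OF test[OF z], of i] unfolding testD[OF z] mh by (simp add: conv_def mult.commute)
  then show "has_dir_deriv (conv J ?h) (axis i 1, 0) z (conv J (\<lambda>z. g z $ i) z)"
    using dconv[OF hC, of "(axis i 1, 0)" z] by simp
qed

text \<open>
  The weak formulation is available only on cylinders that are compactly contained in the given
  one; this provides such a cylinder around the support of the test functions.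
\<close>

lemma compact_in_cylinder:
  fixes D :: "('a::euclidean_space \<times> real) set"
  assumes D: "compact D" "D \<noteq> {}" "D \<subseteq> U \<times> {t1<..<t2}" and U: "open U"
  obtains V s1 s2 where "open V" "s1 < s2" "D \<subseteq> V \<times> {s1<..<s2}" "compactly_contained (V \<times> {s1<..<s2}) (U \<times> {t1<..<t2})"
proof -
  have c1: "compact (fst ` D)" and c2: "compact (snd ` D)"
    using D(1) by (auto intro!: compact_continuous_image continuous_intros)
  have "fst ` D \<subseteq> U" using D(3) by auto
  from compact_subset_open_imp_ball_epsilon_subset[OF c1 U this] obtain e where e: "e > 0" "(\<Union>x\<in>fst ` D. ball x e) \<subseteq> U" .
  define V where "V = (\<Union>x\<in>fst ` D. ball x (e / 2))"
  have V: "open V" unfolding V_def by auto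
  have "closure V \<subseteq> (\<Union>x\<in>fst ` D. ball x e)"
  proof
    fix y assume "y \<in> closure V"
    then obtain y' where y': "y' \<in> V" "dist y' y < e / 2" using e(1) by (auto simp: closure_approachable dest!: spec[of _ "e / 2"])
    then obtain x where "x \<in> fst ` D" "dist x y' < e / 2" by (auto simp: V_def)
    then show "y \<in> (\<Union>x\<in>fst ` D. ball x e)" using y'(2) dist_triangle[of x y y'] by force
  qed
  then have VU: "closure V \<subseteq> U" using e by auto
  obtain R where R: "\<And>x. x \<in> fst ` D \<Longrightarrow> norm x \<le> R" using compact_imp_bounded[OF c1] by (auto simp: bounded_iff)
  have "bounded V"
    unfolding bounded_iff
  proof (intro exI ballI)
    fix y assume "y \<in> V"
    then obtain x where x: "x \<in> fst ` D" "dist x y < e / 2" by (auto simp: V_def)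
    then show "norm y \<le> R + e / 2" using R[OF x(1)] norm_triangle_ineq3[of y x] by (simp add: dist_norm norm_minus_commute)
  qed
  then have cV: "compact (closure V)" by simp
  obtain a where a: "a \<in> snd ` D" "\<And>t. t \<in> snd ` D \<Longrightarrow> a \<le> t" using compact_attains_inf[OF c2] D(2) by auto
  obtain b where b: "b \<in> snd ` D" "\<And>t. t \<in> snd ` D \<Longrightarrow> t \<le> b" using compact_attains_sup[OF c2] D(2) by auto
  have ab: "t1 < a" "b < t2" "a \<le> b" using a b D(3) by auto
  show thesis
  proof (rule that[OF V, of "(t1 + a) / 2" "(b + t2) / 2"])
    show "(t1 + a) / 2 < (b + t2) / 2" using ab by simp
    show "D \<subseteq> V \<times> {(t1 + a) / 2<..<(b + t2) / 2}"
    proof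
      fix z assume z: "z \<in> D"
      then have "fst z \<in> V" unfolding V_def using e(1) by force
      moreover have "a \<le> snd z" "snd z \<le> b" using a b z by auto
      ultimately show "z \<in> V \<times> {(t1 + a) / 2<..<(b + t2) / 2}" using ab by (auto simp: mem_Times_iff)
    qed
    have "closure (V \<times> {(t1 + a) / 2<..<(b + t2) / 2}) = closure V \<times> {(t1 + a) / 2..(b + t2) / 2}"
      using ab by (simp add: closure_Times)
    then show "compactly_contained (V \<times> {(t1 + a) / 2<..<(b + t2) / 2}) (U \<times> {t1<..<t2})"
      unfolding compactly_contained_def using cV VU ab by (auto intro!: compact_Times)
  qed
qed

text \<open>
  If \<open>h > w\<close> somewhere, then the set \<open>D\<close> where \<open>h - w\<close> is at least a fixed positive number, up to a time before \<open>t2\<close>,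
  is compact and avoids the parabolic boundary. There the mollified \<open>h\<close> can be compared with \<open>w\<close> by the energy inequality: its left-hand side
  stays above a positive constant, and its right-hand side tends to 0 by monotonicity.
\<close>

theorem comparison_with_classical_supersolution:
  fixes h w wt :: "(real^'n) \<times> real \<Rightarrow> real" and wx :: "(real^'n) \<times> real \<Rightarrow> real^'n"
    and dG :: "'n \<Rightarrow> (real^'n) \<times> real \<Rightarrow> real"
  assumes p: "1 < p" and U: "open U" "compact (closure U)" "t1 < t2"
    and \<Omega>: "open \<Omega>" "closure U \<times> {t1..t2} \<subseteq> \<Omega>"
    and c: "continuous_on \<Omega> w" "continuous_on \<Omega> wt" "continuous_on \<Omega> wx" "continuous_on \<Omega> (\<lambda>z. p_flux p (wx z))"
      "\<And>i. continuous_on \<Omega> (dG i)"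
    and wt: "\<And>z. z \<in> \<Omega> \<Longrightarrow> has_dir_deriv w (0, 1) z (wt z)"
    and wx: "\<And>z i. z \<in> \<Omega> \<Longrightarrow> has_dir_deriv w (axis i 1, 0) z (wx z $ i)"
    and dG: "\<And>z i. z \<in> \<Omega> \<Longrightarrow> has_dir_deriv (\<lambda>z. p_flux p (wx z) $ i) (axis i 1, 0) z (dG i z)"
    and super: "\<And>z. z \<in> \<Omega> \<Longrightarrow> (\<Sum>i\<in>UNIV. dG i z) \<le> wt z"
    and h: "p_parabolic p (U \<times> {t1<..<t2}) h" "continuous_on (closure U \<times> {t1..t2}) h"
    and bd: "\<And>z. z \<in> parabolic_boundary U t1 t2 \<Longrightarrow> h z \<le> w z"
    and z: "z \<in> U \<times> {t1<..<t2}"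
  shows "h z \<le> w z"
proof (rule ccontr)
  assume "\<not> h z \<le> w z"
  then have hw: "h z - w z > 0" by simp
  \<comment> \<open>three levels: \<open>\<sigma>/2\<close> determines \<open>D\<close>, \<open>\<sigma>\<close> is the truncation level for the mollified difference, and \<open>3 \<sigma>\<close> is the value of \<open>h - w\<close> at \<open>z\<close>\<close>
  define \<sigma> where "\<sigma> = (h z - w z) / 3"
  have \<sigma>: "\<sigma> > 0" "h z - w z = 3 * \<sigma>" using hw by (auto simp: \<sigma>_def)
  define \<tau> where "\<tau> = (snd z + t2) / 2"
  have \<tau>: "snd z < \<tau>" "\<tau> < t2" "t1 < \<tau>" using z by (auto simp: \<tau>_def)
  let ?S = "closure U \<times> {t1..t2}"
  have S: "compact ?S" using U by (intro compact_Times) auto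
  have cd: "continuous_on ?S (\<lambda>z. h z - w z)"
    by (intro continuous_intros h(2) continuous_on_subset[OF c(1) \<Omega>(2)])
  define D where "D = {y \<in> ?S. h y - w y \<ge> \<sigma> / 2 \<and> snd y \<le> \<tau>}"
  have D: "compact D"
  proof -
    have "closed {y \<in> ?S. \<sigma> / 2 \<le> h y - w y}"
      by (rule continuous_on_closed_Collect_le[OF continuous_on_const cd compact_imp_closed[OF S]])
    moreover have "closed {y \<in> ?S. snd y \<le> \<tau>}"
      by (rule continuous_on_closed_Collect_le[OF continuous_on_snd[OF continuous_on_id] continuous_on_const compact_imp_closed[OF S]])
    ultimately have "compact (?S \<inter> ({y \<in> ?S. \<sigma> / 2 \<le> h y - w y} \<inter> {y \<in> ?S. snd y \<le> \<tau>}))"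
      by (intro compact_Int_closed[OF S] closed_Int)
    moreover have "D = ?S \<inter> ({y \<in> ?S. \<sigma> / 2 \<le> h y - w y} \<inter> {y \<in> ?S. snd y \<le> \<tau>})" by (auto simp: D_def)
    ultimately show ?thesis by simp
  qed
  have US: "U \<times> {t1<..<t2} \<subseteq> ?S" using closure_subset[of U] by auto
  have zD: "z \<in> D" using z US \<sigma> \<tau> by (auto simp: D_def)
  have DB: "D \<subseteq> U \<times> {t1<..<t2}"
  proof
    fix y assume y: "y \<in> D"
    then have "y \<notin> parabolic_boundary U t1 t2" using bd[of y] \<sigma> by (auto simp: D_def)
    then show "y \<in> U \<times> {t1<..<t2}"
      using y \<tau> U(1) by (cases y) (auto simp: parabolic_boundary_def D_def frontier_def interior_open)
  qed
  obtain V s1 s2 where V: "open V" "s1 < s2" "D \<subseteq> V \<times> {s1<..<s2}" "compactly_contained (V \<times> {s1<..<s2}) (U \<times> {t1<..<t2})"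
    using compact_in_cylinder[OF D _ DB U(1)] zD by blast
  define C where "C = V \<times> {s1<..<s2}"
  have C: "open C" "C \<in> sets borel" using V by (auto simp: C_def open_Times)
  have clC: "compact (closure C)" "closure C \<subseteq> U \<times> {t1<..<t2}"
    using V(4) by (auto simp: compactly_contained_def C_def)
  have CS: "closure C \<subseteq> ?S" using clC US by blast
  have C\<Omega>: "C \<subseteq> \<Omega>" using CS \<Omega> closure_subset[of C] by blast
  have bC: "bounded C" by (rule bounded_subset[OF compact_imp_bounded[OF clC(1)] closure_subset])
  obtain g where w: "borel_weak_gradient p C h g"
    using p_parabolic_borel_gradient[OF p h(1) V(1,2,4)] unfolding C_def by (rule exE)
  note g = w[unfolded borel_weak_gradient_def, THEN conjunct1]
    w[unfolded borel_weak_gradient_def, THEN conjunct2, THEN conjunct1, rule_format]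
    w[unfolded borel_weak_gradient_def, THEN conjunct2, THEN conjunct2, THEN conjunct1]
  note gz = w[unfolded borel_weak_gradient_def, THEN conjunct2, THEN conjunct1]
  note ig = gradient_flux_bounds(4)[OF p C(2) bC g(1) gz g(3)] and iF = gradient_flux_bounds(5)[OF p C(2) bC g(1) gz g(3)]
  have hclC: "continuous_on (closure C) h" by (rule continuous_on_subset[OF h(2) CS])
  have ih: "integrable lborel (\<lambda>z. indicator C z * h z)"
  proof -
    have "integrable lborel (\<lambda>z. indicator (closure C) z *\<^sub>R h z)"
      by (rule borel_integrable_compact[OF clC(1) hclC])
    then have "integrable lborel (\<lambda>z. indicator C z *\<^sub>R (indicator (closure C) z *\<^sub>R h z))"
      by (rule integrable_mult_indicator[rotated]) (use C in simp)
    moreover have "(\<lambda>z. indicator C z *\<^sub>R (indicator (closure C) z *\<^sub>R h z)) = (\<lambda>z. indicator C z * h z)"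
      by (rule ext) (use closure_subset[of C] in \<open>auto simp: indicator_def\<close>)
    ultimately show ?thesis by simp
  qed
  \<comment> \<open>the scale below which mollification stays inside the cylinder\<close>
  have "D \<subseteq> C" using V(3) by (simp add: C_def)
  from compact_subset_open_imp_ball_epsilon_subset[OF D C(1) this]
  obtain \<rho> where \<rho>: "\<rho> > 0" "(\<Union>x\<in>D. ball x \<rho>) \<subseteq> C" .
  define N where "N = (\<Union>x\<in>D. ball x (\<rho> / 2))"
  have N: "open N" "D \<subseteq> N" using \<rho>(1) by (auto simp: N_def)
  have Nball: "ball y (\<rho> / 2) \<subseteq> C" if y: "y \<in> N" for y
  proof
    fix y' assume "y' \<in> ball y (\<rho> / 2)"
    moreover obtain x where "x \<in> D" "dist x y < \<rho> / 2" using y by (auto simp: N_def)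
    ultimately show "y' \<in> C" using \<rho>(2) dist_triangle[of x y' y] by force
  qed
  have NC: "N \<subseteq> C" using Nball \<rho>(1) by force
  have N\<Omega>: "N \<subseteq> \<Omega>" using NC C\<Omega> by blast
  have "uniformly_continuous_on (closure C) h"
    by (rule compact_uniformly_continuous[OF hclC clC(1)])
  then obtain \<delta> where \<delta>: "\<delta> > 0" "\<And>x y. x \<in> closure C \<Longrightarrow> y \<in> closure C \<Longrightarrow> dist y x < \<delta> \<Longrightarrow> dist (h y) (h x) < \<sigma> / 4"
    unfolding uniformly_continuous_on_def using \<sigma>(1) by (metis divide_pos_pos zero_less_numeral)
  define m where "m = min (\<rho> / 2) \<delta>"
  have m: "m > 0" using \<rho> \<delta> by (simp add: m_def)
  define \<epsilon> where "\<epsilon> k = m / (real k + 2)" for k :: nat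
  have \<epsilon>: "\<epsilon> k > 0" "\<epsilon> k < m" for k
  proof -
    show "\<epsilon> k > 0" using m by (simp add: \<epsilon>_def)
    have "m * 1 < m * (real k + 2)" using m by (intro mult_strict_left_mono) auto
    then show "\<epsilon> k < m" by (simp add: \<epsilon>_def divide_less_eq)
  qed
  have \<epsilon>0: "\<epsilon> \<longlonglongrightarrow> 0"
  proof -
    have "(\<lambda>k. m * inverse (real (Suc (k + 1)))) \<longlonglongrightarrow> m * 0"
      by (intro tendsto_mult tendsto_const LIMSEQ_ignore_initial_segment[OF LIMSEQ_inverse_real_of_nat])
    then show ?thesis unfolding \<epsilon>_def by (simp add: divide_inverse add.commute)
  qed
  have "\<forall>k. \<exists>J :: (real^'n) \<times> real \<Rightarrow> real. approx_kernel (\<epsilon> k) J \<and> (\<forall>j. C_k j J)"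
    using smooth_kernel_exists[OF \<epsilon>(1)] by blast
  from choice[OF this] obtain J :: "nat \<Rightarrow> (real^'n) \<times> real \<Rightarrow> real" where
    J': "\<forall>k. approx_kernel (\<epsilon> k) (J k) \<and> (\<forall>j. C_k j (J k))" by blast
  then have J: "approx_kernel (\<epsilon> k) (J k)" "C_k j (J k)" for k j by blast+
  let ?h = "\<lambda>z. indicator C z * h z"
  define e where "e k y = conv (J k) ?h y - w y" for k y
  define ex where "ex k i y = conv (J k) (\<lambda>z. g z $ i) y - wx y $ i" for k i y
  define E where "E k i y = conv (J k) (\<lambda>z. p_flux p (g z) $ i) y - p_flux p (wx y) $ i" for k i y
  have ball: "cball y (\<epsilon> k) \<subseteq> C" if "y \<in> N" for y k
    using Nball[OF that] \<epsilon>(2)[of k] unfolding m_def by (auto simp: subset_iff)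
  have close: "\<bar>e k y - (h y - w y)\<bar> \<le> \<sigma> / 4" if y: "y \<in> N" for k y
  proof -
    have "\<bar>conv (J k) ?h y - h y\<bar> \<le> \<sigma> / 4"
    proof (rule conv_close[OF J(1) ih])
      fix y' assume y': "norm (y - y') < \<epsilon> k"
      then have "y' \<in> C" using ball[OF y, of k] by (auto simp: dist_norm)
      moreover have "dist y' y < \<delta>" using y' \<epsilon>(2)[of k] by (simp add: m_def dist_norm norm_minus_commute)
      ultimately have "dist (h y') (h y) < \<sigma> / 4" using y NC closure_subset[of C] by (intro \<delta>(2)) auto
      then show "\<bar>indicator C y' * h y' - h y\<bar> \<le> \<sigma> / 4" using \<open>y' \<in> C\<close> by (simp add: dist_real_def)
    qed
    then show ?thesis by (simp add: e_def)
  qed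
  have supp: "y \<in> D" if "y \<in> N" "\<sigma> < e k y" "snd y < \<tau>" for k y
  proof -
    have "y \<in> ?S" using that(1) NC CS closure_subset[of C] by blast
    moreover have "\<sigma> / 2 \<le> h y - w y" using close[OF that(1), of k] that(2) \<sigma>(1) by linarith
    ultimately show ?thesis using that(3) by (simp add: D_def)
  qed
  have cN: "continuous_on N f" if "continuous_on \<Omega> f" for f :: "_ \<Rightarrow> real" by (rule continuous_on_subset[OF that N\<Omega>])
  have cconv: "continuous_on N (conv (J k) f)" if "integrable lborel f" for k f
  proof -
    obtain B where B: "B > 0" "\<And>z. \<bar>J k z\<bar> \<le> B" using approx_kernel_bounded[OF J(1)] by blast
    show ?thesis
      by (rule continuous_on_subset[OF continuous_on_conv[OF approx_kernelD(1)[OF J(1)] B(2) that] subset_UNIV])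
  qed
  have energy: "integrable lborel (\<lambda>y. indicator N y * (2 / 3 * max 0 (e k y - \<sigma>) ^ 3 * max 0 (\<tau> - snd y)))"
    "(LINT y|lborel. indicator N y * (2 / 3 * max 0 (e k y - \<sigma>) ^ 3 * max 0 (\<tau> - snd y)))
      \<le> (LINT y|lborel. indicator N y * (2 * max 0 (e k y - \<sigma>) * (max 0 (\<tau> - snd y))\<^sup>2 * (- (\<Sum>i\<in>UNIV. ex k i y * E k i y))))" for k
  proof -
    define ht where "ht = conv (\<lambda>z. frechet_derivative (J k) (at z) (0, 1)) ?h"
    define dF where "dF i = conv (\<lambda>z. frechet_derivative (J k) (at z) (axis i 1, 0)) (\<lambda>z. p_flux p (g z) $ i)" for i
    have Jk: "approx_kernel (\<epsilon> k) (J k)" "\<And>j. C_k j (J k)" using J' by blast+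
    note ht = mollified_weak_solution[OF ih ig iF w Jk, folded ht_def dF_def]
    have cU: "continuous_on N f" if "continuous_on UNIV f" for f :: "_ \<Rightarrow> real" by (rule continuous_on_subset[OF that subset_UNIV])
    have 1: "continuous_on N (e k)" unfolding e_def by (intro continuous_on_diff cconv ih cN c)
    have 2: "continuous_on N (\<lambda>y. ht y - wt y)" by (rule continuous_on_diff[OF cU[OF ht(1)] cN[OF c(2)]])
    have 3: "continuous_on N (ex k i)" for i
      unfolding ex_def by (intro continuous_on_diff cconv ig cN continuous_on_component c)
    have 4: "continuous_on N (E k i)" for i
      unfolding E_def by (intro continuous_on_diff cconv iF cN continuous_on_component c)
    have 5: "continuous_on N (\<lambda>y. dF i y - dG i y)" for i by (rule continuous_on_diff[OF cU[OF ht(2)] cN[OF c(5)]])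
    have 6: "has_dir_deriv (e k) (0, 1) y (ht y - wt y)" if "y \<in> N" for y
      unfolding e_def by (intro has_dir_deriv_diff ht wt) (use that N\<Omega> in auto)
    have 7: "has_dir_deriv (e k) (axis i 1, 0) y (ex k i y)" if "y \<in> N" for y i
      unfolding e_def ex_def by (intro has_dir_deriv_diff ht(5) wx ball that) (use that N\<Omega> in auto)
    have 8: "has_dir_deriv (E k i) (axis i 1, 0) y (dF i y - dG i y)" if "y \<in> N" for y i
      unfolding E_def by (intro has_dir_deriv_diff ht dG) (use that N\<Omega> in auto)
    have 9: "ht y - wt y \<le> (\<Sum>i\<in>UNIV. dF i y - dG i y)" if "y \<in> N" for y
      using super[of y] ht(6)[OF ball[OF that]] that N\<Omega> by (auto simp: sum_subtractf)
    note en = energy_inequality[OF N(1) D N(2) 1 2 3 4 5 6 7 8 9 supp]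
    show "integrable lborel (\<lambda>y. indicator N y * (2 / 3 * max 0 (e k y - \<sigma>) ^ 3 * max 0 (\<tau> - snd y)))"
      by (rule en(1))
    show "(LINT y|lborel. indicator N y * (2 / 3 * max 0 (e k y - \<sigma>) ^ 3 * max 0 (\<tau> - snd y)))
      \<le> (LINT y|lborel. indicator N y * (2 * max 0 (e k y - \<sigma>) * (max 0 (\<tau> - snd y))\<^sup>2 * (- (\<Sum>i\<in>UNIV. ex k i y * E k i y))))"
      by (rule en(2))
  qed
  \<comment> \<open>the right-hand side tends to 0 along a subsequence\<close>
  have D\<Omega>: "D \<subseteq> \<Omega>" using N N\<Omega> by blast
  have bdd: "\<exists>M. \<forall>y\<in>D. norm (f y) \<le> M" if "continuous_on D f" for f :: "_ \<Rightarrow> 'b::real_normed_vector"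
    using compact_imp_bounded[OF compact_continuous_image[OF that D]] by (auto simp: bounded_iff)
  have DS: "D \<subseteq> ?S" by (auto simp: D_def)
  obtain M1 where M1: "\<forall>y\<in>D. norm (wx y) \<le> M1"
    using bdd[OF continuous_on_subset[OF c(3) D\<Omega>]] by (rule exE)
  obtain M2 where M2: "\<forall>y\<in>D. norm (p_flux p (wx y)) \<le> M2"
    using bdd[OF continuous_on_subset[OF c(4) D\<Omega>]] by (rule exE)
  obtain M3 where M3: "\<forall>y\<in>D. norm (h y - w y) \<le> M3"
    using bdd[OF continuous_on_subset[OF cd DS]] by (rule exE)
  have M': "\<And>y. y \<in> D \<Longrightarrow> norm (wx y) \<le> M1" "\<And>y. y \<in> D \<Longrightarrow> norm (p_flux p (wx y)) \<le> M2"
    "\<And>y. y \<in> D \<Longrightarrow> \<bar>h y - w y\<bar> \<le> M3" using M1 M2 M3 by auto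
  define M where "M = max M1 M2"
  have M: "\<And>y. y \<in> D \<Longrightarrow> norm (wx y) \<le> M" "\<And>y. y \<in> D \<Longrightarrow> norm (p_flux p (wx y)) \<le> M"
    unfolding M_def using M'(1,2) by (simp_all add: le_max_iff_disj)
  have M0: "M \<ge> 0" "M3 \<ge> 0"
    using order_trans[OF norm_ge_zero M(1)[OF zD]] order_trans[OF abs_ge_zero M'(3)[OF zD]] by auto
  have Db: "D \<in> sets borel" "bounded D" using D by (auto intro: compact_imp_bounded borel_compact)
  define X where "X k y = (\<Sum>i\<in>UNIV. (conv (J k) (\<lambda>z. g z $ i) y - wx y $ i) *
      (conv (J k) (\<lambda>z. p_flux p (g z) $ i) y - p_flux p (wx y) $ i))" for k y
  note mm = mollified_monotonicity[OF p C(2) bC Db g(1,2,3) J(1) \<epsilon>0 continuous_on_subset[OF c(3) D\<Omega>]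
      continuous_on_subset[OF c(4) D\<Omega>] M0(1) M(1,2), folded X_def]
  obtain r where r: "strict_mono r" "(\<lambda>k. LINT y|lborel. indicator D y * max 0 (- X (r k) y)) \<longlonglongrightarrow> 0"
    using mm(1) by blast
  define A where "A = 2 * (M3 + \<sigma>) * (\<tau> - t1)\<^sup>2"
  have upper: "(LINT y|lborel. indicator N y * (2 / 3 * max 0 (e k y - \<sigma>) ^ 3 * max 0 (\<tau> - snd y)))
      \<le> A * (LINT y|lborel. indicator D y * max 0 (- X k y))" for k
  proof -
    have A0: "A \<ge> 0" using M0(2) \<sigma> by (simp add: A_def)
    have pt: "indicator N y * (2 * max 0 (e k y - \<sigma>) * (max 0 (\<tau> - snd y))\<^sup>2 * (- (\<Sum>i\<in>UNIV. ex k i y * E k i y)))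
        \<le> A * (indicator D y * max 0 (- X k y))" for y
    proof (cases "y \<in> N \<and> \<sigma> < e k y \<and> snd y < \<tau>")
      case True
      then have yN: "y \<in> N" and "\<sigma> < e k y" "snd y < \<tau>" by blast+
      then have yD: "y \<in> D" by (rule supp)
      have "e k y - \<sigma> \<le> M3 + \<sigma>" using close[OF yN, of k] M'(3)[OF yD] \<sigma>(1) by linarith
      then have "max 0 (e k y - \<sigma>) \<le> M3 + \<sigma>" using M0(2) \<sigma>(1) by simp
      moreover have "(max 0 (\<tau> - snd y))\<^sup>2 \<le> (\<tau> - t1)\<^sup>2"
        using yD True by (intro power_mono) (auto simp: D_def)
      ultimately have "2 * max 0 (e k y - \<sigma>) * (max 0 (\<tau> - snd y))\<^sup>2 \<le> A"
        unfolding A_def using M0(2) \<sigma> by (intro mult_mono) auto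
      then have "2 * max 0 (e k y - \<sigma>) * (max 0 (\<tau> - snd y))\<^sup>2 * (- X k y) \<le> A * max 0 (- X k y)"
        using A0 by (intro order_trans[OF mult_left_mono[of "- X k y" "max 0 (- X k y)"] mult_right_mono]) auto
      then show ?thesis using yN yD by (simp add: X_def ex_def E_def)
    next
      case False
      then have "y \<notin> N \<or> max 0 (e k y - \<sigma>) = 0 \<or> max 0 (\<tau> - snd y) = 0" by auto
      moreover have "0 \<le> A * (indicator D y * max 0 (- X k y))" using A0 by simp
      ultimately show ?thesis by auto
    qed
    show ?thesis
    proof (cases "integrable lborel (\<lambda>y. indicator N y * (2 * max 0 (e k y - \<sigma>) * (max 0 (\<tau> - snd y))\<^sup>2 * (- (\<Sum>i\<in>UNIV. ex k i y * E k i y))))")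
      case True
      have "(LINT y|lborel. indicator N y * (2 * max 0 (e k y - \<sigma>) * (max 0 (\<tau> - snd y))\<^sup>2 * (- (\<Sum>i\<in>UNIV. ex k i y * E k i y))))
        \<le> (LINT y|lborel. A * (indicator D y * max 0 (- X k y)))"
        by (rule integral_mono[OF True _ pt]) (intro integrable_mult_right mm(2))
      then show ?thesis using energy(2)[of k] by simp
    next
      case False
      have "0 \<le> A * (LINT y|lborel. indicator D y * max 0 (- X k y))"
        using A0 by (intro mult_nonneg_nonneg integral_nonneg_AE AE_I2) auto
      then show ?thesis using energy(2)[of k] not_integrable_integral_eq[OF False] by linarith
    qed
  qed
  \<comment> \<open>the left-hand side stays bounded below near the point where \<open>h > w\<close>\<close>
  have "z \<in> N" using zD N by blast
  have cdN: "continuous_on N (\<lambda>y. h y - w y)"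
    by (rule continuous_on_subset[OF cd]) (use NC CS closure_subset[of C] in blast)
  then have "isCont (\<lambda>y. h y - w y) z" using N(1) \<open>z \<in> N\<close> continuous_on_eq_continuous_at by blast
  then obtain r1 where r1: "r1 > 0" "\<And>y. dist y z < r1 \<Longrightarrow> dist (h y - w y) (h z - w z) < \<sigma> / 4"
    unfolding continuous_at_eps_delta using \<sigma>(1) by (metis divide_pos_pos zero_less_numeral)
  obtain r2 where r2: "r2 > 0" "ball z r2 \<subseteq> N" using N(1) \<open>z \<in> N\<close> by (auto simp: open_contains_ball)
  define \<theta> where "\<theta> = (\<tau> - snd z) / 2"
  have \<theta>: "\<theta> > 0" using \<tau> by (simp add: \<theta>_def)
  define r3 where "r3 = min (min r1 r2) \<theta>"
  have r3: "r3 > 0" using r1 r2 \<theta> by (simp add: r3_def)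
  define c0 where "c0 = 2 / 3 * \<sigma> ^ 3 * \<theta> * measure lborel (ball z r3)"
  have c0: "c0 > 0" using \<sigma> \<theta> measure_ball_pos[OF r3, of z] by (simp add: c0_def)
  have lower: "c0 \<le> (LINT y|lborel. indicator N y * (2 / 3 * max 0 (e k y - \<sigma>) ^ 3 * max 0 (\<tau> - snd y)))" for k
    unfolding c0_def
  proof (rule integral_lower_bound_ball[OF energy(1)])
    show "0 \<le> indicator N y * (2 / 3 * max 0 (e k y - \<sigma>) ^ 3 * max 0 (\<tau> - snd y))" for y by simp
    fix y assume y: "y \<in> ball z r3"
    then have yN: "y \<in> N" using r2(2) by (auto simp: r3_def)
    have "dist (h y - w y) (h z - w z) < \<sigma> / 4" using y by (intro r1(2)) (auto simp: r3_def dist_commute)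
    then have "\<bar>(h y - w y) - 3 * \<sigma>\<bar> < \<sigma> / 4" by (simp add: dist_real_def \<sigma>(2))
    then have "\<sigma> \<le> e k y - \<sigma>" using close[OF yN, of k] \<sigma>(1) by linarith
    then have 1: "\<sigma> ^ 3 \<le> max 0 (e k y - \<sigma>) ^ 3" using \<sigma>(1) by (intro power_mono) auto
    have 2: "\<theta> \<le> max 0 (\<tau> - snd y)"
    proof -
      have "\<bar>snd y - snd z\<bar> < \<theta>" using y dist_snd_le[of y z] by (auto simp: r3_def dist_real_def dist_commute)
      then have "\<theta> \<le> \<tau> - snd y" using abs_ge_self[of "snd y - snd z"] unfolding \<theta>_def by argo
      then show ?thesis by simp
    qed
    have "\<sigma> ^ 3 * \<theta> \<le> max 0 (e k y - \<sigma>) ^ 3 * max 0 (\<tau> - snd y)"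
      by (rule mult_mono[OF 1 2]) (use \<theta> in auto)
    then have "2 / 3 * (\<sigma> ^ 3 * \<theta>) \<le> 2 / 3 * (max 0 (e k y - \<sigma>) ^ 3 * max 0 (\<tau> - snd y))"
      by (rule mult_left_mono) simp
    then show "2 / 3 * \<sigma> ^ 3 * \<theta> \<le> indicator N y * (2 / 3 * max 0 (e k y - \<sigma>) ^ 3 * max 0 (\<tau> - snd y))"
      using yN by (simp only: mult.assoc indicator_simps mult_1_left)
  qed
  have "(\<lambda>k. A * (LINT y|lborel. indicator D y * max 0 (- X (r k) y))) \<longlonglongrightarrow> A * 0"
    by (intro tendsto_intros r)
  then have "c0 \<le> A * 0"
    by (rule LIMSEQ_le_const) (use order_trans[OF lower upper] in blast)
  then show False using c0 by simp
qed

section \<open>Explicit solutions\<close>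

text \<open>
  The gradient is constant, so the flux has divergence 0.
\<close>

lemma affine_p_parabolic:
  fixes v :: "real^'n"
  assumes "1 < p" "open W"
  shows "p_parabolic p W (\<lambda>z. c + fst z \<bullet> v)"
proof (rule classical_imp_p_parabolic[where hx = "\<lambda>z. v" and ht = "\<lambda>z. 0" and F = "\<lambda>z. norm v powr (p - 2) *\<^sub>R v" and dF = "\<lambda>i z. 0"])
  show "has_dir_deriv (\<lambda>z. c + fst z \<bullet> v) (axis i 1, 0) z (v $ i)" for z :: "(real^'n) \<times> real" and i
  proof -
    have "(\<lambda>s. c + fst (z + s *\<^sub>R (axis i 1, 0)) \<bullet> v) = (\<lambda>s. c + fst z \<bullet> v + s * (v $ i))"
      by (simp add: inner_add_left inner_axis inner_commute[of "axis i 1" v] fun_eq_iff)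
    then show ?thesis unfolding has_dir_deriv_def by (auto intro!: derivative_eq_intros)
  qed
  show "has_dir_deriv (\<lambda>z. c + fst z \<bullet> v) (0, 1) z 0" for z :: "(real^'n) \<times> real"
    unfolding has_dir_deriv_def by simp
qed (use assms in \<open>auto intro!: continuous_intros has_dir_deriv_const\<close>)

lemma DERIV_max_0_powr:
  assumes r: "1 < r"
  shows "((\<lambda>x::real. max 0 x powr r) has_real_derivative r * max 0 x powr (r - 1)) (at x)"
proof -
  consider "x > 0" | "x < 0" | "x = 0" by linarith
  then show ?thesis
  proof cases
    case 1
    have "((\<lambda>x. x powr r) has_real_derivative r * x powr (r - 1)) (at x)"
      using 1 by (rule has_real_derivative_powr)
    then have "((\<lambda>x::real. max 0 x powr r) has_real_derivative r * x powr (r - 1)) (at x)"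
      by (rule has_field_derivative_transform_within_open[of _ _ _ "{0<..}"]) (use 1 in auto)
    then show ?thesis using 1 by (simp add: max_def)
  next
    case 2
    have "((\<lambda>x. 0) has_real_derivative 0) (at x)" by simp
    then have "((\<lambda>x::real. max 0 x powr r) has_real_derivative 0) (at x)"
      by (rule has_field_derivative_transform_within_open[of _ _ _ "{..<0}"]) (use 2 in auto)
    then show ?thesis using 2 by (simp add: max_def)
  next
    case 3
    have "((\<lambda>h::real. max 0 h) \<longlongrightarrow> max 0 0) (at 0)" by (intro tendsto_intros)
    then have "((\<lambda>h::real. max 0 h powr (r - 1)) \<longlongrightarrow> 0) (at 0)"
      using r by (intro tendsto_zero_powrI[where b = "r - 1"]) auto
    moreover have "\<forall>\<^sub>F h::real in at 0. max 0 h powr (r - 1) = (max 0 (0 + h) powr r - max 0 0 powr r) / h"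
      unfolding eventually_at_filter
    proof (intro always_eventually allI impI)
      fix h :: real assume "h \<noteq> 0"
      show "max 0 h powr (r - 1) = (max 0 (0 + h) powr r - max 0 0 powr r) / h"
      proof (cases "h > 0")
        case True
        then show ?thesis by (simp add: powr_diff)
      qed (use \<open>h \<noteq> 0\<close> in auto)
    qed
    ultimately have "((\<lambda>h::real. (max 0 (0 + h) powr r - max 0 0 powr r) / h) \<longlongrightarrow> 0) (at 0)"
      by (rule Lim_transform_eventually)
    then show ?thesis unfolding 3 DERIV_def by simp
  qed
qed

lemma inner_powr_half: "(x \<bullet> x) powr (s / 2) = norm x powr s" for x :: "'a::real_inner"
proof -
  have "(x \<bullet> x) powr (s / 2) = (norm x powr 2) powr (s / 2)"
    by (cases "x = 0") (simp_all add: power2_norm_eq_inner[symmetric] powr_numeral)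
  also have "\<dots> = norm x powr (2 * (s / 2))" by (rule powr_powr)
  finally show ?thesis by simp
qed

lemma has_dir_deriv_norm_powr:
  fixes z :: "(real^'n) \<times> real"
  assumes "2 < s"
  shows "has_dir_deriv (\<lambda>z. norm (fst z) powr s) (axis i 1, 0) z (s * norm (fst z) powr (s - 2) * fst z $ i)"
    "has_dir_deriv (\<lambda>z. norm (fst z) powr s) (0, 1) z 0"
proof -
  have d: "has_dir_deriv (\<lambda>z. fst z \<bullet> fst z) (axis i 1, 0) z (2 * (fst z $ i))"
    unfolding has_dir_deriv_def
    by (auto intro!: derivative_eq_intros simp: inner_add_left inner_add_right inner_axis inner_axis_axis inner_commute[of "axis i 1"])
  have 1: "has_dir_deriv (\<lambda>z. max 0 (fst z \<bullet> fst z) powr (s / 2)) (axis i 1, 0) z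
      (s / 2 * max 0 (fst z \<bullet> fst z) powr (s / 2 - 1) * (2 * (fst z $ i)))"
    by (rule has_dir_deriv_chain[OF d DERIV_max_0_powr]) (use assms in simp)
  have 2: "(\<lambda>z::(real^'n) \<times> real. max 0 (fst z \<bullet> fst z) powr (s / 2)) = (\<lambda>z. norm (fst z) powr s)"
    by (simp add: max_absorb2 inner_powr_half)
  have "max 0 (fst z \<bullet> fst z) powr (s / 2 - 1) = norm (fst z) powr (s - 2)"
    using inner_powr_half[of "fst z" "s - 2"] by (simp add: max_absorb2 diff_divide_distrib)
  then have 3: "s / 2 * max 0 (fst z \<bullet> fst z) powr (s / 2 - 1) * (2 * (fst z $ i)) = s * norm (fst z) powr (s - 2) * fst z $ i"
    by simp
  show "has_dir_deriv (\<lambda>z. norm (fst z) powr s) (axis i 1, 0) z (s * norm (fst z) powr (s - 2) * fst z $ i)"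
    using 1 unfolding 2 3 .
  show "has_dir_deriv (\<lambda>z. norm (fst z) powr s) (0, 1) z 0"
    unfolding has_dir_deriv_def by simp
qed

lemma has_dir_deriv_time:
  "(f has_real_derivative d) (at (snd z)) \<Longrightarrow> has_dir_deriv (\<lambda>z. f (snd z)) (0, 1) z d"
  "has_dir_deriv (\<lambda>z. f (snd z)) (v, 0) z 0"
proof -
  assume "(f has_real_derivative d) (at (snd z))"
  then have "((\<lambda>s. f (s + snd z)) has_real_derivative d) (at 0)"
    using DERIV_shift[of f d 0 "snd z"] by simp
  then show "has_dir_deriv (\<lambda>z. f (snd z)) (0, 1) z d"
    by (simp add: has_dir_deriv_def add.commute)
qed (simp add: has_dir_deriv_def)

lemma has_dir_deriv_add:
  "has_dir_deriv f v z a \<Longrightarrow> has_dir_deriv g v z b \<Longrightarrow> has_dir_deriv (\<lambda>x. f x + g x) v z (a + b)"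
  unfolding has_dir_deriv_def by (rule DERIV_add)

lemma has_dir_deriv_component: "has_dir_deriv (\<lambda>z::(real^'n) \<times> real. fst z $ i) (axis i 1, 0) z 1"
  unfolding has_dir_deriv_def by (auto intro!: derivative_eq_intros simp: axis_def)

text \<open>
  The exponent \<open>p / (p - 1)\<close> is chosen such that the flux of a multiple of \<open>|x|\<^bsup>p/(p-1)\<^esup>\<close> is linear in \<open>x\<close>.
\<close>

lemma p_flux_radial:
  fixes x :: "real^'n"
  assumes p: "1 < p" and k: "0 \<le> k"
  shows "p_flux p (- (k * norm x powr (p / (p - 1) - 2)) *\<^sub>R x) = - (k powr (p - 1)) *\<^sub>R x"
proof (cases "x = 0 \<or> k = 0")
  case False
  then have x: "norm x > 0" and k: "k > 0" using k by auto
  let ?c = "k * norm x powr (p / (p - 1) - 2)"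
  have c: "?c > 0" using x k by simp
  have "norm (- ?c *\<^sub>R x) powr (p - 2) * ?c = k powr (p - 1)"
  proof -
    have 1: "norm (- ?c *\<^sub>R x) = k * norm x powr (p / (p - 1) - 1)"
    proof -
      have "norm x powr (p / (p - 1) - 2) * norm x = norm x powr (p / (p - 1) - 2) * norm x powr 1" using x by simp
      also have "\<dots> = norm x powr (p / (p - 1) - 1)" unfolding powr_add[symmetric] by simp
      finally show ?thesis using k by (simp add: abs_mult)
    qed
    have "norm (- ?c *\<^sub>R x) powr (p - 2) * ?c = k powr (p - 2) * k * (norm x powr ((p / (p - 1) - 1) * (p - 2)) * norm x powr (p / (p - 1) - 2))"
      unfolding 1 using k by (simp add: powr_mult powr_powr)
    also have "norm x powr ((p / (p - 1) - 1) * (p - 2)) * norm x powr (p / (p - 1) - 2) = norm x powr 0"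
      unfolding powr_add[symmetric] using p by (intro arg_cong[where f = "\<lambda>y. norm x powr y"]) (simp add: field_simps)
    also have "k powr (p - 2) * k = k powr (p - 2) * k powr 1" using k by simp
    also have "\<dots> = k powr (p - 1)" unfolding powr_add[symmetric] by simp
    finally show ?thesis using x by simp
  qed
  then have "norm (- ?c *\<^sub>R x) powr (p - 2) *\<^sub>R (- ?c *\<^sub>R x) = - (k powr (p - 1)) *\<^sub>R x"
    by (simp add: mult.commute)
  then show ?thesis by (simp add: p_flux_def)
qed (auto simp: p_flux_def)

lemma norm_powr_times_square:
  fixes x :: "real^'n"
  shows "norm x powr (s - 2) * (\<Sum>i\<in>UNIV. x $ i * x $ i) = norm x powr s"
proof -
  have "(\<Sum>i\<in>UNIV. x $ i * x $ i) = norm x ^ 2"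
    by (simp add: power2_norm_eq_inner inner_vec_def)
  then show ?thesis
    by (cases "x = 0") (simp_all add: powr_diff power2_eq_square powr_numeral)
qed

lemma continuous_on_norm_powr:
  "0 < s \<Longrightarrow> continuous_on S (\<lambda>z::'a::real_normed_vector \<times> real. norm (fst z) powr s)"
  by (rule continuous_on_powr') (auto intro!: continuous_intros)

text \<open>
  Solutions that decrease away from the origin, found by the ansatz that a negative power of
  \<open>h + d\<close> is affine in \<open>|x|\<^bsup>p/(p-1)\<^esup>\<close>. By the choice of the exponent, the flux is a multiple of \<open>x\<close>, and the equation reduces to
  two ordinary differential equations for the coefficients. The fundamental solutions of Barenblatt
  type have this form.
\<close>

lemma radial_solution:
  fixes p d :: real and a b :: "real \<Rightarrow> real"
  assumes p: "1 < p" "p < 2"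
    and pos: "\<And>t. t \<in> {T0<..<T1} \<Longrightarrow> a t > 0" "\<And>t. t \<in> {T0<..<T1} \<Longrightarrow> b t > 0"
  defines "\<gamma> \<equiv> (p - 1) / (2 - p)" and "\<kappa> \<equiv> (p / (2 - p)) powr (p - 1)"
  assumes a: "\<And>t. t \<in> {T0<..<T1} \<Longrightarrow> (a has_real_derivative \<kappa> / \<gamma> * real CARD('n) * b t powr (p - 1) * a t) (at t)"
    and b: "\<And>t. t \<in> {T0<..<T1} \<Longrightarrow> (b has_real_derivative \<kappa> / \<gamma> * (real CARD('n) - p / (2 - p)) * b t powr (p - 1) * b t) (at t)"
  shows "p_parabolic p (UNIV \<times> {T0<..<T1})
    (\<lambda>z :: (real^'n) \<times> real. (a (snd z) + b (snd z) * norm (fst z) powr (p / (p - 1))) powr (- \<gamma>) - d)"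
proof -
  define s where "s = p / (p - 1)"
  have s: "s > 2" using p by (simp add: s_def field_simps)
  have \<gamma>: "\<gamma> > 0" using p by (simp add: \<gamma>_def)
  have \<gamma>s: "\<gamma> * s = p / (2 - p)" using p by (simp add: \<gamma>_def s_def)
  let ?W = "UNIV \<times> {T0<..<T1} :: ((real^'n) \<times> real) set"
  define v where "v z = a (snd z) + b (snd z) * norm (fst z) powr s" for z :: "(real^'n) \<times> real"
  define a' where "a' t = \<kappa> / \<gamma> * real CARD('n) * b t powr (p - 1) * a t" for t
  define b' where "b' t = \<kappa> / \<gamma> * (real CARD('n) - p / (2 - p)) * b t powr (p - 1) * b t" for t
  define k where "k z = \<gamma> * s * b (snd z) * v z powr (- \<gamma> - 1)" for z
  define hx where "hx z = - (k z * norm (fst z) powr (s - 2)) *\<^sub>R fst z" for z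
  define ht where "ht z = - \<gamma> * v z powr (- \<gamma> - 1) * (a' (snd z) + b' (snd z) * norm (fst z) powr s)" for z
  define F where "F z = - (\<kappa> * b (snd z) powr (p - 1) * v z powr (- \<gamma>)) *\<^sub>R fst z" for z
  define dF where "dF i z = - (\<kappa> * b (snd z) powr (p - 1)) * (- k z * norm (fst z) powr (s - 2) * fst z $ i * fst z $ i + v z powr (- \<gamma>))" for i z
  have W: "open ?W" by (simp add: open_Times)
  have v: "v z > 0" if "z \<in> ?W" for z
    using that pos[of "snd z"] by (auto simp: v_def intro!: add_pos_nonneg mult_nonneg_nonneg)
  have ca: "continuous_on {T0<..<T1} a"
    by (intro continuous_at_imp_continuous_on ballI DERIV_isCont[OF a])
  have cb: "continuous_on {T0<..<T1} b"
    by (intro continuous_at_imp_continuous_on ballI DERIV_isCont[OF b])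
  have caz: "continuous_on ?W (\<lambda>z. a (snd z))" "continuous_on ?W (\<lambda>z. b (snd z))"
    by (auto intro!: continuous_on_compose2[OF ca] continuous_on_compose2[OF cb] continuous_intros)
  have cbp: "continuous_on ?W (\<lambda>z. b (snd z) powr r)" for r
  proof (rule continuous_on_powr[OF caz(2) continuous_on_const], rule ballI)
    fix z :: "(real^'n) \<times> real" assume "z \<in> ?W"
    then have "snd z \<in> {T0<..<T1}" by auto
    from pos(2)[OF this] show "b (snd z) \<noteq> 0" by simp
  qed
  have cn: "continuous_on ?W (\<lambda>z. norm (fst z) powr s)" "continuous_on ?W (\<lambda>z. norm (fst z) powr (s - 2))"
    using s by (simp_all add: continuous_on_norm_powr)
  note cintros = continuous_on_add continuous_on_diff continuous_on_mult continuous_on_minus continuous_on_scaleR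
    continuous_on_const continuous_on_fst[OF continuous_on_id] continuous_on_component caz cbp cn
  have cv: "continuous_on ?W v" unfolding v_def by (intro cintros)
  have cvp: "continuous_on ?W (\<lambda>z. v z powr r)" for r
    by (rule continuous_on_powr[OF cv continuous_on_const], rule ballI, drule v) simp
  have ck: "continuous_on ?W k" unfolding k_def by (intro cintros cvp)
  have dv: "has_dir_deriv v (axis i 1, 0) z (b (snd z) * (s * norm (fst z) powr (s - 2) * fst z $ i))" for z i
    unfolding v_def using has_dir_deriv_add[OF has_dir_deriv_time(2)[of a "axis i 1" z]
        has_dir_deriv_mult[OF has_dir_deriv_time(2)[of b "axis i 1" z] has_dir_deriv_norm_powr(1)[OF s, of i z]]] by simp
  have dvt: "has_dir_deriv v (0, 1) z (a' (snd z) + b' (snd z) * norm (fst z) powr s)" if "z \<in> ?W" for z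
  proof -
    have t: "snd z \<in> {T0<..<T1}" using that by auto
    show ?thesis
      unfolding v_def a'_def b'_def using has_dir_deriv_add[OF has_dir_deriv_time(1)[OF a[OF t]]
        has_dir_deriv_mult[OF has_dir_deriv_time(1)[OF b[OF t]] has_dir_deriv_norm_powr(2)[OF s, of z]]] by simp
  qed
  have dvp: "((\<lambda>y. y powr (- \<gamma>)) has_real_derivative - \<gamma> * v z powr (- \<gamma> - 1)) (at (v z))" if "z \<in> ?W" for z
    using has_real_derivative_powr[OF v[OF that], of "- \<gamma>"] .
  have dvpx: "has_dir_deriv (\<lambda>z. v z powr (- \<gamma>)) (axis i 1, 0) z (- k z * norm (fst z) powr (s - 2) * fst z $ i)" if "z \<in> ?W" for z i
    using has_dir_deriv_chain[OF dv dvp[OF that]] by (simp add: k_def algebra_simps)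
  have "p_parabolic p ?W (\<lambda>z. v z powr (- \<gamma>) - d)"
  proof (rule classical_imp_p_parabolic[OF p(1) W, where hx = hx and ht = ht and F = F and dF = dF])
    show "continuous_on ?W (\<lambda>z. v z powr (- \<gamma>) - d)" by (intro cintros cvp)
    show "continuous_on ?W hx" unfolding hx_def by (intro cintros ck)
    show "continuous_on ?W ht" unfolding ht_def a'_def b'_def by (intro cintros cvp)
    show "continuous_on ?W F" unfolding F_def by (intro cintros cvp)
    show "continuous_on ?W (dF i)" for i unfolding dF_def by (intro cintros cvp ck)
    fix z :: "(real^'n) \<times> real" assume z: "z \<in> ?W"
    show "has_dir_deriv (\<lambda>z. v z powr (- \<gamma>) - d) (axis i 1, 0) z (hx z $ i)" for i
      using has_dir_deriv_diff[OF dvpx[OF z, of i] has_dir_deriv_const[of d]] by (simp add: hx_def mult.assoc)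
    show "has_dir_deriv (\<lambda>z. v z powr (- \<gamma>) - d) (0, 1) z (ht z)"
      using has_dir_deriv_diff[OF has_dir_deriv_chain[OF dvt[OF z] dvp[OF z]] has_dir_deriv_const[of d]] by (simp add: ht_def)
    have bz: "b (snd z) > 0" using pos z by auto
    have kp: "k z powr (p - 1) = \<kappa> * b (snd z) powr (p - 1) * v z powr (- \<gamma>)"
    proof -
      have "k z powr (p - 1) = (\<gamma> * s) powr (p - 1) * b (snd z) powr (p - 1) * v z powr ((- \<gamma> - 1) * (p - 1))"
        unfolding k_def using bz \<gamma> s v[OF z] by (simp add: powr_mult powr_powr)
      also have "(- \<gamma> - 1) * (p - 1) = - \<gamma>" using p by (simp add: \<gamma>_def field_simps)
      finally show ?thesis unfolding \<gamma>s \<kappa>_def .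
    qed
    have "0 \<le> k z" using bz \<gamma> s by (simp add: k_def)
    from p_flux_radial[OF p(1) this, of "fst z"]
    show "F z = norm (hx z) powr (p - 2) *\<^sub>R hx z"
      unfolding p_flux_def s_def[symmetric] hx_def[symmetric] kp F_def by simp
    show "has_dir_deriv (\<lambda>z. F z $ i) (axis i 1, 0) z (dF i z)" for i
    proof -
      have "has_dir_deriv (\<lambda>z. - (\<kappa> * b (snd z) powr (p - 1)) * (v z powr (- \<gamma>) * (fst z $ i))) (axis i 1, 0) z
         (0 * (v z powr (- \<gamma>) * (fst z $ i)) +
          - (\<kappa> * b (snd z) powr (p - 1)) * (- k z * norm (fst z) powr (s - 2) * fst z $ i * fst z $ i + v z powr (- \<gamma>) * 1))"
        by (rule has_dir_deriv_mult[OF has_dir_deriv_time(2)[of "\<lambda>t. - (\<kappa> * b t powr (p - 1))" "axis i 1" z]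
            has_dir_deriv_mult[OF dvpx[OF z, of i] has_dir_deriv_component[of i z]]])
      then show ?thesis by (simp add: F_def dF_def mult.assoc)
    qed
    show "ht z = (\<Sum>i\<in>UNIV. dF i z)"
    proof -
      have "(\<Sum>i\<in>(UNIV::'n set). dF i z) = - (\<kappa> * b (snd z) powr (p - 1)) *
          (- k z * (norm (fst z) powr (s - 2) * (\<Sum>i\<in>UNIV. fst z $ i * fst z $ i)) + real CARD('n) * v z powr (- \<gamma>))"
        unfolding dF_def sum_distrib_left[symmetric] sum.distrib
        by (simp add: sum_distrib_left mult.assoc)
      also have "\<dots> = - (\<kappa> * b (snd z) powr (p - 1)) * (- k z * norm (fst z) powr s + real CARD('n) * v z powr (- \<gamma>))"
        by (simp only: norm_powr_times_square)
      also have "v z powr (- \<gamma>) = v z powr (- \<gamma> - 1) * v z"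
        using v[OF z] by (simp add: powr_diff)
      also have "- (\<kappa> * b (snd z) powr (p - 1)) * (- k z * norm (fst z) powr s + real CARD('n) * (v z powr (- \<gamma> - 1) * v z)) = ht z"
      proof -
        have "- (\<kappa> * B) * (- (P * y * V) * N + n * (V * (x + y * N))) =
            - \<gamma> * V * (\<kappa> / \<gamma> * n * B * x + \<kappa> / \<gamma> * (n - P) * B * y * N)" for B P V N n x y :: real
          using \<gamma> by (simp add: field_simps)
        from this[of "b (snd z) powr (p - 1)" "p / (2 - p)" "b (snd z)" "v z powr (- \<gamma> - 1)" "norm (fst z) powr s" "real CARD('n)" "a (snd z)"]
        show ?thesis unfolding ht_def a'_def b'_def k_def \<gamma>s v_def[symmetric] .
      qed
      finally show ?thesis by simp
    qed
  qed
  then show ?thesis unfolding v_def s_def .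
qed

definition radial_coefficients ::
  "real \<Rightarrow> real \<Rightarrow> real \<Rightarrow> real \<Rightarrow> real \<Rightarrow> real \<Rightarrow> real \<Rightarrow> (real \<Rightarrow> real) \<Rightarrow> (real \<Rightarrow> real) \<Rightarrow> bool" where
  "radial_coefficients p \<alpha> \<beta> \<delta> C b0 b1 a b \<longleftrightarrow>
     \<delta> > 0 \<and> C \<ge> 0 \<and> b0 > 0 \<and> b1 > 0 \<and> a 0 = 1 \<and> b 0 = 1 \<and>
     (\<forall>r. \<bar>r\<bar> \<le> \<delta> \<longrightarrow> a r > 0 \<and> b r > 0 \<and>
        (a has_real_derivative \<alpha> * b r powr (p - 1) * a r) (at r) \<and>
        (b has_real_derivative \<beta> * b r powr (p - 1) * b r) (at r) \<and> b0 \<le> b r \<and> b r \<le> b1) \<and>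
     (\<forall>r. 0 \<le> r \<and> r \<le> \<delta> \<longrightarrow> 1 \<le> a r \<and> a r \<le> 1 + C * r)"

text \<open>
  The equation for \<open>b\<close> makes \<open>b\<^sup>1\<^sup>-\<^sup>p\<close> affine, so that both equations can be solved in closed form, with a
  logarithm if that function is not constant.
\<close>

lemma radial_coefficients_exist:
  fixes \<alpha> \<beta> p :: real
  assumes p: "1 < p" and \<alpha>: "0 \<le> \<alpha>"
  shows "\<exists>\<delta> C b0 b1 a b. radial_coefficients p \<alpha> \<beta> \<delta> C b0 b1 a b"
proof -
  \<comment> \<open>\<open>b\<^sup>1\<^sup>-\<^sup>p\<close> is the affine function \<open>y\<close>, and \<open>L\<close> is the antiderivative of \<open>1 / y\<close> with \<open>L 0 = 0\<close>\<close>
  define \<sigma> where "\<sigma> = (p - 1) * \<beta>"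
  define \<delta> where "\<delta> = 1 / (2 * (\<bar>\<sigma>\<bar> + 1))"
  have \<delta>: "\<delta> > 0" by (simp add: \<delta>_def)
  have \<sigma>\<delta>: "\<bar>\<sigma> * r\<bar> \<le> 1 / 2" if "\<bar>r\<bar> \<le> \<delta>" for r
  proof -
    have "\<bar>\<sigma> * r\<bar> \<le> (\<bar>\<sigma>\<bar> + 1) * \<delta>" unfolding abs_mult using that by (intro mult_mono) auto
    also have "(\<bar>\<sigma>\<bar> + 1) * \<delta> = 1 / 2"
    proof -
      have "x * (1 / (2 * x)) = 1 / 2" if "x > 0" for x :: real using that by simp
      then show ?thesis unfolding \<delta>_def by simp
    qed
    finally show ?thesis .
  qed
  define y where "y r = 1 - \<sigma> * r" for r
  have y: "1 / 2 \<le> y r" "y r \<le> 3 / 2" "y r > 0" if "\<bar>r\<bar> \<le> \<delta>" for r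
    using abs_le_D1[OF \<sigma>\<delta>[OF that]] abs_le_D2[OF \<sigma>\<delta>[OF that]] by (auto simp: y_def)
  define b where "b r = y r powr (- 1 / (p - 1))" for r
  define L where "L r = (if \<sigma> = 0 then r else - ln (y r) / \<sigma>)" for r
  define a where "a r = exp (\<alpha> * L r)" for r
  have bp: "b r powr (p - 1) = 1 / y r" if "\<bar>r\<bar> \<le> \<delta>" for r
  proof -
    have "b r powr (p - 1) = y r powr (- 1)" unfolding b_def powr_powr using p by simp
    then show ?thesis using y(3)[OF that] by (simp add: powr_minus inverse_eq_divide)
  qed
  have dy: "(y has_real_derivative - \<sigma>) (at r)" for r
    unfolding y_def[abs_def] by (auto intro!: derivative_eq_intros)
  have db: "(b has_real_derivative \<beta> * b r powr (p - 1) * b r) (at r)" if r: "\<bar>r\<bar> \<le> \<delta>" for r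
  proof -
    have "((\<lambda>r. y r powr (- 1 / (p - 1))) has_real_derivative (- 1 / (p - 1) * y r powr (- 1 / (p - 1) - 1)) * (- \<sigma>)) (at r)"
      by (rule DERIV_chain2[OF has_real_derivative_powr[OF y(3)[OF r]] dy])
    moreover have "(- 1 / (p - 1) * y r powr (- 1 / (p - 1) - 1)) * (- \<sigma>) = \<beta> * b r powr (p - 1) * b r"
      unfolding bp[OF r] using p y(3)[OF r] by (simp add: b_def \<sigma>_def powr_diff)
    ultimately show ?thesis unfolding b_def[abs_def] by simp
  qed
  have dL: "(L has_real_derivative 1 / y r) (at r)" if r: "\<bar>r\<bar> \<le> \<delta>" for r
  proof (cases "\<sigma> = 0")
    case True
    then show ?thesis by (simp add: L_def[abs_def] y_def)
  next
    case False
    have "((\<lambda>r. ln (y r)) has_real_derivative 1 / y r * (- \<sigma>)) (at r)"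
      by (rule DERIV_chain2[OF DERIV_ln_divide[OF y(3)[OF r]] dy])
    from DERIV_cmult[OF this, of "- 1 / \<sigma>"] show ?thesis using False by (simp add: L_def[abs_def])
  qed
  have L0: "L 0 = 0" by (simp add: L_def y_def)
  have L: "0 \<le> L r" "L r \<le> 2 * r" if r: "0 \<le> r" "r \<le> \<delta>" for r
  proof -
    have "\<exists>x. 0 \<le> x \<and> x \<le> r \<and> L r - L 0 = (r - 0) * (1 / y x)"
    proof (cases "r = 0")
      case False
      then have "\<exists>x. 0 < x \<and> x < r \<and> L r - L 0 = (r - 0) * (1 / y x)"
        using r by (intro MVT2 dL) auto
      then show ?thesis using less_imp_le by blast
    qed auto
    then obtain x where x: "0 \<le> x" "x \<le> r" "L r = r * (1 / y x)" using L0 by auto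
    then have yx: "1 / 2 \<le> y x" using r by (intro y(1)) auto
    then have "0 \<le> 1 / y x" "1 / y x \<le> 2" by (auto simp: field_simps)
    then show "0 \<le> L r" "L r \<le> 2 * r" unfolding x(3) using r mult_left_mono[of "1 / y x" 2 r] by (auto simp: mult.commute)
  qed
  define C where "C = 2 * \<alpha> * exp (2 * \<alpha> * \<delta>)"
  define b0 where "b0 = (3 / 2) powr (- 1 / (p - 1))"
  define b1 where "b1 = (1 / 2) powr (- 1 / (p - 1))"
  have "radial_coefficients p \<alpha> \<beta> \<delta> C b0 b1 a b"
    unfolding radial_coefficients_def
  proof (intro conjI allI impI; (elim conjE)?)
    show "C \<ge> 0" using \<alpha> by (simp add: C_def)
    show "b0 > 0" "b1 > 0" by (simp_all add: b0_def b1_def)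
    show "a 0 = 1" "b 0 = 1" by (simp_all add: a_def L0 b_def y_def)
    show "a r > 0" for r by (simp add: a_def)
    show "b r > 0" if "\<bar>r\<bar> \<le> \<delta>" for r using y(3)[OF that] by (simp add: b_def)
    show "(b has_real_derivative \<beta> * b r powr (p - 1) * b r) (at r)" if "\<bar>r\<bar> \<le> \<delta>" for r by (rule db[OF that])
    show "(a has_real_derivative \<alpha> * b r powr (p - 1) * a r) (at r)" if r: "\<bar>r\<bar> \<le> \<delta>" for r
      using DERIV_chain2[OF DERIV_exp DERIV_cmult[OF dL[OF r], of \<alpha>]] unfolding bp[OF r]
      by (simp add: a_def[abs_def] mult.commute)
    fix r :: real
    show "b0 \<le> b r" "b r \<le> b1" if "\<bar>r\<bar> \<le> \<delta>"
      using y[OF that] p unfolding b0_def b1_def b_def by (auto intro!: powr_mono2' divide_nonpos_pos)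
    assume r: "0 \<le> r" "r \<le> \<delta>"
    have aL: "0 \<le> \<alpha> * L r" "\<alpha> * L r \<le> 2 * \<alpha> * r"
      using L[OF r] \<alpha> mult_left_mono[OF L(2)[OF r] \<alpha>] by (auto simp: mult_ac)
    show "1 \<le> a r" using aL by (simp add: a_def)
    have "1 - \<alpha> * L r \<le> exp (- (\<alpha> * L r))" using exp_ge_add_one_self[of "- (\<alpha> * L r)"] by simp
    then have "(1 - \<alpha> * L r) * a r \<le> exp (- (\<alpha> * L r)) * a r" by (intro mult_right_mono) (auto simp: a_def)
    also have "\<dots> = 1" by (simp add: a_def exp_minus)
    finally have "a r \<le> 1 + \<alpha> * L r * a r" by (simp add: algebra_simps)
    also have "\<alpha> * L r * a r \<le> (2 * \<alpha> * r) * exp (2 * \<alpha> * \<delta>)"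
    proof (rule mult_mono[OF aL(2)])
      have "2 * \<alpha> * r \<le> 2 * \<alpha> * \<delta>" using r \<alpha> by (intro mult_left_mono) auto
      then show "a r \<le> exp (2 * \<alpha> * \<delta>)" unfolding a_def using aL(2) by simp
    qed (use r \<alpha> in \<open>auto simp: a_def\<close>)
    finally show "a r \<le> 1 + C * r" by (simp add: C_def mult_ac)
  qed (rule \<delta>)
  then show ?thesis by blast
qed

text \<open>
  A radial solution is lowered by an upper bound for its values at \<open>|x| \<ge> w\<close> and rescaled such that it starts with the value \<open>c\<close> at
  the origin. The equation is invariant under the scaling of time by \<open>w\<^sup>p\<close> when \<open>x\<close> is scaled by \<open>w\<close>, so that
  the loss near the origin is proportional to \<open>T / w\<^sup>p\<close>.
\<close>

lemma spreading_solution: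
  fixes p :: real
  assumes p: "1 < p" "p < 2"
  shows "\<exists>C \<tau>1. C > 0 \<and> \<tau>1 > 0 \<and> (\<forall>c w t0 T. 1 / 2 \<le> c \<and> c \<le> 1 \<and> 0 < w \<and> 0 < T \<and> T \<le> \<tau>1 * w powr p \<longrightarrow>
     (\<exists>h :: (real^'n) \<times> real \<Rightarrow> real. (\<exists>e>0. p_parabolic p (UNIV \<times> {t0 - e<..<t0 + T + e}) h) \<and> (\<forall>x. h (x, t0) \<le> c) \<and>
        (\<forall>x t. w \<le> norm x \<and> t0 \<le> t \<and> t \<le> t0 + T \<longrightarrow> h (x, t) \<le> 0) \<and>
        (\<forall>x t. t0 \<le> t \<and> t \<le> t0 + T \<longrightarrow> c - C * (T / w powr p + (norm x / w) powr (p / (p - 1))) \<le> h (x, t))))"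
proof -
  define \<gamma> where "\<gamma> = (p - 1) / (2 - p)"
  define \<kappa> where "\<kappa> = (p / (2 - p)) powr (p - 1)"
  define s where "s = p / (p - 1)"
  define \<alpha> where "\<alpha> = \<kappa> / \<gamma> * real CARD('n)"
  define \<beta> where "\<beta> = \<kappa> / \<gamma> * (real CARD('n) - p / (2 - p))"
  have \<gamma>: "\<gamma> > 0" using p by (simp add: \<gamma>_def)
  have s: "s > 0" using p by (simp add: s_def)
  have \<alpha>: "\<alpha> \<ge> 0" using \<gamma> by (simp add: \<alpha>_def \<kappa>_def)
  obtain \<delta> C1 b0 b1 a b where rc: "radial_coefficients p \<alpha> \<beta> \<delta> C1 b0 b1 a b"
    using radial_coefficients_exist[OF p(1) \<alpha>] by blast
  have ab: "\<delta> > 0" "C1 \<ge> 0" "b0 > 0" "b1 > 0" "a 0 = 1" "b 0 = 1"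
    "\<And>r. \<bar>r\<bar> \<le> \<delta> \<Longrightarrow> a r > 0" "\<And>r. \<bar>r\<bar> \<le> \<delta> \<Longrightarrow> b r > 0"
    "\<And>r. \<bar>r\<bar> \<le> \<delta> \<Longrightarrow> (a has_real_derivative \<alpha> * b r powr (p - 1) * a r) (at r)"
    "\<And>r. \<bar>r\<bar> \<le> \<delta> \<Longrightarrow> (b has_real_derivative \<beta> * b r powr (p - 1) * b r) (at r)"
    "\<And>r. 0 \<le> r \<Longrightarrow> r \<le> \<delta> \<Longrightarrow> 1 \<le> a r" "\<And>r. 0 \<le> r \<Longrightarrow> r \<le> \<delta> \<Longrightarrow> a r \<le> 1 + C1 * r"
    "\<And>r. \<bar>r\<bar> \<le> \<delta> \<Longrightarrow> b0 \<le> b r" "\<And>r. \<bar>r\<bar> \<le> \<delta> \<Longrightarrow> b r \<le> b1"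
    using rc unfolding radial_coefficients_def by blast+
  define d where "d = (1 + b0) powr (- \<gamma>)"
  have d: "0 < d" "d < 1"
  proof -
    show "0 < d" using ab(3) by (simp add: d_def)
    have "(1 + b0) powr (- \<gamma>) < (1 + b0) powr 0" using ab(3) \<gamma> by (intro powr_less_mono) auto
    then show "d < 1" using ab(3) by (simp add: d_def)
  qed
  define C where "C = \<gamma> * (2 * C1 + b1) / (1 - d)"
  have C: "C > 0" using \<gamma> ab(2,4) d by (simp add: C_def)
  show ?thesis
  proof (rule exI[of _ C], rule exI[of _ "\<delta> / 4"], intro conjI allI impI C)
    show "\<delta> / 4 > 0" using ab(1) by simp
    fix c w t0 T :: real
    assume "1 / 2 \<le> c \<and> c \<le> 1 \<and> 0 < w \<and> 0 < T \<and> T \<le> \<delta> / 4 * w powr p"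
    then have c: "1 / 2 \<le> c" "c \<le> 1" and w: "0 < w" and T: "0 < T" "T \<le> \<delta> / 4 * w powr p" by auto
    \<comment> \<open>\<open>d\<close> bounds the profile for \<open>|x| \<ge> w\<close>; \<open>M\<close> normalizes \<open>h\<close> to the value \<open>c\<close> at the origin, and \<open>s0\<close> is the
      time scale that belongs to amplitude \<open>M\<close> and width \<open>w\<close>\<close>
    define M where "M = c / (1 - d)"
    have M: "M > 0" "1 / 2 \<le> M" "M \<le> 1 / (1 - d)" "M - M * d = c"
    proof -
      show "M > 0" using c d by (simp add: M_def)
      have "1 / 2 * (1 - d) \<le> c" using c d by simp
      then show "1 / 2 \<le> M" using d by (simp add: M_def le_divide_eq)
      show "M \<le> 1 / (1 - d)" using c d by (simp add: M_def divide_right_mono)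
      have "M * (1 - d) = c" using d by (simp add: M_def)
      then show "M - M * d = c" by (simp add: algebra_simps)
    qed
    define a0 where "a0 = M powr (- 1 / \<gamma>)"
    define s0 where "s0 = M powr (2 - p) * w powr p"
    have a0: "a0 > 0" "a0 powr (- \<gamma>) = M" "a0 powr (p - 1) = M powr (- (2 - p))"
    proof -
      show "a0 > 0" using M by (simp add: a0_def)
      show "a0 powr (- \<gamma>) = M" unfolding a0_def powr_powr using M \<gamma> by simp
      have "- 1 / \<gamma> * (p - 1) = - (2 - p)" using p by (simp add: \<gamma>_def field_simps)
      then show "a0 powr (p - 1) = M powr (- (2 - p))" unfolding a0_def powr_powr by simp
    qed
    have s0: "s0 > 0" "w powr p / 2 \<le> s0"
    proof -
      show "s0 > 0" using M w by (simp add: s0_def)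
      have "(1 / 2) powr 1 \<le> (1 / 2) powr (2 - p)" using p by (intro powr_mono') auto
      also have "\<dots> \<le> M powr (2 - p)" using p M by (intro powr_mono2) auto
      finally have "1 / 2 \<le> M powr (2 - p)" by simp
      from mult_right_mono[OF this, of "w powr p"] show "w powr p / 2 \<le> s0" by (simp add: s0_def)
    qed
    define e where "e = s0 * \<delta> / 4"
    have e: "e > 0" using s0 ab(1) by (simp add: e_def)
    have Ts: "T \<le> s0 * \<delta> / 2"
    proof -
      have "T \<le> \<delta> / 2 * (w powr p / 2)" using T(2) by simp
      also have "\<dots> \<le> \<delta> / 2 * s0" using ab(1) s0(2) by (intro mult_left_mono) auto
      finally show ?thesis by (simp add: mult.commute)
    qed
    define r where "r t = (t - t0) / s0" for t
    have r: "\<bar>r t\<bar> \<le> \<delta>" if "t \<in> {t0 - e<..<t0 + T + e}" for t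
    proof -
      have "\<bar>t - t0\<bar> \<le> s0 * \<delta>" using that Ts e s0 ab(1) by (auto simp: e_def abs_le_iff)
      then show ?thesis using s0 by (simp add: r_def abs_divide divide_le_eq mult.commute)
    qed
    define A where "A t = a0 * a (r t)" for t
    define B where "B t = a0 * w powr (- s) * b (r t)" for t
    have dr: "(r has_real_derivative 1 / s0) (at t)" for t
      unfolding r_def[abs_def] using s0 by (auto intro!: derivative_eq_intros)
    have Bp: "B t powr (p - 1) = b (r t) powr (p - 1) / s0" if t: "\<bar>r t\<bar> \<le> \<delta>" for t
    proof -
      have "B t powr (p - 1) = a0 powr (p - 1) * w powr (- s * (p - 1)) * b (r t) powr (p - 1)"
        unfolding B_def using a0 w ab(8)[OF t] by (simp add: powr_mult powr_powr)
      also have "- s * (p - 1) = - p" using p by (simp add: s_def)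
      also have "a0 powr (p - 1) * w powr (- p) = 1 / s0"
        unfolding a0(3) s0_def powr_minus by (simp add: divide_inverse mult.commute)
      finally show ?thesis by simp
    qed
    define h where "h z = (A (snd z) + B (snd z) * norm (fst z) powr s) powr (- \<gamma>) - M * d" for z :: "(real^'n) \<times> real"
    have par: "p_parabolic p (UNIV \<times> {t0 - e<..<t0 + T + e}) h"
      unfolding h_def s_def \<gamma>_def
    proof (rule radial_solution[OF p])
      fix t assume "t \<in> {t0 - e<..<t0 + T + e}"
      note t = r[OF this]
      show "A t > 0" using a0 ab(7)[OF t] by (simp add: A_def)
      show "B t > 0" using a0 w ab(8)[OF t] by (simp add: B_def)
      have "(A has_real_derivative a0 * (\<alpha> * b (r t) powr (p - 1) * a (r t) * (1 / s0))) (at t)"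
        unfolding A_def[abs_def] by (rule DERIV_cmult[OF DERIV_chain2[OF ab(9)[OF t] dr]])
      moreover have "a0 * (\<alpha> * b (r t) powr (p - 1) * a (r t) * (1 / s0)) = \<alpha> * B t powr (p - 1) * A t"
        unfolding Bp[OF t] by (simp add: A_def)
      ultimately show "(A has_real_derivative (p / (2 - p)) powr (p - 1) / ((p - 1) / (2 - p)) * real CARD('n) * B t powr (p - 1) * A t) (at t)"
        unfolding \<alpha>_def \<kappa>_def \<gamma>_def by (simp only:)
      have "(B has_real_derivative a0 * w powr (- s) * (\<beta> * b (r t) powr (p - 1) * b (r t) * (1 / s0))) (at t)"
        unfolding B_def[abs_def] by (rule DERIV_cmult[OF DERIV_chain2[OF ab(10)[OF t] dr]])
      moreover have "a0 * w powr (- s) * (\<beta> * b (r t) powr (p - 1) * b (r t) * (1 / s0)) = \<beta> * B t powr (p - 1) * B t"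
        unfolding Bp[OF t] by (simp add: B_def)
      ultimately show "(B has_real_derivative (p / (2 - p)) powr (p - 1) / ((p - 1) / (2 - p)) * (real CARD('n) - p / (2 - p)) * B t powr (p - 1) * B t) (at t)"
        unfolding \<beta>_def \<kappa>_def \<gamma>_def by (simp only:)
    qed
    define v where "v x t = a (r t) + b (r t) * (norm x / w) powr s" for x :: "real^'n" and t
    have hv: "h (x, t) = M * v x t powr (- \<gamma>) - M * d" if t: "\<bar>r t\<bar> \<le> \<delta>" for x t
    proof -
      have "A t + B t * norm x powr s = a0 * v x t"
        using w by (simp add: A_def B_def v_def powr_divide powr_minus field_simps)
      moreover have "v x t > 0" using ab(7)[OF t] ab(8)[OF t] by (simp add: v_def add_pos_nonneg)
      ultimately show ?thesis using a0 by (simp add: h_def powr_mult)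
    qed
    have rt: "0 \<le> r t" "r t \<le> \<delta>" "\<bar>r t\<bar> \<le> \<delta>" "r t \<le> 2 * (T / w powr p)" if "t0 \<le> t" "t \<le> t0 + T" for t
    proof -
      show 0: "0 \<le> r t" using that s0 by (simp add: r_def)
      show "\<bar>r t\<bar> \<le> \<delta>" using that e by (intro r) auto
      then show "r t \<le> \<delta>" using 0 by simp
      have "r t \<le> T / s0" unfolding r_def using that s0 by (intro divide_right_mono) auto
      also have "\<dots> \<le> T / (w powr p / 2)" using T s0 w by (intro divide_left_mono) auto
      finally show "r t \<le> 2 * (T / w powr p)" by (simp add: mult.commute)
    qed
    have t0: "r t0 = 0" by (simp add: r_def)
    have 1: "h (x, t0) \<le> c" for x
    proof -
      have "1 \<le> v x t0" using ab(5,6) by (simp add: v_def t0)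
      then have "v x t0 powr (- \<gamma>) \<le> 1 powr (- \<gamma>)" using \<gamma> by (intro powr_mono2') auto
      then have "M * v x t0 powr (- \<gamma>) \<le> M * 1" using M by (intro mult_left_mono) auto
      then show ?thesis using hv[of t0 x] ab(1) M(4) by (simp add: t0)
    qed
    have 2: "h (x, t) \<le> 0" if "w \<le> norm x" "t0 \<le> t" "t \<le> t0 + T" for x t
    proof -
      have "1 powr s \<le> (norm x / w) powr s" using that w s by (intro powr_mono2) auto
      then have "b0 * 1 \<le> b (r t) * (norm x / w) powr s"
        using ab(3) ab(13)[OF rt(3)[OF that(2,3)]] by (intro mult_mono) auto
      then have "1 + b0 \<le> v x t" using ab(11)[OF rt(1,2)[OF that(2,3)]] by (simp add: v_def)
      then have "v x t powr (- \<gamma>) \<le> d" unfolding d_def using \<gamma> ab(3) by (intro powr_mono2') auto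
      then have "M * v x t powr (- \<gamma>) \<le> M * d" using M by (intro mult_left_mono) auto
      then show ?thesis unfolding hv[OF rt(3)[OF that(2,3)]] by simp
    qed
    have 3: "c - C * (T / w powr p + (norm x / w) powr s) \<le> h (x, t)" if "t0 \<le> t" "t \<le> t0 + T" for x t
    proof -
      let ?\<rho> = "(norm x / w) powr s"
      note rt' = rt[OF that]
      have v1: "1 \<le> v x t" using ab(11)[OF rt'(1,2)] ab(8)[OF rt'(3)] by (simp add: v_def add_increasing2)
      have "1 - \<gamma> * (v x t - 1) \<le> 1 + (- \<gamma> * ln (v x t))"
        using ln_le_minus_one[of "v x t"] v1 \<gamma> mult_left_mono[of "ln (v x t)" "v x t - 1" \<gamma>] by simp
      also have "\<dots> \<le> exp (- \<gamma> * ln (v x t))" by (rule exp_ge_add_one_self)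
      also have "\<dots> = v x t powr (- \<gamma>)" using v1 by (simp add: powr_def)
      finally have bern: "1 - \<gamma> * (v x t - 1) \<le> v x t powr (- \<gamma>)" .
      have "C1 * r t \<le> C1 * (2 * (T / w powr p))" using ab(2) rt'(4) by (intro mult_left_mono) auto
      then have "C1 * r t \<le> 2 * C1 * (T / w powr p)" by (simp only: mult.assoc mult.left_commute)
      moreover have "b (r t) * ?\<rho> \<le> b1 * ?\<rho>" using ab(14)[OF rt'(3)] by (intro mult_right_mono) auto
      ultimately have "v x t - 1 \<le> 2 * C1 * (T / w powr p) + b1 * ?\<rho>"
        using ab(12)[OF rt'(1,2)] unfolding v_def by linarith
      also have "\<dots> \<le> (2 * C1 + b1) * (T / w powr p + ?\<rho>)"
        using ab(2,4) T by (simp add: algebra_simps)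
      finally have "\<gamma> * (v x t - 1) \<le> \<gamma> * ((2 * C1 + b1) * (T / w powr p + ?\<rho>))" using \<gamma> by (intro mult_left_mono) auto
      then have "M * (\<gamma> * (v x t - 1)) \<le> 1 / (1 - d) * (\<gamma> * ((2 * C1 + b1) * (T / w powr p + ?\<rho>)))"
        using M \<gamma> v1 d by (intro mult_mono) auto
      also have "\<dots> = C * (T / w powr p + ?\<rho>)" by (simp add: C_def)
      finally have "M * (\<gamma> * (v x t - 1)) \<le> C * (T / w powr p + ?\<rho>)" .
      moreover have "M * (1 - \<gamma> * (v x t - 1)) \<le> M * v x t powr (- \<gamma>)" using bern M by (intro mult_left_mono) auto
      ultimately show ?thesis unfolding hv[OF rt'(3)] using M(4) by (simp add: algebra_simps)
    qed
    show "\<exists>h :: (real^'n) \<times> real \<Rightarrow> real. (\<exists>e>0. p_parabolic p (UNIV \<times> {t0 - e<..<t0 + T + e}) h) \<and> (\<forall>x. h (x, t0) \<le> c) \<and>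
        (\<forall>x t. w \<le> norm x \<and> t0 \<le> t \<and> t \<le> t0 + T \<longrightarrow> h (x, t) \<le> 0) \<and>
        (\<forall>x t. t0 \<le> t \<and> t \<le> t0 + T \<longrightarrow> c - C * (T / w powr p + (norm x / w) powr (p / (p - 1))) \<le> h (x, t))"
      unfolding s_def[symmetric]
    proof (rule exI[of _ h], intro conjI allI impI)
      show "\<exists>e>0. p_parabolic p (UNIV \<times> {t0 - e<..<t0 + T + e}) h" using par e by blast
    qed (use 1 2 3 in auto)
  qed
qed

section \<open>The minimum principle for superparabolic functions\<close>

lemma Liminf_gt_nhd:
  fixes u :: "'a::metric_space \<Rightarrow> ereal"
  assumes "c < Liminf (at z within S) u"
  shows "\<exists>e>0. \<forall>y\<in>S. y \<noteq> z \<and> dist y z < e \<longrightarrow> c < u y"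
proof -
  have "eventually (\<lambda>y. c < u y) (at z within S)"
    using assms less_LiminfD by blast
  then show ?thesis unfolding eventually_at by auto
qed

lemma p_superparabolicD:
  assumes "p_superparabolic p \<Theta> u"
  shows "\<And>z. z \<in> \<Theta> \<Longrightarrow> u z \<noteq> - \<infinity>"
    and "\<And>z. z \<in> \<Theta> \<Longrightarrow> u z \<le> Liminf (at z within \<Theta>) u"
    and "\<And>a b t1 t2 h z. t1 < t2 \<Longrightarrow> compactly_contained (box a b \<times> {t1<..<t2}) \<Theta> \<Longrightarrow>
      p_parabolic p (box a b \<times> {t1<..<t2}) h \<Longrightarrow> continuous_on (closure (box a b \<times> {t1<..<t2})) h \<Longrightarrow>
      (\<And>y. y \<in> parabolic_boundary (box a b) t1 t2 \<Longrightarrow> ereal (h y) \<le> u y) \<Longrightarrow>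
      z \<in> box a b \<times> {t1<..<t2} \<Longrightarrow> ereal (h z) \<le> u z"
proof -
  note d = assms[unfolded p_superparabolic_def]
  show "u z \<noteq> - \<infinity>" if "z \<in> \<Theta>" for z
    by (rule bspec[OF conjunct1[OF d] that])
  show "u z \<le> Liminf (at z within \<Theta>) u" if "z \<in> \<Theta>" for z
    by (rule bspec[OF conjunct1[OF conjunct2[OF d]] that])
  note box = conjunct2[OF conjunct2[OF conjunct2[OF d]], THEN spec, THEN spec, THEN spec, THEN spec, THEN spec, THEN mp]
  fix a b t1 t2 h z
  assume a: "t1 < t2" "compactly_contained (box a b \<times> {t1<..<t2}) \<Theta>"
      "p_parabolic p (box a b \<times> {t1<..<t2}) h" "continuous_on (closure (box a b \<times> {t1<..<t2})) h"
      "\<And>y. y \<in> parabolic_boundary (box a b) t1 t2 \<Longrightarrow> ereal (h y) \<le> u y" "z \<in> box a b \<times> {t1<..<t2}"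
  show "ereal (h z) \<le> u z"
    by (rule bspec[OF box[OF conjI[OF a(1) conjI[OF a(2) conjI[OF a(3) conjI[OF a(4) ballI[OF a(5)]]]]]] a(6)])
qed

lemma superparabolic_lsc_sequentially:
  assumes sp: "p_superparabolic p \<Theta> u" and z: "z \<in> \<Theta>" "y \<longlonglongrightarrow> z" and y: "\<And>k. y k \<in> \<Theta>"
    and le: "\<And>k::nat. u (y k) \<le> ereal (c k)" and c: "c \<longlonglongrightarrow> c0"
  shows "u z \<le> ereal c0"
proof (rule ccontr)
  assume "\<not> u z \<le> ereal c0"
  then have "ereal c0 < u z" by simp
  then obtain c1 where c1: "ereal c0 < c1" "c1 < u z" using dense by blast
  have "u z \<le> Liminf (at z within \<Theta>) u" by (rule p_superparabolicD(2)[OF sp z(1)])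
  then have "c1 < Liminf (at z within \<Theta>) u" using c1 by simp
  from Liminf_gt_nhd[OF this] obtain e where e: "e > 0" "\<forall>y\<in>\<Theta>. y \<noteq> z \<and> dist y z < e \<longrightarrow> c1 < u y"
    by blast
  have "eventually (\<lambda>k. dist (y k) z < e) sequentially" using z(2) e(1) by (simp add: tendsto_iff)
  moreover have "eventually (\<lambda>k. ereal (c k) < c1) sequentially"
    by (rule order_tendstoD(2)[OF _ c1(1)]) (simp add: c)
  ultimately have "eventually (\<lambda>k. False) sequentially"
  proof eventually_elim
    case (elim k)
    have "c1 < u (y k)" using e(2) y[of k] elim(1) c1(2) by (cases "y k = z") blast+
    then show ?case using le[of k] elim(2) by simp
  qed
  then show False by simp
qed

lemma compact_subseq:
  fixes S :: "'a::metric_space set"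
  assumes "compact S" "\<And>k::nat. y k \<in> S"
  shows "\<exists>l r. l \<in> S \<and> strict_mono (r :: nat \<Rightarrow> nat) \<and> (y \<circ> r) \<longlonglongrightarrow> l"
  using compact_imp_seq_compact[OF assms(1)] assms(2) unfolding seq_compact_def by blast

text \<open>
  If the infimum of \<open>u\<close> up to time \<open>T\<close> is smaller than \<open>c\<close>, then it is attained on a compact subset of \<open>\<Theta>\<close>. At its earliest time, a point
  farthest from the origin is strictly separated by an affine function from all other points, and
  affine functions are \<open>p\<close>-parabolic: comparing with a small multiple on a box around the point lifts
  the minimum. The lateral sides of the box are handled up to a slightly later time by
  semicontinuity.
\<close>

theorem superparabolic_minimum_principle:
  fixes \<Theta> :: "((real^'n) \<times> real) set"
  assumes p: "1 < p" and \<Theta>: "open \<Theta>" "bounded \<Theta>" and sp: "p_superparabolic p \<Theta> u"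
    and bd: "\<And>\<xi>. \<xi> \<in> frontier \<Theta> \<Longrightarrow> snd \<xi> \<le> T \<Longrightarrow> ereal c \<le> Liminf (at \<xi> within \<Theta>) u"
    and z: "z \<in> \<Theta>" "snd z \<le> T"
  shows "ereal c \<le> u z"
proof (rule ccontr)
  assume "\<not> ereal c \<le> u z"
  then have uz: "u z < ereal c" by simp
  define A where "A = {z \<in> \<Theta>. snd z \<le> T}"
  have zA: "z \<in> A" using z by (simp add: A_def)
  define m where "m = (INF z\<in>A. u z)"
  have m: "m < ereal c" using uz INF_lower[OF zA, of u] unfolding m_def by simp
  have mA: "m \<le> u y" if "y \<in> A" for y unfolding m_def using that by (rule INF_lower)
  \<comment> \<open>a minimizing sequence cannot approach the boundary, where the lower limit of \<open>u\<close> is at least \<open>c\<close>\<close>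
  have lim: "y0 \<in> A \<and> u y0 \<le> m" if y: "\<And>k::nat. y k \<in> A" "y \<longlonglongrightarrow> y0" and uy: "(\<lambda>k. u (y k)) \<longlonglongrightarrow> m" for y y0
  proof -
    have y\<Theta>: "y k \<in> \<Theta>" for k using y(1) by (simp add: A_def)
    have T: "snd y0 \<le> T"
      by (rule LIMSEQ_le_const2[OF tendsto_snd[OF y(2)]]) (use y(1) in \<open>auto simp: A_def\<close>)
    have contra: False if c1: "m < c1" "c1 < Liminf (at y0 within \<Theta>) u" "y0 \<in> \<Theta> \<Longrightarrow> c1 < u y0" for c1
    proof -
      obtain e where e: "e > 0" "\<forall>y\<in>\<Theta>. y \<noteq> y0 \<and> dist y y0 < e \<longrightarrow> c1 < u y"
        using Liminf_gt_nhd[OF c1(2)] by blast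
      have "eventually (\<lambda>k. dist (y k) y0 < e) sequentially" using y(2) e(1) by (simp add: tendsto_iff)
      moreover have "eventually (\<lambda>k. u (y k) < c1) sequentially"
        by (rule order_tendstoD(2)[OF uy c1(1)])
      ultimately have "eventually (\<lambda>k. False) sequentially"
      proof eventually_elim
        case (elim k)
        have "c1 < u (y k)" using e(2) y\<Theta>[of k] elim(1) c1(3) by (cases "y k = y0") auto
        then show ?case using elim(2) by simp
      qed
      then show False by simp
    qed
    have in\<Theta>: "y0 \<in> \<Theta>"
    proof (rule ccontr)
      assume n: "y0 \<notin> \<Theta>"
      have "y0 \<in> closure \<Theta>" unfolding closure_sequential using y\<Theta> y(2) by blast
      then have "y0 \<in> frontier \<Theta>" using n \<Theta>(1) by (simp add: frontier_def interior_open)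
      then have "m < Liminf (at y0 within \<Theta>) u" using bd[of y0] T m by simp
      then obtain c1 where "m < c1" "c1 < Liminf (at y0 within \<Theta>) u" using dense by blast
      then show False using contra n by blast
    qed
    moreover have "u y0 \<le> m"
    proof (rule ccontr)
      assume "\<not> u y0 \<le> m"
      then have "m < u y0" by simp
      then obtain c1 where c1: "m < c1" "c1 < u y0" using dense by blast
      have "u y0 \<le> Liminf (at y0 within \<Theta>) u" by (rule p_superparabolicD(2)[OF sp in\<Theta>])
      from contra[OF c1(1) less_le_trans[OF c1(2) this] c1(2)] show False .
    qed
    ultimately show ?thesis using T by (simp add: A_def)
  qed
  have cl: "compact (closure \<Theta>)" using \<Theta>(2) by simp
  define E where "E = {y \<in> A. u y \<le> m}"
  have Eu: "u y = m" if "y \<in> E" for y using that mA[of y] by (auto simp: E_def)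
  have Ene: "E \<noteq> {}"
  proof -
    obtain v where v: "\<And>k::nat. v k \<in> u ` A" "v \<longlonglongrightarrow> m"
      unfolding m_def using Inf_as_limit[of "u ` A"] zA by auto
    have "\<forall>k. \<exists>y. y \<in> A \<and> v k = u y" using v(1) unfolding image_iff Bex_def by blast
    from choice[OF this] obtain y where y: "\<forall>k. y k \<in> A \<and> v k = u (y k)" by blast
    have "y k \<in> closure \<Theta>" for k using y closure_subset[of \<Theta>] by (auto simp: A_def)
    then obtain y0 r where r: "strict_mono r" "(y \<circ> r) \<longlonglongrightarrow> y0"
      using compact_subseq[OF cl, of y] by blast
    have "v = u \<circ> y" using y by auto
    then have "(\<lambda>k. u ((y \<circ> r) k)) \<longlonglongrightarrow> m" using LIMSEQ_subseq_LIMSEQ[OF v(2) r(1)] by (simp add: o_def)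
    from lim[OF _ r(2) this] have "y0 \<in> E" using y by (auto simp: E_def)
    then show ?thesis by auto
  qed
  then obtain y where y: "y \<in> E" by blast
  have "u y = m" by (rule Eu[OF y])
  moreover have "y \<in> \<Theta>" using y by (simp add: E_def A_def)
  ultimately have "m \<noteq> - \<infinity>" using p_superparabolicD(1)[OF sp, of y] by simp
  moreover have "m \<noteq> \<infinity>" using m by auto
  ultimately have "\<bar>m\<bar> \<noteq> \<infinity>" by (intro ereal_infinity_cases)
  define \<mu> where "\<mu> = real_of_ereal m"
  have \<mu>: "m = ereal \<mu>" unfolding \<mu>_def using ereal_real'[OF \<open>\<bar>m\<bar> \<noteq> \<infinity>\<close>] by (rule sym)
  have E\<Theta>: "E \<subseteq> \<Theta>" by (auto simp: E_def A_def)
  have "closed E"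
    unfolding closed_sequential_limits
  proof (intro allI impI)
    fix y y0 assume y: "(\<forall>k. y k \<in> E) \<and> y \<longlonglongrightarrow> y0"
    have "(\<lambda>k. u (y k)) \<longlonglongrightarrow> m" using y Eu by simp
    then show "y0 \<in> E" using lim[of y y0] y by (auto simp: E_def)
  qed
  moreover have "bounded E" using \<Theta>(2) E\<Theta> bounded_subset by blast
  ultimately have Ec: "compact E" by (simp add: compact_eq_bounded_closed)
  obtain z1 where z1: "z1 \<in> E" "\<And>y. y \<in> E \<Longrightarrow> snd z1 \<le> snd y"
    using continuous_attains_inf[OF Ec Ene continuous_on_snd[OF continuous_on_id]] by auto
  define t0 where "t0 = snd z1"
  have t0T: "t0 \<le> T" using z1(1) by (simp add: t0_def E_def A_def)
  define E0 where "E0 = E \<inter> {y. snd y = t0}"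
  have "closed {y :: (real^'n) \<times> real. snd y = t0}"
    by (rule closed_Collect_eq) (auto intro!: continuous_intros)
  then have E0c: "compact E0" unfolding E0_def using Ec by (rule compact_Int_closed[rotated])
  have "E0 \<noteq> {}" using z1(1) by (auto simp: E0_def t0_def)
  then have "\<exists>x\<in>E0. \<forall>y\<in>E0. norm (fst y) \<le> norm (fst x)"
    using E0c by (intro continuous_attains_sup) (auto intro!: continuous_intros)
  then obtain z0 where z0: "z0 \<in> E0" "\<And>y. y \<in> E0 \<Longrightarrow> norm (fst y) \<le> norm (fst z0)" by blast
  define x0 where "x0 = fst z0"
  have z0eq: "z0 = (x0, t0)" using z0(1) by (auto simp: x0_def E0_def prod_eq_iff)
  define L where "L y = (fst y - x0) \<bullet> x0" for y :: "(real^'n) \<times> real"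
  have Lneg: "L y < 0" if "y \<in> E0" "fst y \<noteq> x0" for y
  proof (rule ccontr)
    assume "\<not> L y < 0"
    then have 1: "x0 \<bullet> x0 \<le> fst y \<bullet> x0" by (simp add: L_def inner_diff_left)
    have "fst y \<bullet> fst y \<le> x0 \<bullet> x0"
      using z0(2)[OF that(1)] by (simp add: x0_def norm_eq_sqrt_inner)
    then have "(fst y - x0) \<bullet> (fst y - x0) \<le> 0" using 1 by (simp add: inner_diff_left inner_diff_right inner_commute)
    then have "fst y - x0 = 0" by (metis inner_gt_zero_iff not_le)
    then show False using that(2) by simp
  qed
  have Lc: "continuous_on S L" for S unfolding L_def by (intro continuous_intros)
  obtain \<rho> where \<rho>: "\<rho> > 0" "ball z0 \<rho> \<subseteq> \<Theta>"
  proof -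
    have "z0 \<in> \<Theta>" using z0(1) E\<Theta> unfolding E0_def by blast
    then show thesis using \<Theta>(1) that unfolding open_contains_ball by blast
  qed
  define r where "r = \<rho> / (2 * (real CARD('n) + 1))"
  have r: "r > 0" using \<rho> by (simp add: r_def)
  define a where "a = (\<chi> i. x0 $ i - r)"
  define b where "b = (\<chi> i. x0 $ i + r)"
  have x0Q: "x0 \<in> box a b" using r by (simp add: mem_box_cart a_def b_def)
  then have clQ: "closure (box a b) = cbox a b" by (intro closure_box) auto
  have cyl: "cbox a b \<times> {t0 - r..t0 + r} \<subseteq> \<Theta>"
  proof
    fix y assume y: "y \<in> cbox a b \<times> {t0 - r..t0 + r}"
    have "norm (fst y - x0) \<le> (\<Sum>i\<in>UNIV. \<bar>(fst y - x0) $ i\<bar>)" by (rule norm_le_l1_cart)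
    also have "\<dots> \<le> (\<Sum>i\<in>(UNIV::'n set). r)"
    proof (rule sum_mono)
      fix i :: 'n
      have "a $ i \<le> fst y $ i" "fst y $ i \<le> b $ i" using y by (auto simp: mem_box_cart)
      then show "\<bar>(fst y - x0) $ i\<bar> \<le> r" by (simp add: a_def b_def abs_le_iff)
    qed
    finally have "norm (fst y - x0) \<le> real CARD('n) * r" by simp
    moreover have "\<bar>snd y - t0\<bar> \<le> r" using y by (auto simp: abs_le_iff)
    moreover have "dist z0 y \<le> norm (fst y - x0) + \<bar>snd y - t0\<bar>"
      using sqrt_sum_squares_le_sum_abs[of "norm (fst y - x0)" "t0 - snd y"]
      by (simp add: z0eq dist_prod_def dist_norm norm_minus_commute abs_minus_commute)
    ultimately have "dist z0 y \<le> (real CARD('n) + 1) * r" by (simp add: distrib_right)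
    also have "\<dots> = \<rho> / 2"
    proof -
      have 1: "q * (\<rho> / (2 * q)) = \<rho> / 2" if "q > 0" for q :: real using that by simp
      show ?thesis unfolding r_def by (rule 1) (simp add: add_nonneg_pos)
    qed
    also have "\<dots> < \<rho>" using \<rho>(1) by simp
    finally show "y \<in> \<Theta>" using \<rho>(2) by auto
  qed
  define Fr where "Fr = frontier (box a b)"
  have Fr: "Fr \<subseteq> cbox a b" "x0 \<notin> Fr" "compact Fr"
  proof -
    show s: "Fr \<subseteq> cbox a b" unfolding Fr_def frontier_def clQ by blast
    show "x0 \<notin> Fr" using x0Q unfolding Fr_def frontier_def interior_open[OF open_box] by blast
    have "bounded Fr" by (rule bounded_subset[OF bounded_cbox s])
    then show "compact Fr" unfolding Fr_def by (simp add: compact_eq_bounded_closed)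
  qed
  define P where "P = cbox a b \<times> {t0 - r} \<union> Fr \<times> {t0 - r..t0}"
  have Pc: "compact P" unfolding P_def using Fr(3) by (intro compact_Un compact_Times) auto
  have PA: "P \<subseteq> A" using cyl Fr(1) r t0T unfolding P_def A_def by (auto simp: subset_iff)
  have P\<Theta>: "P \<subseteq> \<Theta>" using PA by (auto simp: A_def)
  have PE: "L y < 0" if "y \<in> P" "y \<in> E" for y
  proof -
    have "t0 \<le> snd y" using z1(2)[OF that(2)] by (simp add: t0_def)
    then have y: "snd y = t0" "fst y \<in> Fr" using that(1) r by (auto simp: P_def)
    then show ?thesis using Lneg[of y] that(2) Fr(2) by (auto simp: E0_def)
  qed
  obtain \<beta> where \<beta>: "\<beta> > 0" "\<And>y. y \<in> P \<Longrightarrow> y \<in> E \<Longrightarrow> L y + \<beta> < 0"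
  proof (cases "E \<inter> P = {}")
    case True
    then show ?thesis using that[of 1] by auto
  next
    case False
    have "compact (E \<inter> P)" using Ec Pc by (rule compact_Int)
    from continuous_attains_sup[OF this False Lc] obtain y where y: "y \<in> E \<inter> P" "\<And>y'. y' \<in> E \<inter> P \<Longrightarrow> L y' \<le> L y"
      by blast
    have "L y < 0" using PE y(1) by blast
    then show ?thesis using that[of "- L y / 2"] y(2) by fastforce
  qed
  define h where "h \<epsilon> y = \<mu> + \<epsilon> * (L y + \<beta>)" for \<epsilon> y
  have "\<exists>\<epsilon>>0. \<forall>y\<in>P. ereal (h \<epsilon> y) < u y"
  proof (rule ccontr)
    assume no: "\<not> ?thesis"
    have "\<forall>k::nat. \<exists>y. y \<in> P \<and> u y \<le> ereal (h (inverse (real (Suc k))) y)"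
    proof (intro allI)
      fix k :: nat
      have "inverse (real (Suc k)) > 0" by simp
      then have "\<not> (\<forall>y\<in>P. ereal (h (inverse (real (Suc k))) y) < u y)" using no by blast
      then show "\<exists>y. y \<in> P \<and> u y \<le> ereal (h (inverse (real (Suc k))) y)" unfolding not_less[symmetric] by blast
    qed
    from choice[OF this] obtain y where y: "\<forall>k. y k \<in> P \<and> u (y k) \<le> ereal (h (inverse (real (Suc k))) (y k))" by blast
    obtain y0 q where q: "y0 \<in> P" "strict_mono q" "(y \<circ> q) \<longlonglongrightarrow> y0"
      using compact_subseq[OF Pc, of y] y by blast
    have Ly: "(\<lambda>k. L (y (q k))) \<longlonglongrightarrow> L y0"
      using q(3) unfolding L_def o_def by (intro tendsto_intros)
    have "(\<lambda>k. inverse (real (Suc (q k)))) \<longlonglongrightarrow> 0"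
      using LIMSEQ_subseq_LIMSEQ[OF LIMSEQ_inverse_real_of_nat q(2)] by (simp add: o_def)
    then have "(\<lambda>k. h (inverse (real (Suc (q k)))) (y (q k))) \<longlonglongrightarrow> \<mu> + 0 * (L y0 + \<beta>)"
      unfolding h_def by (intro tendsto_intros Ly)
    then have "u y0 \<le> ereal \<mu>"
      using superparabolic_lsc_sequentially[OF sp, of y0 "y \<circ> q" "\<lambda>k. h (inverse (real (Suc (q k)))) (y (q k))" \<mu>] q y P\<Theta>
      by (auto simp: o_def)
    then have "y0 \<in> E" using q(1) PA by (auto simp: E_def \<mu>)
    then have "L y0 < - \<beta>" using \<beta>(2)[OF q(1)] by simp
    then have "eventually (\<lambda>k. L (y (q k)) < - \<beta>) sequentially" using Ly by (intro order_tendstoD(2))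
    then obtain k where "L (y (q k)) < - \<beta>" by (auto simp: eventually_sequentially)
    then have "inverse (real (Suc (q k))) * (L (y (q k)) + \<beta>) < 0" by (intro mult_pos_neg) auto
    then have "h (inverse (real (Suc (q k)))) (y (q k)) < \<mu>" by (simp add: h_def)
    then have "ereal (h (inverse (real (Suc (q k)))) (y (q k))) < ereal \<mu>" by simp
    moreover have "u (y (q k)) \<le> ereal (h (inverse (real (Suc (q k)))) (y (q k)))" "y (q k) \<in> P" using y by blast+
    ultimately have "u (y (q k)) < m" "y (q k) \<in> A" using PA unfolding \<mu> by (blast intro: le_less_trans)+
    then show False using mA[of "y (q k)"] by simp
  qed
  then obtain \<epsilon> where \<epsilon>: "\<epsilon> > 0" "\<And>y. y \<in> P \<Longrightarrow> ereal (h \<epsilon> y) < u y" by blast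
  have hc: "continuous_on S (h \<epsilon>)" for S unfolding h_def by (intro continuous_intros Lc)
  have "\<exists>t2>t0. t2 \<le> t0 + r \<and> (\<forall>y\<in>Fr \<times> {t0 - r..t2}. ereal (h \<epsilon> y) \<le> u y)"
  proof (rule ccontr)
    assume no: "\<not> ?thesis"
    have "\<forall>k::nat. \<exists>y. y \<in> Fr \<times> {t0 - r..t0 + r * inverse (real (Suc k))} \<and> u y \<le> ereal (h \<epsilon> y)"
    proof
      fix k :: nat
      let ?t = "t0 + r * inverse (real (Suc k))"
      have "?t > t0" "?t \<le> t0 + r" using r by (auto simp: field_simps)
      then show "\<exists>y. y \<in> Fr \<times> {t0 - r..?t} \<and> u y \<le> ereal (h \<epsilon> y)" using no unfolding not_le[symmetric] by (metis linear not_le)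
    qed
    from choice[OF this] obtain y where y: "\<forall>k. y k \<in> Fr \<times> {t0 - r..t0 + r * inverse (real (Suc k))} \<and> u (y k) \<le> ereal (h \<epsilon> (y k))" by blast
    have yS: "y k \<in> Fr \<times> {t0 - r..t0 + r}" for k
    proof -
      have "r * inverse (real (Suc k)) \<le> r" using r by (simp add: field_simps)
      then show ?thesis using spec[OF y, of k] by (auto simp: mem_Times_iff)
    qed
    have FrT: "compact (Fr \<times> {t0 - r..t0 + r})" using Fr(3) by (intro compact_Times) auto
    obtain y0 q where q: "y0 \<in> Fr \<times> {t0 - r..t0 + r}" "strict_mono q" "(y \<circ> q) \<longlonglongrightarrow> y0"
      using compact_subseq[OF FrT, of y] yS by blast
    have "snd y0 \<le> t0"
    proof (rule LIMSEQ_le[OF tendsto_snd[OF q(3)]])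
      have "(\<lambda>k. t0 + r * inverse (real (Suc (q k)))) \<longlonglongrightarrow> t0 + r * 0"
        using LIMSEQ_subseq_LIMSEQ[OF LIMSEQ_inverse_real_of_nat q(2)] by (intro tendsto_intros) (simp add: o_def)
      then show "(\<lambda>k. t0 + r * inverse (real (Suc (q k)))) \<longlonglongrightarrow> t0" by simp
      show "\<exists>N. \<forall>k\<ge>N. snd ((y \<circ> q) k) \<le> t0 + r * inverse (real (Suc (q k)))"
        using y by (auto simp: mem_Times_iff)
    qed
    then have y0P: "y0 \<in> P" using q(1) by (auto simp: P_def mem_Times_iff)
    have "(\<lambda>k. h \<epsilon> (y (q k))) \<longlonglongrightarrow> h \<epsilon> y0"
      using q(3) unfolding h_def L_def o_def by (intro tendsto_intros)
    moreover have "y (q k) \<in> \<Theta>" for k using yS[of "q k"] subsetD[OF cyl, of "y (q k)"] Fr(1) by (auto simp: mem_Times_iff)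
    ultimately have "u y0 \<le> ereal (h \<epsilon> y0)"
      using superparabolic_lsc_sequentially[OF sp, of y0 "y \<circ> q" "\<lambda>k. h \<epsilon> (y (q k))" "h \<epsilon> y0"] q(3) y y0P P\<Theta>
      by (auto simp: o_def)
    then show False using \<epsilon>(2)[OF y0P] by simp
  qed
  then obtain t2 where t2: "t2 > t0" "t2 \<le> t0 + r" "\<And>y. y \<in> Fr \<times> {t0 - r..t2} \<Longrightarrow> ereal (h \<epsilon> y) \<le> u y" by blast
  have lt: "t0 - r < t2" using r t2 by simp
  have clo: "closure (box a b \<times> {t0 - r<..<t2}) = cbox a b \<times> {t0 - r..t2}"
    using lt by (simp add: closure_Times clQ)
  have cc: "compactly_contained (box a b \<times> {t0 - r<..<t2}) \<Theta>"
    unfolding compactly_contained_def clo using cyl t2(2) by (auto intro!: compact_Times simp: subset_iff)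
  have heq: "h \<epsilon> = (\<lambda>y. (\<mu> + \<epsilon> * (\<beta> - x0 \<bullet> x0)) + fst y \<bullet> (\<epsilon> *\<^sub>R x0))"
    by (rule ext) (simp add: h_def L_def inner_diff_left algebra_simps)
  have "p_parabolic p (box a b \<times> {t0 - r<..<t2}) (h \<epsilon>)"
    unfolding heq by (rule affine_p_parabolic[OF p]) (simp add: open_Times open_box)
  moreover have "ereal (h \<epsilon> y) \<le> u y" if "y \<in> parabolic_boundary (box a b) (t0 - r) t2" for y
  proof (cases "y \<in> P")
    case True
    then show ?thesis using \<epsilon>(2)[of y] by simp
  next
    case False
    then have "y \<in> Fr \<times> {t0 - r..t2}"
      using that unfolding parabolic_boundary_def clQ Fr_def[symmetric] P_def by (auto simp: mem_Times_iff)
    then show ?thesis by (rule t2(3))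
  qed
  moreover have "continuous_on (closure (box a b \<times> {t0 - r<..<t2})) (h \<epsilon>)" by (rule hc)
  moreover have "z0 \<in> box a b \<times> {t0 - r<..<t2}" using x0Q r t2(1) by (simp add: z0eq)
  ultimately have "ereal (h \<epsilon> z0) \<le> u z0" using p_superparabolicD(3)[OF sp lt cc] by blast
  moreover have "u z0 = ereal \<mu>" using Eu z0(1) \<mu> by (simp add: E0_def)
  moreover have "h \<epsilon> z0 > \<mu>" using \<epsilon>(1) \<beta>(1) by (simp add: h_def L_def z0eq)
  ultimately show False by simp
qed

section \<open>The cusp domain\<close>

definition cusp :: "real \<Rightarrow> real \<Rightarrow> ((real^'n) \<times> real) set" where
  "cusp K q = {(x, t). norm x < K * (- t) powr q \<and> - 1 < t \<and> t < 0}"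

lemma mem_cusp: "z \<in> cusp K q \<longleftrightarrow> norm (fst z) < K * (- snd z) powr q \<and> - 1 < snd z \<and> snd z < 0"
  by (cases z) (simp add: cusp_def)

lemma continuous_on_cusp_radius:
  assumes "0 < q"
  shows "continuous_on UNIV (\<lambda>z::(real^'n) \<times> real. K * (max 0 (- snd z)) powr q)"
proof -
  have "continuous_on UNIV (\<lambda>z::(real^'n) \<times> real. (max 0 (- snd z)) powr q)"
    by (rule continuous_on_powr') (use assms in \<open>auto intro!: continuous_intros\<close>)
  then show ?thesis by (intro continuous_on_mult continuous_on_const)
qed

text \<open>
  On the boundary the function \<open>(- t) powr q\<close> is replaced by its continuous extension \<open>(max 0 (- t)) powr q\<close>,
  which forces \<open>x = 0\<close> when \<open>t = 0\<close>.
\<close>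

lemma cusp_topology:
  assumes K: "0 < K" and q: "0 < q"
  shows "open (cusp K q :: ((real^'n) \<times> real) set)" "bounded (cusp K q :: ((real^'n) \<times> real) set)"
    "closure (cusp K q) \<subseteq> {z :: (real^'n) \<times> real. norm (fst z) \<le> K * (max 0 (- snd z)) powr q \<and> - 1 \<le> snd z \<and> snd z \<le> 0}"
    "(0, 0) \<in> frontier (cusp K q :: ((real^'n) \<times> real) set)"
proof -
  let ?R = "\<lambda>z::(real^'n) \<times> real. K * (max 0 (- snd z)) powr q"
  note cR = continuous_on_cusp_radius[OF q, of K, where 'n = 'n]
  have cn: "continuous_on UNIV (\<lambda>z::(real^'n) \<times> real. norm (fst z))" "continuous_on UNIV (\<lambda>z::(real^'n) \<times> real. snd z)"
    by (intro continuous_intros)+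
  have eq: "cusp K q = {z. norm (fst z) < ?R z} \<inter> ({z. - 1 < snd z} \<inter> {z. snd z < 0})"
    by (auto simp: mem_cusp max_def)
  show o: "open (cusp K q :: ((real^'n) \<times> real) set)"
    unfolding eq by (intro open_Int open_Collect_less cn cR continuous_on_const)
  have cl: "closed ({z. norm (fst z) \<le> ?R z} \<inter> ({z. - 1 \<le> snd z} \<inter> {z. snd z \<le> 0}))"
    by (intro closed_Int closed_Collect_le cn cR continuous_on_const)
  have "cusp K q \<subseteq> {z. norm (fst z) \<le> ?R z} \<inter> ({z. - 1 \<le> snd z} \<inter> {z. snd z \<le> 0})"
    unfolding eq by auto
  from closure_minimal[OF this cl]
  show "closure (cusp K q) \<subseteq> {z :: (real^'n) \<times> real. norm (fst z) \<le> K * (max 0 (- snd z)) powr q \<and> - 1 \<le> snd z \<and> snd z \<le> 0}"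
    by auto
  show "bounded (cusp K q :: ((real^'n) \<times> real) set)"
    unfolding bounded_iff
  proof (intro exI ballI)
    fix z :: "(real^'n) \<times> real" assume z: "z \<in> cusp K q"
    then have "(- snd z) powr q \<le> 1 powr q" using q by (intro powr_mono2) (auto simp: mem_cusp)
    then have "K * (- snd z) powr q \<le> K * 1" using K by (intro mult_left_mono) auto
    then have "norm (fst z) \<le> K" "\<bar>snd z\<bar> \<le> 1" using z by (auto simp: mem_cusp)
    then show "norm z \<le> K + 1" using norm_Pair_le[of "fst z" "snd z"] by simp
  qed
  have axis: "(0, - inverse (real (Suc (Suc k)))) \<in> (cusp K q :: ((real^'n) \<times> real) set)" for k
  proof -
    have "inverse (real (Suc (Suc k))) < 1" by (simp add: field_simps)
    then show ?thesis using K by (simp add: mem_cusp)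
  qed
  have "(\<lambda>k. - inverse (real (Suc (Suc k)))) \<longlonglongrightarrow> - 0"
    by (intro tendsto_minus LIMSEQ_Suc[OF LIMSEQ_inverse_real_of_nat])
  then have "(\<lambda>k. (0, - inverse (real (Suc (Suc k))))) \<longlonglongrightarrow> ((0, 0) :: (real^'n) \<times> real)"
    by (intro tendsto_Pair tendsto_const) simp
  then have "(0, 0) \<in> closure (cusp K q :: ((real^'n) \<times> real) set)"
    unfolding closure_sequential using axis by (intro exI[of _ "\<lambda>k. (0, - inverse (real (Suc (Suc k))))"]) auto
  then show "(0, 0) \<in> frontier (cusp K q :: ((real^'n) \<times> real) set)"
    using o by (simp add: frontier_def interior_open mem_cusp)
qed

section \<open>The barrier\<close>

lemma le_Liminf_of_tendsto:
  assumes "(w \<longlongrightarrow> l) (at z within S)"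
  shows "ereal l \<le> Liminf (at z within S) (\<lambda>y. ereal (w y))"
  unfolding le_Liminf_iff
proof (intro allI impI)
  fix y assume y: "y < ereal l"
  have "((\<lambda>y. ereal (w y)) \<longlongrightarrow> ereal l) (at z within S)" using assms by (rule tendsto_ereal)
  then show "eventually (\<lambda>x. y < ereal (w x)) (at z within S)" using y by (rule order_tendstoD(1))
qed

text \<open>
  The barrier is \<open>w = (- t)\<^bsup>1/(2-p)\<^esup> (A - B |x|\<^bsup>p/(p-1)\<^esup>)\<close>. Both \<open>\<partial>w/\<partial>t\<close> and the divergence of its flux carry the factor \<open>(- t)\<^bsup>(p-1)/(2-p)\<^esup>\<close>;
  the remaining factors grow like \<open>B\<close> and \<open>B\<^sup>p\<^sup>-\<^sup>1\<close>. Since \<open>p < 2\<close>, a small \<open>B\<close> therefore makes \<open>w\<close> a supersolution, and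
  \<open>A = 2 B K\<^bsup>p/(p-1)\<^esup>\<close> keeps it positive on the closure of the domain except at time 0.
\<close>

lemma barrier_exists:
  fixes p K q :: real
  assumes p: "1 < p" "p < 2" and K: "0 < K" and q: "0 < q"
  shows "\<exists>u. traditional_barrier p (cusp K q :: ((real^'n) \<times> real) set) (0, 0) u"
proof -
  define s where "s = p / (p - 1)"
  have s: "s > 2" using p by (simp add: s_def field_simps)
  define g where "g = 1 / (2 - p)"
  have g: "g > 0" "g * (p - 1) = g - 1" using p by (auto simp: g_def field_simps)
  \<comment> \<open>chosen such that \<open>B\<^sup>2\<^sup>-\<^sup>p = m\<close> turns the supersolution inequality at \<open>x = 0\<close> into an equality\<close>
  define m where "m = real CARD('n) * s powr (p - 1) * (2 - p) / (2 * K powr s)"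
  have m: "m > 0" using p s K by (simp add: m_def)
  define B where "B = m powr g"
  have B: "B > 0" "B = m * B powr (p - 1)"
  proof -
    show "B > 0" using m by (simp add: B_def)
    have "m * B powr (p - 1) = m powr 1 * m powr (g - 1)" using m unfolding B_def powr_powr g(2) by simp
    also have "\<dots> = B" unfolding powr_add[symmetric] B_def by simp
    finally show "B = m * B powr (p - 1)" by simp
  qed
  define A where "A = 2 * B * K powr s"
  have gA: "g * A = real CARD('n) * (B * s) powr (p - 1)"
  proof -
    have "g * A = g * (2 * (m * B powr (p - 1)) * K powr s)" unfolding A_def using B(2) by simp
    also have "\<dots> = real CARD('n) * (B powr (p - 1) * s powr (p - 1))"
      unfolding m_def g_def using p K by (simp add: field_simps)
    finally show ?thesis using B s by (simp add: powr_mult)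
  qed
  let ?\<Omega> = "{z :: (real^'n) \<times> real. snd z < 0}"
  define w where "w z = (- snd z) powr g * (A - B * norm (fst z) powr s)" for z :: "(real^'n) \<times> real"
  define wt where "wt z = - (g * (- snd z) powr (g - 1)) * (A - B * norm (fst z) powr s)" for z :: "(real^'n) \<times> real"
  define k where "k z = B * s * (- snd z) powr g" for z :: "(real^'n) \<times> real"
  define wx where "wx z = - (k z * norm (fst z) powr (s - 2)) *\<^sub>R fst z" for z
  define dG where "dG i z = - (k z powr (p - 1))" for i :: 'n and z
  have \<Omega>: "open ?\<Omega>" by (rule open_Collect_less) (auto intro!: continuous_intros)
  have k0: "0 \<le> k z" for z using B s by (simp add: k_def)
  have flux: "p_flux p (wx z) = - (k z powr (p - 1)) *\<^sub>R fst z" for z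
    using p_flux_radial[OF p(1) k0, of z "fst z"] unfolding wx_def s_def .
  have kp: "k z powr (p - 1) = (B * s) powr (p - 1) * (- snd z) powr (g - 1)" for z
    unfolding k_def using B s by (simp add: powr_mult powr_powr g(2))
  have ct: "continuous_on ?\<Omega> (\<lambda>z. (- snd z) powr r)" for r
    by (rule continuous_on_powr) (auto intro!: continuous_intros)
  have cn: "continuous_on ?\<Omega> (\<lambda>z. norm (fst z) powr s)" "continuous_on ?\<Omega> (\<lambda>z. norm (fst z) powr (s - 2))"
    using s by (simp_all add: continuous_on_norm_powr)
  note cintros = continuous_on_diff continuous_on_mult continuous_on_minus continuous_on_scaleR
    continuous_on_const continuous_on_fst[OF continuous_on_id] ct cn
  have cw: "continuous_on ?\<Omega> w" unfolding w_def by (intro cintros)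
  have cwt: "continuous_on ?\<Omega> wt" unfolding wt_def by (intro cintros)
  have ck: "continuous_on ?\<Omega> k" unfolding k_def by (intro cintros)
  have cwx: "continuous_on ?\<Omega> wx" unfolding wx_def by (intro cintros ck)
  have cG: "continuous_on ?\<Omega> (\<lambda>z. p_flux p (wx z))" unfolding flux kp by (intro cintros)
  have cdG: "continuous_on ?\<Omega> (dG i)" for i unfolding dG_def kp by (intro cintros)
  have dN: "has_dir_deriv (\<lambda>z. A - B * norm (fst z) powr s) v z (- (B * d))"
    if "has_dir_deriv (\<lambda>z. norm (fst z) powr s) v z d" for v d and z :: "(real^'n) \<times> real"
    using has_dir_deriv_diff[OF has_dir_deriv_const[of A] has_dir_deriv_mult[OF has_dir_deriv_const[of B] that]] by simp
  have dt: "has_dir_deriv (\<lambda>z. (- snd z) powr g) (0, 1) z (- (g * (- snd z) powr (g - 1)))" if "z \<in> ?\<Omega>" for z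
  proof (rule has_dir_deriv_time(1)[of "\<lambda>t. (- t) powr g"])
    have "((\<lambda>t. (- t) powr g) has_real_derivative (g * (- snd z) powr (g - 1)) * (- 1)) (at (snd z))"
      by (rule DERIV_chain2[OF has_real_derivative_powr]) (use that in \<open>auto intro!: derivative_eq_intros\<close>)
    then show "((\<lambda>t. (- t) powr g) has_real_derivative - (g * (- snd z) powr (g - 1))) (at (snd z))" by simp
  qed
  have dwt: "has_dir_deriv w (0, 1) z (wt z)" if "z \<in> ?\<Omega>" for z
    unfolding w_def wt_def using has_dir_deriv_mult[OF dt[OF that] dN[OF has_dir_deriv_norm_powr(2)[OF s, of z]]] by simp
  have dwx: "has_dir_deriv w (axis i 1, 0) z (wx z $ i)" for z i
    unfolding w_def wx_def k_def
    using has_dir_deriv_mult[OF has_dir_deriv_time(2)[of "\<lambda>t. (- t) powr g" "axis i 1" z] dN[OF has_dir_deriv_norm_powr(1)[OF s, of i z]]]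
    by (simp add: algebra_simps)
  have ddG: "has_dir_deriv (\<lambda>z. p_flux p (wx z) $ i) (axis i 1, 0) z (dG i z)" for z i
    unfolding flux kp dG_def
    using has_dir_deriv_mult[OF has_dir_deriv_time(2)[of "\<lambda>t. - ((B * s) powr (p - 1) * (- t) powr (g - 1))" "axis i 1" z] has_dir_deriv_component[of i z]]
    by simp
  have super: "(\<Sum>i\<in>UNIV. dG i z) \<le> wt z" if "z \<in> ?\<Omega>" for z
  proof -
    have "A - B * norm (fst z) powr s \<le> A" using B by simp
    then have "g * (A - B * norm (fst z) powr s) \<le> g * A" using g by (intro mult_left_mono) auto
    from mult_right_mono[OF this, of "(- snd z) powr (g - 1)"]
    show ?thesis unfolding gA by (simp add: dG_def kp wt_def mult_ac)
  qed
  let ?C = "cusp K q :: ((real^'n) \<times> real) set"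
  note top = cusp_topology[OF K q, where 'n = 'n]
  have C\<Omega>: "?C \<subseteq> ?\<Omega>" by (auto simp: mem_cusp)
  have isCont: "(w \<longlongrightarrow> w z) (at z within ?C)" if "z \<in> ?\<Omega>" for z
    using cw \<Omega> that by (meson continuous_on_eq_continuous_at isCont_def tendsto_within_subset subset_UNIV)
  have wpos: "0 < w z" if "snd z < 0" "- 1 \<le> snd z" "norm (fst z) \<le> K * (- snd z) powr q" for z
  proof -
    have "(- snd z) powr q \<le> 1 powr q" using that q by (intro powr_mono2) auto
    then have "K * (- snd z) powr q \<le> K * 1" using K by (intro mult_left_mono) auto
    then have "norm (fst z) powr s \<le> K powr s" using that s by (intro powr_mono2) auto
    then have "B * norm (fst z) powr s \<le> B * K powr s" using B by (intro mult_left_mono) auto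
    moreover have "B * K powr s > 0" using B K by simp
    ultimately have "A - B * norm (fst z) powr s > 0" unfolding A_def by linarith
    then show ?thesis using that(1) by (simp add: w_def)
  qed
  have sp: "p_superparabolic p ?C (\<lambda>z. ereal (w z))"
    unfolding p_superparabolic_def
  proof (intro conjI ballI allI impI)
    show "ereal (w z) \<le> Liminf (at z within ?C) (\<lambda>z. ereal (w z))" if "z \<in> ?C" for z
      by (rule le_Liminf_of_tendsto[OF isCont]) (use that C\<Omega> in blast)
    show "?C \<subseteq> closure {z \<in> ?C. ereal (w z) \<noteq> \<infinity>}" using closure_subset[of ?C] by simp
    fix a b :: "real^'n" and t1 t2 :: real and h :: "(real^'n) \<times> real \<Rightarrow> real" and z
    assume H: "t1 < t2 \<and> compactly_contained (box a b \<times> {t1<..<t2}) ?C \<and>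
       p_parabolic p (box a b \<times> {t1<..<t2}) h \<and> continuous_on (closure (box a b \<times> {t1<..<t2})) h \<and>
       (\<forall>z\<in>parabolic_boundary (box a b) t1 t2. ereal (h z) \<le> ereal (w z))"
      and z: "z \<in> box a b \<times> {t1<..<t2}"
    have t: "t1 < t2" and cc: "compactly_contained (box a b \<times> {t1<..<t2}) ?C" and par: "p_parabolic p (box a b \<times> {t1<..<t2}) h"
      and hc: "continuous_on (closure (box a b \<times> {t1<..<t2})) h" and hb: "\<And>z. z \<in> parabolic_boundary (box a b) t1 t2 \<Longrightarrow> h z \<le> w z"
      using H by (simp_all del: split_paired_All)
    note cyl = compactly_contained_cylinder[OF cc t]
    have sub: "closure (box a b) \<times> {t1..t2} \<subseteq> ?\<Omega>" using cyl(2) C\<Omega> by (rule subset_trans)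
    have hc': "continuous_on (closure (box a b) \<times> {t1..t2}) h" using hc unfolding cyl(3) .
    have "h z \<le> w z"
      by (rule comparison_with_classical_supersolution[OF p(1) open_box cyl(1) t \<Omega> sub cw cwt cwx cG cdG dwt dwx ddG super par hc' hb z])
    then show "ereal (h z) \<le> ereal (w z)" by simp
  qed simp
  have lim: "((\<lambda>z. ereal (w z)) \<longlongrightarrow> 0) (at (0, 0) within ?C)"
  proof -
    have "(w \<longlongrightarrow> 0) (at (0, 0) within ?C)"
    proof (rule tendsto_sandwich[OF _ _ tendsto_const])
      show "eventually (\<lambda>z. 0 \<le> w z) (at (0, 0) within ?C)"
        unfolding eventually_at_filter by (rule always_eventually) (auto simp: mem_cusp intro!: less_imp_le[OF wpos])
      show "eventually (\<lambda>z. w z \<le> (max 0 (- snd z)) powr g * A) (at (0, 0) within ?C)"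
        unfolding eventually_at_filter
      proof (intro always_eventually allI impI)
        fix z :: "(real^'n) \<times> real" assume "z \<in> ?C"
        then have "max 0 (- snd z) = - snd z" by (simp add: mem_cusp)
        moreover have "(- snd z) powr g * (A - B * norm (fst z) powr s) \<le> (- snd z) powr g * A"
          using B by (intro mult_left_mono) auto
        ultimately show "w z \<le> (max 0 (- snd z)) powr g * A" by (simp add: w_def)
      qed
      have "((\<lambda>z. max 0 (- snd z)) \<longlongrightarrow> max 0 (- snd ((0::real^'n), 0::real))) (at (0, 0) within ?C)"
        by (intro tendsto_intros)
      then have "((\<lambda>z. (max 0 (- snd z)) powr g) \<longlongrightarrow> 0) (at (0, 0) within ?C)"
        by (intro tendsto_zero_powrI[where b = g] tendsto_const) (use g in auto)
      then show "((\<lambda>z. (max 0 (- snd z)) powr g * A) \<longlongrightarrow> 0) (at (0, 0) within ?C)"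
        by (rule tendsto_mult_left_zero)
    qed
    then have "((\<lambda>z. ereal (w z)) \<longlongrightarrow> ereal 0) (at (0, 0) within ?C)" by (rule tendsto_ereal)
    then show ?thesis by (simp add: zero_ereal_def)
  qed
  have front: "0 < Liminf (at \<xi> within ?C) (\<lambda>z. ereal (w z))" if \<xi>: "\<xi> \<in> frontier ?C - {(0, 0)}" for \<xi>
  proof -
    have "\<xi> \<in> closure ?C" using \<xi> by (simp add: frontier_def)
    then have c: "norm (fst \<xi>) \<le> K * (max 0 (- snd \<xi>)) powr q" "- 1 \<le> snd \<xi>" "snd \<xi> \<le> 0" using top(3) by auto
    have neg: "snd \<xi> < 0"
    proof (rule ccontr)
      assume "\<not> snd \<xi> < 0"
      then have "snd \<xi> = 0" using c by simp
      moreover from this have "fst \<xi> = 0" using c(1) by simp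
      ultimately show False using \<xi> by (simp add: prod_eq_iff)
    qed
    then have "0 < w \<xi>" using c by (intro wpos) (auto simp: max_def)
    then have "0 < ereal (w \<xi>)" by simp
    also have "\<dots> \<le> Liminf (at \<xi> within ?C) (\<lambda>z. ereal (w z))"
      by (rule le_Liminf_of_tendsto[OF isCont]) (use neg in simp)
    finally show ?thesis .
  qed
  have "traditional_barrier p ?C (0, 0) (\<lambda>z. ereal (w z))"
    unfolding traditional_barrier_def
  proof (intro conjI ballI sp lim front)
    fix z assume "z \<in> ?C"
    then have "0 < w z" by (intro wpos) (auto simp: mem_cusp)
    then show "0 < ereal (w z)" by simp
  qed
  then show ?thesis by blast
qed

section \<open>Irregularity of the cusp point\<close>

lemma compactly_contained_mono: "compactly_contained S V \<Longrightarrow> V \<subseteq> W \<Longrightarrow> compactly_contained S W"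
  unfolding compactly_contained_def by (meson subset_trans)

text \<open>
  Fewer cylinders are compactly contained in a smaller set.
\<close>

lemma p_parabolic_mono:
  assumes "p_parabolic p W h" "V \<subseteq> W"
  shows "p_parabolic p V h"
proof -
  have c: "continuous_on W h" and ws: "weak_solution p W (\<lambda>z. ereal (h z))"
    using assms(1) unfolding p_parabolic_def by (rule conjunct1, rule conjunct2)
  have "weak_solution p V (\<lambda>z. ereal (h z))"
    unfolding weak_solution_def[of p V]
  proof (rule allI, rule allI, rule allI, rule impI)
    fix U t1 t2
    assume H: "open U \<and> t1 < t2 \<and> compactly_contained (U \<times> {t1<..<t2}) V"
    then have "open U \<and> t1 < t2 \<and> compactly_contained (U \<times> {t1<..<t2}) W"
      using compactly_contained_mono[OF _ assms(2)] by blast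
    from ws[unfolded weak_solution_def, THEN spec, THEN spec, THEN spec, THEN mp, OF this]
    show "in_CL2 U t1 t2 (\<lambda>z. ereal (h z)) \<and>
        (\<exists>g. LpW1p_with_gradient p U t1 t2 (\<lambda>z. ereal (h z)) g \<and>
           (\<forall>\<phi>. test_function (U \<times> {t1<..<t2}) \<phi> \<longrightarrow>
              (LINT z|lebesgue_on (U \<times> {t1<..<t2}).
                 (norm (g z) powr (p - 2) *\<^sub>R g z) \<bullet> space_gradient \<phi> z) -
              (LINT z|lebesgue_on (U \<times> {t1<..<t2}).
                 real_of_ereal (ereal (h z)) * time_derivative \<phi> z) = 0))" .
  qed
  then show ?thesis unfolding p_parabolic_def using continuous_on_subset[OF c assms(2)] by blast
qed

text \<open>
  A cube lies between balls of radius \<open>w\<close> and \<open>\<surd>n w\<close>: comparison is possible on boxes only, while the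
  explicit solutions are radial.
\<close>

lemma cube_norm:
  fixes x :: "real^'n"
  assumes w: "0 \<le> w" and x: "x \<in> cbox (\<chi> i. - w) (\<chi> i. w)"
  shows "norm x \<le> sqrt (real CARD('n)) * w" "x \<notin> box (\<chi> i. - w) (\<chi> i. w) \<Longrightarrow> w \<le> norm x"
proof -
  have xi: "\<bar>x $ i\<bar> \<le> w" for i
  proof -
    have "- w \<le> x $ i" "x $ i \<le> w" using x by (auto simp: mem_box_cart)
    then show ?thesis by (simp add: abs_le_iff)
  qed
  have "(norm x)\<^sup>2 = (\<Sum>i\<in>UNIV. \<bar>x $ i\<bar> ^ 2)"
    unfolding power2_norm_eq_inner inner_vec_def by (simp add: power2_eq_square)
  also have "\<dots> \<le> (\<Sum>i\<in>(UNIV::'n set). w\<^sup>2)"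
    by (intro sum_mono power_mono xi) auto
  also have "\<dots> = (sqrt (real CARD('n)) * w)\<^sup>2" by (simp add: power_mult_distrib)
  finally show "norm x \<le> sqrt (real CARD('n)) * w"
    by (rule power2_le_imp_le) (use w in simp)
  assume "x \<notin> box (\<chi> i. - w) (\<chi> i. w)"
  then obtain i where "\<not> (- w < x $ i \<and> x $ i < w)" by (auto simp: mem_box_cart)
  then have "w \<le> \<bar>x $ i\<bar>" by linarith
  then show "w \<le> norm x" using component_le_norm_cart[of x i] by linarith
qed

lemma eventually_powr_less:
  fixes c d r :: real
  assumes "0 < r" "0 < d"
  shows "eventually (\<lambda>t. c * t powr r < d) (at_right 0)"
proof -
  have "((\<lambda>t::real. t powr r) \<longlongrightarrow> 0) (at_right 0)"
  proof (rule tendsto_zero_powrI[OF _ tendsto_const _ assms(1)])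
    show "((\<lambda>t::real. t) \<longlongrightarrow> 0) (at_right 0)" by (rule tendsto_ident_at)
    show "eventually (\<lambda>t::real. 0 \<le> t) (at_right 0)" by (auto simp: eventually_at_filter)
  qed
  then have "((\<lambda>t::real. c * t powr r) \<longlongrightarrow> 0) (at_right 0)" by (rule tendsto_mult_right_zero)
  then show ?thesis using assms(2) by (rule order_tendstoD(2))
qed

text \<open>
  The lower bound is propagated from time \<open>- \<tau>\<close> to \<open>- \<tau>\<^sup>\<alpha>\<close> by one comparison on a cylinder whose width
  \<open>w\<close> is comparable with \<open>\<tau>\<^sup>\<alpha>\<^sup>q\<close>. Since \<open>q p < 1\<close>, the exponent \<open>\<alpha> > 1\<close> can be chosen with \<open>\<alpha> q p < 1\<close>; then
  the duration \<open>\<tau>\<close> is much shorter than \<open>w\<^sup>p\<close>, and the next cylinder is much narrower than \<open>w\<close>, so that the loss is a positive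
  power \<open>\<tau>\<^sup>\<epsilon>\<close>. The losses are absorbed by the term \<open>D \<tau>\<^sup>\<epsilon>\<close>.
\<close>

lemma upper_class_lower_bound:
  fixes p K q :: real
  assumes p: "1 < p" "p < 2" and K: "0 < K" and q: "0 < q" "q < 1 / p"
  shows "\<exists>\<tau>0>0. \<forall>\<delta>>0. \<exists>\<tau>. 0 < \<tau> \<and> \<tau> < \<delta> \<and> \<tau> < 1 \<and>
    (\<forall>u\<in>upper_class p (cusp K q :: ((real^'n) \<times> real) set) (\<lambda>z. min 1 (- snd z / \<tau>0)). ereal (1 / 2) \<le> u (0, - \<tau>))"
proof -
  obtain C \<tau>1 where C: "C > 0" "\<tau>1 > 0" and sol: "\<And>c w t0 T. 1 / 2 \<le> c \<and> c \<le> 1 \<and> 0 < w \<and> 0 < T \<and> T \<le> \<tau>1 * w powr p \<Longrightarrow>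
     (\<exists>h :: (real^'n) \<times> real \<Rightarrow> real. (\<exists>e>0. p_parabolic p (UNIV \<times> {t0 - e<..<t0 + T + e}) h) \<and> (\<forall>x. h (x, t0) \<le> c) \<and>
        (\<forall>x t. w \<le> norm x \<and> t0 \<le> t \<and> t \<le> t0 + T \<longrightarrow> h (x, t) \<le> 0) \<and>
        (\<forall>x t. t0 \<le> t \<and> t \<le> t0 + T \<longrightarrow> c - C * (T / w powr p + (norm x / w) powr (p / (p - 1))) \<le> h (x, t)))"
    using spreading_solution[OF p, where 'n = 'n] by blast
  let ?C = "cusp K q :: ((real^'n) \<times> real) set"
  note top = cusp_topology[OF K q(1), where 'n = 'n]
  define n where "n = real CARD('n)"
  have n: "n > 0" by (simp add: n_def)
  define s where "s = p / (p - 1)"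
  have s: "s > 0" using p by (simp add: s_def)
  have qp: "0 < q * p" "q * p < 1" using p q by (auto simp: less_divide_eq)
  have q1: "q < 1" using q(2) p by (smt (verit) divide_le_eq_1_pos)
  define \<alpha> where "\<alpha> = (1 + q * p) / (2 * (q * p))"
  have \<alpha>: "\<alpha> > 1"
  proof -
    have "2 * (q * p) < 1 + q * p" using qp by linarith
    then show ?thesis unfolding \<alpha>_def using qp(1) by (subst less_divide_eq_1_pos) auto
  qed
  define \<beta> where "\<beta> = \<alpha> * q * p"
  have \<beta>: "\<beta> < 1"
  proof -
    have "a / (2 * y) * y = a / 2" if "0 < y" for a y :: real using that by simp
    from this[OF qp(1), of "1 + q * p"] have "\<alpha> * (q * p) = (1 + q * p) / 2" unfolding \<alpha>_def .
    then show ?thesis using qp by (simp add: \<beta>_def mult.assoc)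
  qed
  define \<kappa> where "\<kappa> = K / (2 * sqrt n)"
  have \<kappa>: "\<kappa> > 0" "sqrt n * \<kappa> = K / 2" using K n by (auto simp: \<kappa>_def)
  define w where "w \<tau> = \<kappa> * \<tau> powr (\<alpha> * q)" for \<tau>
  define \<mu> where "\<mu> = (\<alpha> - 1) * (\<alpha> * q)"
  have \<mu>: "\<mu> > 0" using \<alpha> q by (simp add: \<mu>_def)
  define \<epsilon> where "\<epsilon> = min (1 - \<beta>) (\<mu> * s)"
  have \<epsilon>: "\<epsilon> > 0" "\<epsilon> \<le> 1 - \<beta>" "\<epsilon> \<le> \<mu> * s" using \<beta> \<mu> s by (auto simp: \<epsilon>_def)
  define C' where "C' = C * (\<kappa> powr (- p) + sqrt n powr s)"
  have C': "C' > 0" using C \<kappa> n by (simp add: C'_def add_pos_nonneg)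
  define D where "D = 2 * C'"
  have D: "D > 0" using C' by (simp add: D_def)
  \<comment> \<open>smallness conditions, each of the form \<open>c \<tau>\<^sup>r < d\<close> with \<open>r > 0\<close>, that make one step possible\<close>
  define G where "G \<tau> \<longleftrightarrow> 0 < \<tau> \<and> \<tau> < 1 \<and> 1 * \<tau> powr (1 - \<beta>) < \<tau>1 * \<kappa> powr p \<and> sqrt n * \<tau> powr \<mu> < 1 \<and>
      D * \<tau> powr \<epsilon> < 1 / 2 \<and> 1 * \<tau> powr ((\<alpha> - 1) * \<epsilon>) < 1 / 2" for \<tau>
  define P where "P u \<tau> \<longleftrightarrow> (\<forall>x::real^'n. norm x \<le> sqrt n * w \<tau> \<longrightarrow> ereal (1 / 2 + D * \<tau> powr \<epsilon>) \<le> u (x, - \<tau>))"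
    for u :: "(real^'n) \<times> real \<Rightarrow> ereal" and \<tau>
  have "eventually G (at_right 0)"
    unfolding G_def
  proof (intro eventually_conj eventually_powr_less)
    show "eventually (\<lambda>\<tau>::real. 0 < \<tau>) (at_right 0)" by (auto simp: eventually_at_filter)
    show "eventually (\<lambda>\<tau>::real. \<tau> < 1) (at_right 0)" by (rule order_tendstoD(2)[OF tendsto_ident_at]) simp
  qed (use \<beta> \<mu> \<epsilon> \<alpha> C \<kappa> in auto)
  then obtain b where b: "b > 0" "\<And>\<tau>. 0 < \<tau> \<Longrightarrow> \<tau> < b \<Longrightarrow> G \<tau>"
    unfolding eventually_at_right_field by auto
  define \<tau>0 where "\<tau>0 = b / 2"
  have \<tau>0: "\<tau>0 > 0" "\<And>\<tau>. 0 < \<tau> \<Longrightarrow> \<tau> \<le> \<tau>0 \<Longrightarrow> G \<tau>" using b by (auto simp: \<tau>0_def)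
  have shrink: "0 < \<tau> powr \<alpha>" "\<tau> powr \<alpha> = \<tau> * \<tau> powr (\<alpha> - 1)" "\<tau> powr (\<alpha> - 1) < 1" "\<tau> powr \<alpha> < \<tau>" if "G \<tau>" for \<tau>
  proof -
    have \<tau>: "0 < \<tau>" "\<tau> < 1" using that by (auto simp: G_def)
    show "0 < \<tau> powr \<alpha>" using \<tau> by simp
    have "\<tau> * \<tau> powr (\<alpha> - 1) = \<tau> powr 1 * \<tau> powr (\<alpha> - 1)" using \<tau> by simp
    then show 1: "\<tau> powr \<alpha> = \<tau> * \<tau> powr (\<alpha> - 1)" unfolding powr_add[symmetric] by simp
    have "\<tau> powr (\<alpha> - 1) < 1 powr (\<alpha> - 1)" using \<tau> \<alpha> by (intro powr_less_mono2) auto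
    then show 2: "\<tau> powr (\<alpha> - 1) < 1" by simp
    show "\<tau> powr \<alpha> < \<tau>" unfolding 1 using mult_strict_left_mono[OF 2 \<tau>(1)] by simp
  qed
  have wq: "sqrt n * w \<tau> = K / 2 * (\<tau> powr \<alpha>) powr q" for \<tau>
    using \<kappa>(2) by (simp add: w_def powr_powr mult.assoc[symmetric])
  \<comment> \<open>a cylinder of width \<open>w \<tau>\<close> stays in the domain until time \<open>- \<tau>\<^sup>\<alpha> / 2\<close>, because \<open>q < 1\<close>\<close>
  have incusp: "(x, t) \<in> ?C" if G: "G \<tau>" and x: "norm x \<le> sqrt n * w \<tau>" and t: "- \<tau> \<le> t" "t \<le> - (\<tau> powr \<alpha> / 2)" for \<tau> x t
  proof -
    note sh = shrink[OF G]
    have "(1 / 2) powr 1 < (1 / 2 :: real) powr q" using q1 by (intro powr_less_mono') auto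
    then have h: "1 / 2 < (1 / 2 :: real) powr q" by simp
    have "(1 / 2) * (\<tau> powr \<alpha>) powr q < (1 / 2) powr q * (\<tau> powr \<alpha>) powr q"
      using mult_strict_right_mono[OF h, of "(\<tau> powr \<alpha>) powr q"] sh(1) by simp
    also have "\<dots> = (\<tau> powr \<alpha> / 2) powr q" using sh(1) by (simp add: powr_mult[symmetric])
    also have "\<dots> \<le> (- t) powr q" using t sh(1) q by (intro powr_mono2) auto
    finally have "K * ((1 / 2) * (\<tau> powr \<alpha>) powr q) < K * (- t) powr q" using K by (intro mult_strict_left_mono)
    then have "norm x < K * (- t) powr q" using x unfolding wq by simp
    moreover have "- 1 < t" using t(1) G by (auto simp: G_def)
    moreover have "t < 0" using t(2) sh(1) by linarith
    ultimately show ?thesis by (simp add: mem_cusp)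
  qed
  have step: "P u (\<tau> powr \<alpha>)" if sp: "p_superparabolic p ?C u" and u0: "\<And>z. z \<in> ?C \<Longrightarrow> 0 \<le> u z" and G: "G \<tau>" and Pu: "P u \<tau>" for u \<tau>
    unfolding P_def
  proof (intro allI impI)
    fix x :: "real^'n" assume x: "norm x \<le> sqrt n * w (\<tau> powr \<alpha>)"
    have \<tau>: "0 < \<tau>" "\<tau> < 1" and G': "\<tau> powr (1 - \<beta>) < \<tau>1 * \<kappa> powr p" "sqrt n * \<tau> powr \<mu> < 1" "D * \<tau> powr \<epsilon> < 1 / 2"
      "\<tau> powr ((\<alpha> - 1) * \<epsilon>) < 1 / 2" using G by (auto simp: G_def)
    note sh = shrink[OF G]
    define T where "T = \<tau> - \<tau> powr \<alpha> / 2"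
    define c where "c = 1 / 2 + D * \<tau> powr \<epsilon>"
    have T: "0 < T" "T \<le> \<tau>" using sh by (auto simp: T_def)
    have w0: "w \<tau> > 0" using \<tau> \<kappa> by (simp add: w_def)
    have wp: "w \<tau> powr p = \<kappa> powr p * \<tau> powr \<beta>"
      using \<kappa> \<tau> by (simp add: w_def powr_mult powr_powr \<beta>_def)
    have \<tau>\<beta>: "\<tau> = \<tau> powr (1 - \<beta>) * \<tau> powr \<beta>"
      unfolding powr_add[symmetric] using \<tau> by simp
    have "\<tau> \<le> (\<tau>1 * \<kappa> powr p) * \<tau> powr \<beta>"
      by (subst \<tau>\<beta>, rule mult_right_mono) (use G' in auto)
    then have Tw: "T \<le> \<tau>1 * w \<tau> powr p" using T wp by simp
    have c: "1 / 2 \<le> c" "c \<le> 1" using D G'(3) \<tau> by (auto simp: c_def)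
    obtain h :: "(real^'n) \<times> real \<Rightarrow> real" where "(\<exists>e>0. p_parabolic p (UNIV \<times> {- \<tau> - e<..<- \<tau> + T + e}) h) \<and> (\<forall>x. h (x, - \<tau>) \<le> c) \<and>
        (\<forall>x t. w \<tau> \<le> norm x \<and> - \<tau> \<le> t \<and> t \<le> - \<tau> + T \<longrightarrow> h (x, t) \<le> 0) \<and>
        (\<forall>x t. - \<tau> \<le> t \<and> t \<le> - \<tau> + T \<longrightarrow> c - C * (T / w \<tau> powr p + (norm x / w \<tau>) powr (p / (p - 1))) \<le> h (x, t))"
      using sol[of c "w \<tau>" T "- \<tau>"] c w0 T(1) Tw by blast
    then obtain e where e: "e > 0" "p_parabolic p (UNIV \<times> {- \<tau> - e<..<- \<tau> + T + e}) h"
      and h1: "\<And>x. h (x, - \<tau>) \<le> c" and h2: "\<And>x t. w \<tau> \<le> norm x \<Longrightarrow> - \<tau> \<le> t \<Longrightarrow> t \<le> - \<tau> + T \<Longrightarrow> h (x, t) \<le> 0"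
      and h3: "\<And>x t. - \<tau> \<le> t \<Longrightarrow> t \<le> - \<tau> + T \<Longrightarrow> c - C * (T / w \<tau> powr p + (norm x / w \<tau>) powr s) \<le> h (x, t)"
      unfolding s_def by blast
    define t2 where "t2 = - (\<tau> powr \<alpha> / 2)"
    have t2: "- \<tau> + T = t2" "- \<tau> < t2" using T by (auto simp: t2_def T_def)
    define Q where "Q = box (\<chi> i. - w \<tau>) (\<chi> i. w \<tau> :: real^'n)"
    define cQ where "cQ = cbox (\<chi> i. - w \<tau>) (\<chi> i. w \<tau> :: real^'n)"
    have Qne: "0 \<in> Q" using w0 by (simp add: Q_def mem_box_cart)
    have clQ: "closure Q = cQ" using Qne unfolding Q_def cQ_def by (intro closure_box) auto
    have QcQ: "Q \<subseteq> cQ" unfolding Q_def cQ_def by (rule box_subset_cbox)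
    have frQ: "y \<in> cQ \<and> y \<notin> Q" if "y \<in> frontier Q" for y
      using that unfolding frontier_def clQ unfolding Q_def interior_open[OF open_box] by blast
    have cQn: "norm y \<le> sqrt n * w \<tau>" "y \<notin> Q \<Longrightarrow> w \<tau> \<le> norm y" if "y \<in> cQ" for y
      using cube_norm[of "w \<tau>" y] w0 that unfolding cQ_def Q_def n_def by auto
    have cyl: "cQ \<times> {- \<tau>..t2} \<subseteq> ?C"
    proof
      fix z assume "z \<in> cQ \<times> {- \<tau>..t2}"
      then have "(fst z, snd z) \<in> ?C" using cQn(1)[of "fst z"] by (intro incusp[OF G]) (auto simp: t2_def)
      then show "z \<in> ?C" by simp
    qed
    have clo: "closure (Q \<times> {- \<tau><..<t2}) = cQ \<times> {- \<tau>..t2}"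
      using t2(2) by (simp add: closure_Times clQ)
    have cc: "compactly_contained (Q \<times> {- \<tau><..<t2}) ?C"
      unfolding compactly_contained_def clo using cyl by (auto intro!: compact_Times simp: cQ_def)
    have par: "p_parabolic p (Q \<times> {- \<tau><..<t2}) h"
      by (rule p_parabolic_mono[OF e(2)]) (use e(1) t2(1) in auto)
    have "continuous_on (UNIV \<times> {- \<tau> - e<..<- \<tau> + T + e}) h" using e(2) unfolding p_parabolic_def by (rule conjunct1)
    then have hc: "continuous_on (closure (Q \<times> {- \<tau><..<t2})) h"
      unfolding clo by (rule continuous_on_subset) (use e(1) t2(1) in auto)
    have bd: "ereal (h y) \<le> u y" if y: "y \<in> parabolic_boundary Q (- \<tau>) t2" for y
    proof -
      have yC: "y \<in> ?C" using y t2(2) frQ cyl unfolding parabolic_boundary_def clQ by (auto simp: subset_iff)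
      from y consider "fst y \<in> cQ" "snd y = - \<tau>" | "fst y \<in> frontier Q" "- \<tau> < snd y" "snd y \<le> t2"
        unfolding parabolic_boundary_def clQ by auto
      then show ?thesis
      proof cases
        case 1
        then have "ereal c \<le> u (fst y, - \<tau>)" using Pu cQn(1) unfolding P_def c_def by blast
        moreover have "ereal (h (fst y, - \<tau>)) \<le> ereal c" using h1 by simp
        moreover have "y = (fst y, - \<tau>)" using 1 by (simp add: prod_eq_iff)
        ultimately show ?thesis by (metis order_trans)
      next
        case 2
        then have "w \<tau> \<le> norm (fst y)" using frQ cQn(2) by blast
        then have "h (fst y, snd y) \<le> 0" using 2 t2(1) by (intro h2) auto
        then have "ereal (h y) \<le> 0" by simp
        then show ?thesis using u0[OF yC] by (rule order_trans)
      qed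
    qed
    have ratio: "norm x / w \<tau> \<le> sqrt n * \<tau> powr \<mu>"
    proof -
      have "w (\<tau> powr \<alpha>) = \<tau> powr \<mu> * w \<tau>"
        by (simp add: w_def powr_powr \<mu>_def powr_add[symmetric] algebra_simps)
      then have "norm x \<le> (sqrt n * \<tau> powr \<mu>) * w \<tau>" using x by (simp add: mult.assoc)
      then show ?thesis using w0 by (simp add: divide_le_eq)
    qed
    have "norm x / w \<tau> < 1" using ratio G'(2) by (rule le_less_trans)
    then have xw: "norm x < w \<tau>" using w0 by (simp add: divide_less_eq)
    have "x \<in> Q"
      unfolding Q_def mem_box_cart
    proof
      fix i
      have "\<bar>x $ i\<bar> < w \<tau>" using component_le_norm_cart[of x i] xw by (rule le_less_trans)
      then show "(\<chi> i. - w \<tau>) $ i < x $ i \<and> x $ i < (\<chi> i. w \<tau>) $ i" by (auto simp: abs_less_iff)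
    qed
    then have "(x, - (\<tau> powr \<alpha>)) \<in> Q \<times> {- \<tau><..<t2}" using sh by (simp add: t2_def)
    from p_superparabolicD(3)[OF sp t2(2) cc[unfolded Q_def] par[unfolded Q_def] hc[unfolded Q_def] bd[unfolded Q_def] this[unfolded Q_def]]
    have uh: "ereal (h (x, - (\<tau> powr \<alpha>))) \<le> u (x, - (\<tau> powr \<alpha>))" .
    have l1: "T / w \<tau> powr p \<le> \<kappa> powr (- p) * \<tau> powr \<epsilon>"
    proof -
      have "T / w \<tau> powr p \<le> \<tau> / w \<tau> powr p" using T w0 by (intro divide_right_mono) auto
      also have "\<dots> = (\<tau> powr (1 - \<beta>) * \<tau> powr \<beta>) / (\<kappa> powr p * \<tau> powr \<beta>)" unfolding wp using \<tau>\<beta> by simp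
      also have "\<dots> = \<kappa> powr (- p) * \<tau> powr (1 - \<beta>)" using \<tau> by (simp add: powr_minus divide_inverse)
      also have "\<dots> \<le> \<kappa> powr (- p) * \<tau> powr \<epsilon>" using \<tau> \<epsilon>(2) by (intro mult_left_mono powr_mono') auto
      finally show ?thesis .
    qed
    have l2: "(norm x / w \<tau>) powr s \<le> sqrt n powr s * \<tau> powr \<epsilon>"
    proof -
      have "(norm x / w \<tau>) powr s \<le> (sqrt n * \<tau> powr \<mu>) powr s" using ratio w0 s by (intro powr_mono2) auto
      also have "\<dots> = sqrt n powr s * \<tau> powr (\<mu> * s)" using n by (simp add: powr_mult powr_powr)
      also have "\<dots> \<le> sqrt n powr s * \<tau> powr \<epsilon>" using \<tau> \<epsilon>(3) by (intro mult_left_mono powr_mono') auto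
      finally show ?thesis .
    qed
    have "C * (T / w \<tau> powr p + (norm x / w \<tau>) powr s) \<le> C * (\<kappa> powr (- p) * \<tau> powr \<epsilon> + sqrt n powr s * \<tau> powr \<epsilon>)"
      using l1 l2 C by (intro mult_left_mono add_mono) auto
    also have "\<dots> = C' * \<tau> powr \<epsilon>" by (simp add: C'_def algebra_simps)
    finally have loss: "C * (T / w \<tau> powr p + (norm x / w \<tau>) powr s) \<le> C' * \<tau> powr \<epsilon>" .
    have "D * (\<tau> powr \<alpha>) powr \<epsilon> = 2 * C' * (\<tau> powr ((\<alpha> - 1) * \<epsilon>) * \<tau> powr \<epsilon>)"
      by (simp add: D_def powr_powr powr_add[symmetric] algebra_simps)
    also have "\<dots> \<le> 2 * C' * (1 / 2 * \<tau> powr \<epsilon>)" using C' G'(4) by (intro mult_left_mono mult_right_mono) auto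
    finally have gain: "D * (\<tau> powr \<alpha>) powr \<epsilon> \<le> C' * \<tau> powr \<epsilon>" by simp
    have "1 / 2 + D * (\<tau> powr \<alpha>) powr \<epsilon> \<le> c - C' * \<tau> powr \<epsilon>" using gain unfolding c_def D_def by simp
    also have "\<dots> \<le> h (x, - (\<tau> powr \<alpha>))"
      using h3[of "- (\<tau> powr \<alpha>)" x] loss sh t2 by (simp add: t2_def)
    finally have "ereal (1 / 2 + D * (\<tau> powr \<alpha>) powr \<epsilon>) \<le> ereal (h (x, - (\<tau> powr \<alpha>)))" by simp
    then show "ereal (1 / 2 + D * (\<tau> powr \<alpha>) powr \<epsilon>) \<le> u (x, - (\<tau> powr \<alpha>))" using uh by (rule order_trans)
  qed
  let ?f = "\<lambda>z::(real^'n) \<times> real. min 1 (- snd z / \<tau>0)"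
  define \<tau>s where "\<tau>s k = ((\<lambda>\<tau>. \<tau> powr \<alpha>) ^^ k) \<tau>0" for k
  have \<tau>s_Suc: "\<tau>s (Suc k) = \<tau>s k powr \<alpha>" for k by (simp add: \<tau>s_def)
  define \<rho> where "\<rho> = \<tau>0 powr (\<alpha> - 1)"
  have G0: "G \<tau>0" using \<tau>0 by simp
  have \<rho>: "0 \<le> \<rho>" "\<rho> < 1" using shrink(3)[OF G0] by (auto simp: \<rho>_def)
  have \<tau>s: "0 < \<tau>s k \<and> \<tau>s k \<le> \<tau>0 \<and> \<tau>s k \<le> \<tau>0 * \<rho> ^ k" for k
  proof (induction k)
    case 0
    then show ?case using \<tau>0(1) by (simp add: \<tau>s_def)
  next
    case (Suc k)
    then have Gk: "G (\<tau>s k)" using \<tau>0(2) by blast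
    note sh = shrink[OF Gk]
    have "\<tau>s k powr (\<alpha> - 1) \<le> \<rho>" unfolding \<rho>_def using Suc \<alpha> by (intro powr_mono2) auto
    then have "\<tau>s k * \<tau>s k powr (\<alpha> - 1) \<le> \<tau>0 * \<rho> ^ k * \<rho>" using Suc \<rho> \<tau>0(1) by (intro mult_mono) auto
    then have "\<tau>s (Suc k) \<le> \<tau>0 * \<rho> ^ Suc k" unfolding \<tau>s_Suc sh(2) by (simp add: mult.commute mult.left_commute)
    moreover have "0 < \<tau>s (Suc k)" "\<tau>s (Suc k) \<le> \<tau>0" using sh(1,4) Suc unfolding \<tau>s_Suc by linarith+
    ultimately show ?case by blast
  qed
  have Gs: "G (\<tau>s k)" for k using \<tau>s \<tau>0(2) by blast
  have lower: "P u (\<tau>s k)" if u: "u \<in> upper_class p ?C ?f" for u k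
  proof -
    have sp: "p_superparabolic p ?C u" and bd: "\<And>\<xi>. \<xi> \<in> frontier ?C \<Longrightarrow> ereal (?f \<xi>) \<le> Liminf (at \<xi> within ?C) u"
      using u unfolding upper_class_def by blast+
    have u0: "0 \<le> u z" if "z \<in> ?C" for z
    proof -
      have "ereal 0 \<le> u z"
      proof (rule superparabolic_minimum_principle[OF p(1) top(1,2) sp _ that, of 0])
        fix \<xi> assume \<xi>: "\<xi> \<in> frontier ?C" "snd \<xi> \<le> 0"
        then have "0 \<le> - snd \<xi> / \<tau>0" using \<tau>0(1) by (intro divide_nonneg_pos) auto
        then have "0 \<le> ?f \<xi>" by (rule min.boundedI[OF zero_le_one])
        then have "ereal 0 \<le> ereal (?f \<xi>)" by (simp only: ereal_less_eq)
        then show "ereal 0 \<le> Liminf (at \<xi> within ?C) u" using bd[OF \<xi>(1)] by (rule order_trans)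
      qed (use that in \<open>simp add: mem_cusp\<close>)
      then show ?thesis by (simp add: zero_ereal_def)
    qed
    have u1: "ereal 1 \<le> u z" if "z \<in> ?C" "snd z \<le> - \<tau>0" for z
    proof (rule superparabolic_minimum_principle[OF p(1) top(1,2) sp _ that])
      fix \<xi> assume \<xi>: "\<xi> \<in> frontier ?C" "snd \<xi> \<le> - \<tau>0"
      then have "1 * \<tau>0 \<le> - snd \<xi>" by simp
      then have "1 \<le> - snd \<xi> / \<tau>0" using \<tau>0(1) by (subst pos_le_divide_eq)
      then have "?f \<xi> = 1" by (rule min_absorb1)
      then show "ereal 1 \<le> Liminf (at \<xi> within ?C) u" using bd[OF \<xi>(1)] by simp
    qed
    show ?thesis
    proof (induction k)
      case 0
      show ?case unfolding P_def
      proof (intro allI impI)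
        fix x :: "real^'n" assume x: "norm x \<le> sqrt n * w (\<tau>s 0)"
        have t: "\<tau>s 0 = \<tau>0" by (simp add: \<tau>s_def)
        have "(x, - \<tau>0) \<in> ?C"
        proof (rule incusp[OF G0])
          show "norm x \<le> sqrt n * w \<tau>0" using x t by simp
          show "- \<tau>0 \<le> - (\<tau>0 powr \<alpha> / 2)" using shrink(1,4)[OF G0] by linarith
        qed simp
        then have "ereal 1 \<le> u (x, - \<tau>0)" by (rule u1) simp
        moreover have "ereal (1 / 2 + D * \<tau>0 powr \<epsilon>) \<le> ereal 1" using G0 by (simp add: G_def)
        ultimately show "ereal (1 / 2 + D * \<tau>s 0 powr \<epsilon>) \<le> u (x, - \<tau>s 0)" unfolding t by (metis order_trans)
      qed
    next
      case (Suc k)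
      then show ?case unfolding \<tau>s_Suc by (intro step[OF sp u0 Gs])
    qed
  qed
  show ?thesis
  proof (rule exI[of _ \<tau>0], intro conjI allI impI)
    show "\<tau>0 > 0" by (rule \<tau>0(1))
    fix \<delta> :: real assume \<delta>: "\<delta> > 0"
    have "(\<lambda>k. \<tau>0 * \<rho> ^ k) \<longlonglongrightarrow> \<tau>0 * 0" using \<rho> by (intro tendsto_mult tendsto_const LIMSEQ_realpow_zero)
    then have "eventually (\<lambda>k. \<tau>0 * \<rho> ^ k < \<delta>) sequentially" using \<delta> by (intro order_tendstoD(2)) auto
    then obtain k where k: "\<tau>0 * \<rho> ^ k < \<delta>" by (auto simp: eventually_sequentially)
    have w0: "0 \<le> sqrt n * w (\<tau>s k)" using n \<kappa> by (simp add: w_def)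
    have "\<forall>u\<in>upper_class p ?C ?f. ereal (1 / 2) \<le> u (0, - \<tau>s k)"
    proof
      fix u assume "u \<in> upper_class p ?C ?f"
      from lower[OF this, of k] have "ereal (1 / 2 + D * \<tau>s k powr \<epsilon>) \<le> u (0, - \<tau>s k)"
        using w0 unfolding P_def by simp
      moreover have "ereal (1 / 2) \<le> ereal (1 / 2 + D * \<tau>s k powr \<epsilon>)" using D by simp
      ultimately show "ereal (1 / 2) \<le> u (0, - \<tau>s k)" by (metis order_trans)
    qed
    moreover have "0 < \<tau>s k" "\<tau>s k < \<delta>" using \<tau>s[of k] k by auto
    moreover have "\<tau>s k < 1" using Gs[of k] by (simp add: G_def)
    ultimately show "\<exists>\<tau>. 0 < \<tau> \<and> \<tau> < \<delta> \<and> \<tau> < 1 \<and> (\<forall>u\<in>upper_class p ?C ?f. ereal (1 / 2) \<le> u (0, - \<tau>))" by blast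
  qed
qed

text \<open>
  The boundary function \<open>min 1 (- t / \<tau>0)\<close> vanishes at the cusp point, but the upper Perron solution is at least \<open>1/2\<close>
  at points of the axis arbitrarily close to it.
\<close>

lemma cusp_irregular:
  fixes p K q :: real
  assumes p: "1 < p" "p < 2" and K: "0 < K" and q: "0 < q" "q < 1 / p"
  shows "irregular_point p (cusp K q :: ((real^'n) \<times> real) set) (0, 0)"
proof -
  let ?C = "cusp K q :: ((real^'n) \<times> real) set"
  obtain \<tau>0 where \<tau>0: "\<tau>0 > 0" "\<forall>\<delta>>0. \<exists>\<tau>. 0 < \<tau> \<and> \<tau> < \<delta> \<and> \<tau> < 1 \<and>
    (\<forall>u\<in>upper_class p ?C (\<lambda>z. min 1 (- snd z / \<tau>0)). ereal (1 / 2) \<le> u (0, - \<tau>))"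
    using upper_class_lower_bound[OF assms, where 'n = 'n] by blast
  let ?f = "\<lambda>z::(real^'n) \<times> real. min 1 (- snd z / \<tau>0)"
  have "\<not> regular_point p ?C (0, 0)"
  proof
    assume reg: "regular_point p ?C (0, 0)"
    have "continuous_on (frontier ?C) ?f" using \<tau>0(1) by (intro continuous_intros) auto
    then have "(upper_Perron p ?C ?f \<longlongrightarrow> ereal (?f (0, 0))) (at (0, 0) within ?C)"
      using reg unfolding regular_point_def by blast
    moreover have "ereal (?f (0, 0)) < ereal (1 / 2)" by simp
    ultimately have "eventually (\<lambda>z. upper_Perron p ?C ?f z < ereal (1 / 2)) (at (0, 0) within ?C)"
      by (rule order_tendstoD(2))
    then obtain d where d: "d > 0" "\<forall>z\<in>?C. z \<noteq> (0, 0) \<and> dist z (0, 0) < d \<longrightarrow> upper_Perron p ?C ?f z < ereal (1 / 2)"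
      unfolding eventually_at by blast
    obtain \<tau> where \<tau>: "0 < \<tau>" "\<tau> < d" "\<tau> < 1" "\<forall>u\<in>upper_class p ?C ?f. ereal (1 / 2) \<le> u (0, - \<tau>)"
      using \<tau>0(2) d(1) by blast
    have "(0, - \<tau>) \<in> ?C" using \<tau> K by (simp add: mem_cusp)
    moreover have "dist (0 :: real^'n, - \<tau>) (0, 0) < d" using \<tau> by (simp add: dist_prod_def)
    ultimately have "upper_Perron p ?C ?f (0, - \<tau>) < ereal (1 / 2)" using d(2) \<tau>(1) by auto
    moreover have "ereal (1 / 2) \<le> upper_Perron p ?C ?f (0, - \<tau>)"
      unfolding upper_Perron_def using \<tau>(4) by (intro INF_greatest) blast
    ultimately show False by simp
  qed
  then show ?thesis
    unfolding irregular_point_def using cusp_topology(4)[OF K q(1)] by blast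
qed

theorem proposition1p2:
  fixes p K q :: real and \<Theta> :: "((real^'n) \<times> real) set"
  assumes "1 < p" "p < 2" "0 < K" "0 < q" "q < 1 / p"
    and "\<Theta> = {(x, t). norm x < K * (- t) powr q \<and> - 1 < t \<and> t < 0}"
  shows "(\<exists>u. traditional_barrier p \<Theta> (0, 0) u) \<and> irregular_point p \<Theta> (0, 0)"
proof -
  have "\<Theta> = cusp K q" unfolding assms(6) cusp_def ..
  then show ?thesis
    using barrier_exists[OF assms(1-4), where 'n = 'n] cusp_irregular[OF assms(1-5), where 'n = 'n] by simp
qed

end
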